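(* For every integer $h\ge 1$, the norm of the signature class $\tau^{\mathbf{R}}_{2h}\in H^2(\mathrm{Sp}_{2h}(\mathbf{R});\mathbf{R})$ of the real symplectic group is $$\lVert\tau^{\mathbf{R}}_{2h}\rVert=h.$$
   Context: $\mathrm{Sp}_{2h}(\mathbf{R})$ is the group of linear automorphisms of $\mathbf{R}^{2h}$ preserving the standard symplectic form, regarded as a discrete group. Its signature class $\tau^{\mathbf{R}}_{2h}$ is the element of $H^2(\mathrm{Sp}_{2h}(\mathbf{R});\mathbf{R})=\operatorname{Hom}(H_2(\mathrm{Sp}_{2h}(\mathbf{R});\mathbf{Z}),\mathbf{R})$ defined as follows. Every class in $H_2(\mathrm{Sp}_{2h}(\mathbf{R});\mathbf{Z})$ is of the form $f_*[\Sigma_g]$ for a map $f\colon\Sigma_g\to B\mathrm{Sp}_{2h}(\mathbf{R})$ from a closed oriented surface; $f$ corresponds to a local coefficient system $E$ on $\Sigma_g$ with fiber $\mathbf{R}^{2h}$ and a parallel symplectic form. Cup product combined with the symplectic form gives a symmetric bilinear pairing $H^1(\Sigma_g;E)\times H^1(\Sigma_g;E)\to H^2(\Sigma_g;\mathbf{R})\cong\mathbf{R}$, and $\tau^{\mathbf{R}}_{2h}(f_*[\Sigma_g])$ is the signature of this form. For a discrete group $\Gamma$ and $\alpha\in H^2(\Gamma;\mathbf{R})$, the (Gromov) norm $\lVert\alpha\rVert\in[0,\infty]$ is the infimum of the sup-norms of real-valued group cocycles (in the standard bar resolution) representing $\alpha$. *)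

theory Defs
  imports "HOL-Analysis.Analysis" "HOL-Algebra.Free_Abelian_Groups"
    "HOL-Library.Extended_Nonnegative_Real"
begin

text \<open>\<open>\<real>\<^sup>2\<^sup>h\<close> is modelled as \<open>\<real>\<^sup>h \<times> \<real>\<^sup>h\<close>, with \<open>h = CARD('h)\<close>.\<close>

type_synonym 'h symp_space = "(real ^ 'h) \<times> (real ^ 'h)"

definition symp_form :: "'h::finite symp_space \<Rightarrow> 'h symp_space \<Rightarrow> real" where
  "symp_form x y = fst x \<bullet> snd y - snd x \<bullet> fst y"

definition Sp :: "('h::finite symp_space \<Rightarrow> 'h symp_space) monoid" where
  "Sp = \<lparr>carrier = {A. linear A \<and> bij A \<and> (\<forall>x y. symp_form (A x) (A y) = symp_form x y)},
         monoid.mult = (\<circ>), one = id\<rparr>"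

text \<open>The low-degree part of the (inhomogeneous) bar complex over \<open>\<int>\<close>; the pair \<open>(x, y)\<close> stands
  for the generator \<open>[x | y]\<close>.\<close>

definition bar_d2 :: "('g, 'm) monoid_scheme \<Rightarrow> ('g \<times> 'g \<Rightarrow>\<^sub>0 int) \<Rightarrow> ('g \<Rightarrow>\<^sub>0 int)" where
  "bar_d2 G = frag_extend (\<lambda>(x, y). frag_of y - frag_of (x \<otimes>\<^bsub>G\<^esub> y) + frag_of x)"

definition bar_d3 ::
    "('g, 'm) monoid_scheme \<Rightarrow> ('g \<times> 'g \<times> 'g \<Rightarrow>\<^sub>0 int) \<Rightarrow> ('g \<times> 'g \<Rightarrow>\<^sub>0 int)" where
  "bar_d3 G = frag_extend (\<lambda>(x, y, z).
     frag_of (y, z) - frag_of (x \<otimes>\<^bsub>G\<^esub> y, z) + frag_of (x, y \<otimes>\<^bsub>G\<^esub> z) - frag_of (x, y))"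

definition bar_H2 :: "('g, 'm) monoid_scheme \<Rightarrow> ('g \<times> 'g \<Rightarrow>\<^sub>0 int) set monoid" where
  "bar_H2 G =
     subgroup_generated (free_Abelian_group (carrier G \<times> carrier G))
       (kernel (free_Abelian_group (carrier G \<times> carrier G)) (free_Abelian_group (carrier G))
          (bar_d2 G))
     Mod (bar_d3 G ` carrier (free_Abelian_group (carrier G \<times> carrier G \<times> carrier G)))"

definition bar_cocycle2 :: "('g, 'm) monoid_scheme \<Rightarrow> ('g \<times> 'g \<Rightarrow> real) \<Rightarrow> bool" where
  "bar_cocycle2 G c \<longleftrightarrow> (\<forall>x\<in>carrier G. \<forall>y\<in>carrier G. \<forall>z\<in>carrier G.
     c (y, z) - c (x \<otimes>\<^bsub>G\<^esub> y, z) + c (x, y \<otimes>\<^bsub>G\<^esub> z) - c (x, y) = 0)"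

definition cochain_eval :: "('b \<Rightarrow> real) \<Rightarrow> ('b \<Rightarrow>\<^sub>0 int) \<Rightarrow> real" where
  "cochain_eval c z = (\<Sum>p\<in>Poly_Mapping.keys z. of_int (Poly_Mapping.lookup z p) * c p)"

text \<open>Classes in \<open>H\<^sup>2(G;\<real>)\<close> are regarded as homomorphisms \<open>H\<^sub>2(G;\<int>) \<rightarrow> \<real>\<close>; a cocycle represents
  such a homomorphism if that is what it induces by evaluation on cycles.\<close>

definition represents_class ::
    "('g, 'm) monoid_scheme \<Rightarrow> ('g \<times> 'g \<Rightarrow> real) \<Rightarrow> (('g \<times> 'g \<Rightarrow>\<^sub>0 int) set \<Rightarrow> real) \<Rightarrow> bool" where
  "represents_class G c \<alpha> \<longleftrightarrow>
     bar_cocycle2 G c \<and> (\<forall>X\<in>carrier (bar_H2 G). \<forall>z\<in>X. cochain_eval c z = \<alpha> X)"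

definition gromov_norm ::
    "('g, 'm) monoid_scheme \<Rightarrow> (('g \<times> 'g \<Rightarrow>\<^sub>0 int) set \<Rightarrow> real) \<Rightarrow> ennreal" where
  "gromov_norm G \<alpha> =
     (INF c\<in>{c. represents_class G c \<alpha>}. SUP p\<in>carrier G \<times> carrier G. ennreal \<bar>c p\<bar>)"

text \<open>A closed oriented surface is given by a finite set \<open>{..<ntri S}\<close> of triangles with ordered
  vertices \<open>0, 1, 2\<close>, whose sides are glued in pairs, preserving the order of the endpoints.
  The side \<open>(t, i)\<close> of the triangle \<open>t\<close> is the one opposite to the vertex \<open>i\<close>, directed from its
  smaller to its larger vertex. Two corners of triangles are the same vertex of the surface iff
  the gluing of sides forces them to be; no condition on vertex links is therefore needed.
  The sign \<open>tri_sign S t\<close> says whether the vertex order of \<open>t\<close> agrees with the orientation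
  of the surface; the fundamental cycle is the sum of the triangles with these signs.\<close>

record tri_surface =
  ntri :: nat
  glue :: "nat \<times> nat \<Rightarrow> nat \<times> nat"
  tri_sign :: "nat \<Rightarrow> int"

definition sides :: "tri_surface \<Rightarrow> (nat \<times> nat) set" where
  "sides S = {..<ntri S} \<times> {..<3}"

definition side_start :: "nat \<Rightarrow> nat" where
  "side_start i = (if i = 0 then 1 else 0)"

definition side_end :: "nat \<Rightarrow> nat" where
  "side_end i = (if i = 2 then 1 else 2)"

definition closed_oriented_surface :: "tri_surface \<Rightarrow> bool" where
  "closed_oriented_surface S \<longleftrightarrow>
     (\<forall>a\<in>sides S. glue S a \<in> sides S \<and> glue S a \<noteq> a \<and> glue S (glue S a) = a) \<and>
     (\<forall>t<ntri S. tri_sign S t = 1 \<or> tri_sign S t = -1) \<and>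
     (\<forall>(t, i)\<in>sides S. \<forall>s j. glue S (t, i) = (s, j) \<longrightarrow>
        (-1) ^ i * tri_sign S t = - ((-1) ^ j * tri_sign S s))"

definition connected_surface :: "tri_surface \<Rightarrow> bool" where
  "connected_surface S \<longleftrightarrow> 0 < ntri S \<and>
     (\<forall>s<ntri S. \<forall>t<ntri S. (s, t) \<in> {(fst a, fst (glue S a)) |a. a \<in> sides S}\<^sup>*)"

text \<open>A local system with structure group \<open>G\<close>, that is, a simplicial map from the surface to the
  nerve \<open>BG\<close>. The label of an edge is the parallel transport along it from the fibre over its
  end to the fibre over its start, so that on a triangle the label of \<open>02\<close> is the product
  of those of \<open>01\<close> and \<open>12\<close>, and the triangle is mapped to the bar simplex
  \<open>[\<phi>(01) | \<phi>(12)]\<close>.\<close>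

definition local_system ::
    "('g, 'm) monoid_scheme \<Rightarrow> tri_surface \<Rightarrow> (nat \<times> nat \<Rightarrow> 'g) \<Rightarrow> bool" where
  "local_system G S \<phi> \<longleftrightarrow>
     (\<forall>a\<in>sides S. \<phi> a \<in> carrier G \<and> \<phi> (glue S a) = \<phi> a) \<and>
     (\<forall>t<ntri S. \<phi> (t, 1) = \<phi> (t, 2) \<otimes>\<^bsub>G\<^esub> \<phi> (t, 0))"

definition pushforward_fundamental_cycle ::
    "tri_surface \<Rightarrow> (nat \<times> nat \<Rightarrow> 'g) \<Rightarrow> ('g \<times> 'g \<Rightarrow>\<^sub>0 int)" where
  "pushforward_fundamental_cycle S \<phi> =
     (\<Sum>t<ntri S. frag_cmul (tri_sign S t) (frag_of (\<phi> (t, 2), \<phi> (t, 0))))"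

text \<open>Cellular cochains with values in the local system. A 0-cochain is a function on corners that
  is compatible with the gluing, a 1-cochain a function on sides that is compatible with the
  gluing; the value of a 1-cochain on an edge lies in the fibre over its start.\<close>

definition cochains0 :: "tri_surface \<Rightarrow> (nat \<times> nat \<Rightarrow> 'v) set" where
  "cochains0 S = {w. \<forall>(t, i)\<in>sides S. \<forall>s j. glue S (t, i) = (s, j) \<longrightarrow>
     w (t, side_start i) = w (s, side_start j) \<and> w (t, side_end i) = w (s, side_end j)}"

definition cochains1 :: "tri_surface \<Rightarrow> (nat \<times> nat \<Rightarrow> 'v::zero) set" where
  "cochains1 S = {u. (\<forall>a\<in>sides S. u (glue S a) = u a) \<and> (\<forall>a. a \<notin> sides S \<longrightarrow> u a = 0)}"

definition cocycles1 ::
    "tri_surface \<Rightarrow> (nat \<times> nat \<Rightarrow> 'v \<Rightarrow> 'v) \<Rightarrow> (nat \<times> nat \<Rightarrow> 'v::real_vector) set" where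
  "cocycles1 S \<phi> =
     {u\<in>cochains1 S. \<forall>t<ntri S. \<phi> (t, 2) (u (t, 0)) - u (t, 1) + u (t, 2) = 0}"

definition coboundary0 ::
    "tri_surface \<Rightarrow> (nat \<times> nat \<Rightarrow> 'v \<Rightarrow> 'v) \<Rightarrow> (nat \<times> nat \<Rightarrow> 'v) \<Rightarrow> (nat \<times> nat \<Rightarrow> 'v::real_vector)" where
  "coboundary0 S \<phi> w = (\<lambda>(t, i).
     if (t, i) \<in> sides S then \<phi> (t, i) (w (t, side_end i)) - w (t, side_start i) else 0)"

definition H1_class ::
    "tri_surface \<Rightarrow> (nat \<times> nat \<Rightarrow> 'v \<Rightarrow> 'v) \<Rightarrow> (nat \<times> nat \<Rightarrow> 'v) \<Rightarrow> (nat \<times> nat \<Rightarrow> 'v::real_vector) set" where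
  "H1_class S \<phi> u = {v. (\<lambda>a. v a - u a) \<in> coboundary0 S \<phi> ` cochains0 S}"

definition H1 ::
    "tri_surface \<Rightarrow> (nat \<times> nat \<Rightarrow> 'v \<Rightarrow> 'v) \<Rightarrow> (nat \<times> nat \<Rightarrow> 'v::real_vector) set set" where
  "H1 S \<phi> = H1_class S \<phi> ` cocycles1 S \<phi>"

text \<open>The Alexander--Whitney cup product of 1-cochains, combined with the symplectic form and
  evaluated on the fundamental cycle.\<close>

definition cup_pairing ::
    "tri_surface \<Rightarrow> (nat \<times> nat \<Rightarrow> 'h::finite symp_space \<Rightarrow> 'h symp_space) \<Rightarrow>
     (nat \<times> nat \<Rightarrow> 'h symp_space) \<Rightarrow> (nat \<times> nat \<Rightarrow> 'h symp_space) \<Rightarrow> real" where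
  "cup_pairing S \<phi> u v =
     (\<Sum>t<ntri S. of_int (tri_sign S t) * symp_form (u (t, 2)) (\<phi> (t, 2) (v (t, 0))))"

definition H1_form ::
    "tri_surface \<Rightarrow> (nat \<times> nat \<Rightarrow> 'h::finite symp_space \<Rightarrow> 'h symp_space) \<Rightarrow>
     (nat \<times> nat \<Rightarrow> 'h symp_space) set \<Rightarrow> (nat \<times> nat \<Rightarrow> 'h symp_space) set \<Rightarrow> real" where
  "H1_form S \<phi> X Y = (THE r. \<forall>u\<in>X. \<forall>v\<in>Y. cup_pairing S \<phi> u v = r)"

text \<open>The signature of the form on \<open>H\<^sup>1\<close>: the number of positive minus the number of
  negative values on the members of an orthogonal basis, here the classes of
  \<open>e 0, \<dots>, e (n - 1)\<close>.\<close>

definition H1_basis ::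
    "tri_surface \<Rightarrow> (nat \<times> nat \<Rightarrow> 'v \<Rightarrow> 'v) \<Rightarrow> nat \<Rightarrow> (nat \<Rightarrow> nat \<times> nat \<Rightarrow> 'v::real_vector) \<Rightarrow> bool" where
  "H1_basis S \<phi> n e \<longleftrightarrow> (\<forall>i<n. e i \<in> cocycles1 S \<phi>) \<and>
     (\<forall>X\<in>H1 S \<phi>. \<exists>!c :: nat \<Rightarrow> real.
        (\<forall>i\<ge>n. c i = 0) \<and> X = H1_class S \<phi> (\<lambda>a. \<Sum>i<n. c i *\<^sub>R e i a))"

definition has_signature ::
    "tri_surface \<Rightarrow> (nat \<times> nat \<Rightarrow> 'h::finite symp_space \<Rightarrow> 'h symp_space) \<Rightarrow> int \<Rightarrow> bool" where
  "has_signature S \<phi> s \<longleftrightarrow> (\<exists>n e. H1_basis S \<phi> n e \<and>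
     (\<forall>i<n. \<forall>j<n. i \<noteq> j \<longrightarrow> H1_form S \<phi> (H1_class S \<phi> (e i)) (H1_class S \<phi> (e j)) = 0) \<and>
     s = int (card {i. i < n \<and> H1_form S \<phi> (H1_class S \<phi> (e i)) (H1_class S \<phi> (e i)) > 0})
       - int (card {i. i < n \<and> H1_form S \<phi> (H1_class S \<phi> (e i)) (H1_class S \<phi> (e i)) < 0}))"

definition signature_class ::
    "(('h::finite symp_space \<Rightarrow> 'h symp_space) \<times> ('h symp_space \<Rightarrow> 'h symp_space) \<Rightarrow>\<^sub>0 int) set \<Rightarrow> real"
  where
  "signature_class X = (THE r. \<exists>S \<phi> s. closed_oriented_surface S \<and> connected_surface S \<and>
     local_system Sp S \<phi> \<and> pushforward_fundamental_cycle S \<phi> \<in> X \<and>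
     has_signature S \<phi> s \<and> r = of_int s)"

end

theory Submission
  imports Defs "HOL-Library.Function_Algebras"
begin

text \<open>
  Fix the Lagrangian subspace \<open>L = \<real>\<^sup>h \<times> 0\<close>. The Maslov cocycle \<open>m(x, y)\<close> is the signature of the form
  \<open>\<omega>(w\<^sub>0, w\<^sub>1)\<close> on the triples in \<open>L \<times> x L \<times> x y L\<close> with sum zero; as \<open>w\<^sub>0 = 0\<close> makes the form vanish,
  its absolute value is at most \<open>dim L = h\<close>.

  It represents the signature class: on a triangulated surface with local system, a section of \<open>L\<close>
  over the flags (side, endpoint) has a difference across each side and a difference across each
  corner of a triangle. When it closes up in every triangle, the first is a twisted 1-cocycle, the
  second a tuple of triples as above, and the cup product form and the sum of the Maslov forms agree
  on them. The resulting relation between the two spaces is Lagrangian, so that the signatures are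
  equal. Applied to the boundary of a tetrahedron, this is the cocycle identity; and as every class
  in \<open>H\<^sub>2\<close> comes from a connected surface, \<open>m\<close> represents the signature class.

  For the lower bound, a cocycle \<open>c\<close> representing the same class as \<open>m\<close> differs from it by the
  coboundary of a function on the commutator subgroup. This function is bounded on the unipotent
  elements, each of which is a single commutator, and smearing the two ideal triangles of a thrice-punctured sphere over its
  cusps gives \<open>2 N\<^sup>3\<close> simplices on which \<open>m\<close> is extremal and whose boundaries cancel up to \<open>O(N\<^sup>2)\<close>.
\<close>

text \<open>That the relation is isotropic is a computation in each triangle; the obstacle is its
  maximality. A pair orthogonal to the relation is realized, up to radical terms, by a flag section
  that need not take values in \<open>L\<close>: only its differences at the corners do. The
  comparison of the two forms is therefore proved for all such sections. For the lower bound, a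
  primitive of the bounded cocycle \<open>c - m\<close> has no reason to be bounded. On a single
  commutator it is, because such an element is the boundary of a chain of only three bar simplices.
  Under the diagonal action of \<open>SL_2\<close>, with \<open>L\<close> as the point at infinity
  of a projective line, the Maslov form is \<open>h\<close> copies of a form of rank one, so that it
  reaches its bound on every nondegenerate triangle. Smearing turns the edges of one triangle into
  families indexed by powers at the cusps; these cancel between neighbouring indices, and only the
  ends of the index ranges survive. As \<open>c\<close> has trace -2, only its even powers are
  unipotent, which makes the ranges even.\<close>

instantiation "fun" :: (type, real_vector) real_vector
begin
definition scaleR_fun :: "real \<Rightarrow> ('a \<Rightarrow> 'b) \<Rightarrow> 'a \<Rightarrow> 'b"
  where "scaleR_fun r f = (\<lambda>x. r *\<^sub>R f x)"
instance
  by standard (simp_all add: scaleR_fun_def fun_eq_iff algebra_simps)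
end

lemma scaleR_fun_apply [simp]: "(r *\<^sub>R f) x = r *\<^sub>R f x"
  by (simp add: scaleR_fun_def)

lemma sum_fun_apply: "(\<Sum>i\<in>I. f i) x = (\<Sum>i\<in>I. f i x)"
  for f :: "'i \<Rightarrow> 'a \<Rightarrow> 'b::comm_monoid_add"
  by (induction I rule: infinite_finite_induct) auto

section \<open>Signatures of symmetric bilinear forms\<close>

text \<open>Gaussian elimination: the unknown \<open>j0\<close> is solved from the equation
  \<open>i0\<close>, and \<open>M'\<close> is the system after substitution. This replaces dimension
  counts below, where the spaces are mere sets of functions.\<close>

lemma underdetermined:
  fixes M :: "'i \<Rightarrow> 'j \<Rightarrow> real"
  assumes "finite I" "finite J" "card I < card J"
  shows "\<exists>c. (\<exists>j\<in>J. c j \<noteq> 0) \<and> (\<forall>i\<in>I. (\<Sum>j\<in>J. c j * M i j) = 0)"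
  using assms
proof (induction I arbitrary: M J rule: finite_induct)
  case empty
  then have "J \<noteq> {}" by auto
  then show ?case by (auto intro!: exI[of _ "\<lambda>_. 1"])
next
  case (insert i0 I)
  show ?case
  proof (cases "\<forall>j\<in>J. M i0 j = 0")
    case True
    obtain c where "\<exists>j\<in>J. c j \<noteq> 0" "\<forall>i\<in>I. (\<Sum>j\<in>J. c j * M i j) = 0"
      using insert.IH[of J M] insert.prems insert.hyps by (metis Suc_lessD card_insert_disjoint)
    then show ?thesis using True by (intro exI[of _ c]) auto
  next
    case False
    then obtain j0 where j0: "j0 \<in> J" "M i0 j0 \<noteq> 0" by auto
    define J' where "J' = J - {j0}"
    have J': "finite J'" "j0 \<notin> J'" "J = insert j0 J'" "card I < card J'"
      using insert j0 by (auto simp: J'_def)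
    define M' where "M' i j = M i j - M i0 j / M i0 j0 * M i j0" for i j
    obtain c where c: "\<exists>j\<in>J'. c j \<noteq> 0" "\<forall>i\<in>I. (\<Sum>j\<in>J'. c j * M' i j) = 0"
      using insert.IH[of J' M'] J' by blast
    define c' where "c' = c(j0 := - (\<Sum>j\<in>J'. c j * M i0 j) / M i0 j0)"
    have sum: "(\<Sum>j\<in>J. c' j * M i j) = c' j0 * M i j0 + (\<Sum>j\<in>J'. c j * M i j)" for i
    proof -
      have "(\<Sum>j\<in>J'. c' j * M i j) = (\<Sum>j\<in>J'. c j * M i j)"
        by (rule sum.cong) (use J' in \<open>auto simp: c'_def\<close>)
      then show ?thesis using J' by simp
    qed
    have "(\<Sum>j\<in>J. c' j * M i0 j) = 0"
      unfolding sum using j0 by (simp add: c'_def)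
    moreover have "(\<Sum>j\<in>J. c' j * M i j) = 0" if "i \<in> I" for i
    proof -
      have "0 = (\<Sum>j\<in>J'. c j * M i j - (c j * M i0 j) * (M i j0 / M i0 j0))"
        using c(2) that by (auto simp: M'_def field_simps)
      also have "\<dots> = (\<Sum>j\<in>J'. c j * M i j) - (\<Sum>j\<in>J'. c j * M i0 j) * (M i j0 / M i0 j0)"
        by (simp add: sum_subtractf sum_distrib_right sum_divide_distrib)
      finally show ?thesis unfolding sum by (simp add: c'_def)
    qed
    moreover have "\<exists>j\<in>J. c' j \<noteq> 0"
      using c(1) J' by (auto simp: c'_def intro!: bexI)
    ultimately show ?thesis by auto
  qed
qed

text \<open>Linear independence in the quotient by \<open>R\<close>, without forming the quotient.
  In the applications \<open>R\<close> is a radical or a space of coboundaries.\<close>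

definition independent_mod :: "'a::real_vector set \<Rightarrow> 'a set \<Rightarrow> bool" where
  "independent_mod R F \<longleftrightarrow> finite F \<and> (\<forall>c. (\<Sum>x\<in>F. c x *\<^sub>R x) \<in> R \<longrightarrow> (\<forall>x\<in>F. c x = 0))"

text \<open>An independent family of greatest size exists by \<open>bound\<close> and spans modulo
  \<open>R\<close>: a vector outside its span could be adjoined.\<close>

lemma maximal_independent_mod:
  assumes R: "subspace R"
    and bound: "\<And>F. F \<subseteq> I \<Longrightarrow> independent_mod R F \<Longrightarrow> card F \<le> m"
  shows "\<exists>F\<subseteq>I. independent_mod R F \<and> (\<forall>i\<in>I. \<exists>c. i - (\<Sum>x\<in>F. c x *\<^sub>R x) \<in> R)"
proof -
  have "\<exists>F. (F \<subseteq> I \<and> independent_mod R F) \<and>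
      (\<forall>G. G \<subseteq> I \<and> independent_mod R G \<longrightarrow> card G \<le> card F)"
    by (rule ex_has_greatest_nat[where k = "{}" and b = "Suc m"])
      (use bound in \<open>auto simp: independent_mod_def less_Suc_eq_le\<close>)
  then obtain F where F: "F \<subseteq> I" "independent_mod R F"
    and max: "\<And>G. G \<subseteq> I \<Longrightarrow> independent_mod R G \<Longrightarrow> card G \<le> card F"
    by blast
  have fin: "finite F" using F by (simp add: independent_mod_def)
  have "\<exists>c. i - (\<Sum>x\<in>F. c x *\<^sub>R x) \<in> R" if i: "i \<in> I" for i
  proof (cases "i \<in> F")
    case True
    have "(\<Sum>x\<in>F. (if x = i then 1 else 0) *\<^sub>R x) = (\<Sum>x\<in>F. if x = i then x else 0)"
      by (rule sum.cong) auto
    also have "\<dots> = i" using True fin by simp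
    finally show ?thesis
      using subspace_0[OF R] by (intro exI[of _ "\<lambda>x. if x = i then 1 else 0"]) simp
  next
    case False
    have "\<not> independent_mod R (insert i F)"
      using max[of "insert i F"] False fin F i by auto
    then obtain c x where c: "(\<Sum>x\<in>insert i F. c x *\<^sub>R x) \<in> R" "x \<in> insert i F" "c x \<noteq> 0"
      using fin by (auto simp: independent_mod_def)
    have eq: "(\<Sum>x\<in>insert i F. c x *\<^sub>R x) = c i *\<^sub>R i + (\<Sum>x\<in>F. c x *\<^sub>R x)"
      using False fin by simp
    have ci: "c i \<noteq> 0"
    proof
      assume "c i = 0"
      then have "(\<Sum>x\<in>F. c x *\<^sub>R x) \<in> R" using c(1) eq by simp
      then show False using c(2,3) F(2) \<open>c i = 0\<close> by (auto simp: independent_mod_def)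
    qed
    have "(1 / c i) *\<^sub>R (c i *\<^sub>R i + (\<Sum>x\<in>F. c x *\<^sub>R x)) \<in> R"
      using c(1) eq R by (simp add: subspace_scale)
    also have "(1 / c i) *\<^sub>R (c i *\<^sub>R i + (\<Sum>x\<in>F. c x *\<^sub>R x)) = i - (\<Sum>x\<in>F. (- c x / c i) *\<^sub>R x)"
      using ci by (simp add: scaleR_add_right scaleR_sum_right sum_negf)
    finally show ?thesis by (intro exI[of _ "\<lambda>x. - c x / c i"])
  qed
  with F show ?thesis by blast
qed

text \<open>Symmetry is asked on \<open>A\<close> only: the cup product is symmetric on cocycles,
  the Maslov form on closed triples, and neither is symmetric on the whole type.\<close>

locale sym_form =
  fixes A :: "'a::real_vector set" and B :: "'a \<Rightarrow> 'a \<Rightarrow> real"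
  assumes subsp: "subspace A" and bil: "bilinear B"
    and sym: "\<And>x y. x \<in> A \<Longrightarrow> y \<in> A \<Longrightarrow> B x y = B y x"

definition orthonormal_pair :: "'a::real_vector set \<Rightarrow> ('a \<Rightarrow> 'a \<Rightarrow> real) \<Rightarrow> 'a set \<Rightarrow> 'a set \<Rightarrow> bool"
  where "orthonormal_pair A B P N \<longleftrightarrow> finite P \<and> finite N \<and> P \<subseteq> A \<and> N \<subseteq> A \<and>
    (\<forall>x\<in>P. \<forall>y\<in>P. B x y = (if x = y then 1 else 0)) \<and>
    (\<forall>x\<in>N. \<forall>y\<in>N. B x y = (if x = y then - 1 else 0)) \<and>
    (\<forall>x\<in>P. \<forall>y\<in>N. B x y = 0)"

text \<open>The radical gets no basis here. The orthogonal complement of \<open>P\<close> and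
  \<open>N\<close> only has to be isotropic, and by polarization it is then the radical.\<close>

definition diagonalizes :: "'a::real_vector set \<Rightarrow> ('a \<Rightarrow> 'a \<Rightarrow> real) \<Rightarrow> 'a set \<Rightarrow> 'a set \<Rightarrow> bool"
  where "diagonalizes A B P N \<longleftrightarrow> orthonormal_pair A B P N \<and>
    (\<forall>a\<in>A. (\<forall>x\<in>P \<union> N. B a x = 0) \<longrightarrow> B a a = 0)"

definition radical :: "'a set \<Rightarrow> ('a \<Rightarrow> 'a \<Rightarrow> real) \<Rightarrow> 'a set" where
  "radical A B = {x\<in>A. \<forall>a\<in>A. B x a = 0}"

lemma bilinear_sum_right:
  fixes B :: "'a::real_vector \<Rightarrow> 'b::real_vector \<Rightarrow> real"
  assumes "bilinear B"
  shows "B a (\<Sum>x\<in>F. c x *\<^sub>R f x) = (\<Sum>x\<in>F. c x * B a (f x))"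
proof -
  have "linear (B a)" using assms by (simp add: bilinear_def)
  then show ?thesis by (simp add: linear_sum linear_scale)
qed

lemma bilinear_sum_left:
  fixes B :: "'a::real_vector \<Rightarrow> 'b::real_vector \<Rightarrow> real"
  assumes "bilinear B"
  shows "B (\<Sum>x\<in>F. c x *\<^sub>R f x) a = (\<Sum>x\<in>F. c x * B (f x) a)"
proof -
  have "linear (\<lambda>x. B x a)" using assms by (simp add: bilinear_def)
  then show ?thesis by (simp add: linear_sum[of "\<lambda>x. B x a"] linear_scale[of "\<lambda>x. B x a"])
qed

lemma bilinear_uminus: "bilinear B \<Longrightarrow> bilinear (\<lambda>x y. - B x y)"
  for B :: "'a::real_vector \<Rightarrow> 'b::real_vector \<Rightarrow> real"
  by (simp add: bilinear_def linear_iff algebra_simps)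

section \<open>Orthogonal decompositions and the Lagrangian criterion for signature zero\<close>

context sym_form
begin

lemmas add_left = bilinear_ladd[OF bil] and add_right = bilinear_radd[OF bil]
  and diff_left = bilinear_lsub[OF bil] and diff_right = bilinear_rsub[OF bil]
  and scale_left = bilinear_lmul[OF bil] and scale_right = bilinear_rmul[OF bil]
  and sum_left = bilinear_sum_left[OF bil] and sum_right = bilinear_sum_right[OF bil]

lemma sum_mem: "F \<subseteq> A \<Longrightarrow> (\<Sum>x\<in>F. c x *\<^sub>R x) \<in> A"
  using subsp by (intro subspace_sum) (auto simp: subspace_scale)

lemma subspace_radical: "subspace (radical A B)"
  using subsp unfolding radical_def
  by (auto simp: subspace_def add_left scale_left bilinear_lzero[OF bil])

lemma uminus: "sym_form A (\<lambda>x y. - B x y)"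
  by unfold_locales (use subsp sym bilinear_uminus[OF bil] in auto)

lemma diagonalizes_uminus:
  "diagonalizes A B P N \<Longrightarrow> diagonalizes A (\<lambda>x y. - B x y) N P"
  unfolding diagonalizes_def orthonormal_pair_def
  by (auto split: if_splits simp: subset_iff) (metis sym)

lemma orthonormal_coeffs:
  assumes "orthonormal_pair A B P N"
  shows "x \<in> P \<Longrightarrow> B (\<Sum>x\<in>P. c x *\<^sub>R x) x = c x"
    and "y \<in> N \<Longrightarrow> B (\<Sum>x\<in>P. c x *\<^sub>R x) y = 0"
    and "x \<in> P \<Longrightarrow> B (\<Sum>y\<in>N. c y *\<^sub>R y) x = 0"
    and "y \<in> N \<Longrightarrow> B (\<Sum>y\<in>N. c y *\<^sub>R y) y = - c y"
proof -
  note o = assms[unfolded orthonormal_pair_def]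
  show "B (\<Sum>x\<in>P. c x *\<^sub>R x) x = c x" if "x \<in> P" for x
  proof -
    have "(\<Sum>z\<in>P. c z * B z x) = (\<Sum>z\<in>P. if z = x then c z else 0)"
      using o that by (intro sum.cong) auto
    then show ?thesis using o that by (simp add: sum_left)
  qed
  show "B (\<Sum>y\<in>N. c y *\<^sub>R y) y = - c y" if "y \<in> N" for y
  proof -
    have "(\<Sum>z\<in>N. c z * B z y) = (\<Sum>z\<in>N. if z = y then - c z else 0)"
      using o that by (intro sum.cong) auto
    then show ?thesis using o that by (simp add: sum_left)
  qed
  show "B (\<Sum>x\<in>P. c x *\<^sub>R x) y = 0" if "y \<in> N" for y
    using o that by (simp add: sum_left)
  show "B (\<Sum>y\<in>N. c y *\<^sub>R y) x = 0" if "x \<in> P" for x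
  proof -
    have "B y x = 0" if "y \<in> N" for y
      using o that \<open>x \<in> P\<close> sym[of x y] by auto
    then show ?thesis by (simp add: sum_left)
  qed
qed

text \<open>Removing from \<open>b\<close> its components along \<open>P\<close> and
  \<open>N\<close> gives a vector \<open>b'\<close> of the complement that has the same product with
  \<open>a\<close>. Since \<open>a\<close>, \<open>b'\<close> and \<open>a + b'\<close> are
  isotropic, polarization yields \<open>B a b' = 0\<close>.\<close>

lemma orthogonal_imp_radical:
  assumes d: "diagonalizes A B P N" and a: "a \<in> A" "\<And>x. x \<in> P \<union> N \<Longrightarrow> B a x = 0"
  shows "a \<in> radical A B"
proof -
  note o = d[unfolded diagonalizes_def, THEN conjunct1]
  have PN: "P \<subseteq> A" "N \<subseteq> A" using o by (auto simp: orthonormal_pair_def)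
  have iso: "B x x = 0" if "x \<in> A" "\<And>y. y \<in> P \<union> N \<Longrightarrow> B x y = 0" for x
    using d that by (auto simp: diagonalizes_def)
  have "B a b = 0" if b: "b \<in> A" for b
  proof -
    define b' where "b' = b - (\<Sum>x\<in>P. B b x *\<^sub>R x) + (\<Sum>y\<in>N. B b y *\<^sub>R y)"
    have b': "b' \<in> A"
      unfolding b'_def using subsp b PN by (intro subspace_add subspace_diff sum_mem)
    have "B b' y = 0" if "y \<in> P \<union> N" for y
      using that by (auto simp: b'_def diff_left add_left orthonormal_coeffs[OF o])
    then have "B b' b' = 0" "B (a + b') (a + b') = 0"
      using b' a subsp iso[of b'] iso[of "a + b'"] by (auto simp: add_left[of a b'] subspace_add)
    moreover have "B a a = 0" using iso a by simp
    ultimately have "B a b' = 0"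
      using sym[of a b'] a b' by (simp add: add_left add_right)
    moreover have "B a b = B a b' + (\<Sum>x\<in>P. B b x * B a x) - (\<Sum>y\<in>N. B b y * B a y)"
      by (simp add: b'_def diff_right add_right sum_right)
    ultimately show ?thesis using a(2) by simp
  qed
  with a show ?thesis by (simp add: radical_def)
qed

lemma decompose:
  assumes d: "diagonalizes A B P N" and a: "a \<in> A"
  shows "a - (\<Sum>x\<in>P. B a x *\<^sub>R x) + (\<Sum>y\<in>N. B a y *\<^sub>R y) \<in> radical A B"
proof (rule orthogonal_imp_radical[OF d])
  note o = d[unfolded diagonalizes_def, THEN conjunct1]
  have PN: "P \<subseteq> A" "N \<subseteq> A" using o by (auto simp: orthonormal_pair_def)
  show "a - (\<Sum>x\<in>P. B a x *\<^sub>R x) + (\<Sum>y\<in>N. B a y *\<^sub>R y) \<in> A"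
    using subsp a PN by (intro subspace_add subspace_diff sum_mem)
  show "B (a - (\<Sum>x\<in>P. B a x *\<^sub>R x) + (\<Sum>y\<in>N. B a y *\<^sub>R y)) z = 0" if "z \<in> P \<union> N" for z
    using that by (auto simp: diff_left add_left orthonormal_coeffs[OF o])
qed

lemma square_eq:
  assumes d: "diagonalizes A B P N" and a: "a \<in> A"
  shows "B a a = (\<Sum>x\<in>P. (B a x)\<^sup>2) - (\<Sum>y\<in>N. (B a y)\<^sup>2)"
proof -
  define r where "r = a - (\<Sum>x\<in>P. B a x *\<^sub>R x) + (\<Sum>y\<in>N. B a y *\<^sub>R y)"
  have r: "r \<in> radical A B" unfolding r_def by (rule decompose[OF d a])
  have "0 = B a r" using r a sym by (auto simp: radical_def)
  also have "\<dots> = B a a - (\<Sum>x\<in>P. (B a x)\<^sup>2) + (\<Sum>y\<in>N. (B a y)\<^sup>2)"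
    by (simp add: r_def diff_right add_right sum_right power2_eq_square)
  finally show ?thesis by simp
qed

text \<open>Modulo the radical, \<open>I\<close> has dimension at most \<open>card N\<close>: for a
  vector of \<open>I\<close> orthogonal to \<open>N\<close>, the sum of the squares along
  \<open>P\<close> equals \<open>B a a = 0\<close>, so the vector is in the radical. If
  \<open>card P\<close> were larger, a nonzero combination of \<open>P\<close> would be orthogonal
  to \<open>I\<close>, hence isotropic by \<open>coiso\<close>, although the form is positive
  definite on the span of \<open>P\<close>.\<close>

lemma card_le_of_lagrangian:
  assumes d: "diagonalizes A B P N" and I: "subspace I" "I \<subseteq> A"
    and iso: "\<And>i. i \<in> I \<Longrightarrow> B i i = 0"
    and coiso: "\<And>a. a \<in> A \<Longrightarrow> (\<And>i. i \<in> I \<Longrightarrow> B a i = 0) \<Longrightarrow> B a a = 0"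
  shows "card P \<le> card N"
proof (rule ccontr)
  assume less: "\<not> card P \<le> card N"
  note o = d[unfolded diagonalizes_def, THEN conjunct1]
  have fin: "finite P" "finite N" "P \<subseteq> A" using o by (auto simp: orthonormal_pair_def)
  have bound: "card F \<le> card N" if F: "F \<subseteq> I" "independent_mod (radical A B) F" for F
  proof (rule ccontr)
    assume "\<not> card F \<le> card N"
    moreover have "finite F" using F by (simp add: independent_mod_def)
    ultimately obtain c where c: "\<exists>j\<in>F. c j \<noteq> 0" "\<forall>i\<in>N. (\<Sum>j\<in>F. c j * B j i) = 0"
      using underdetermined[of N F "\<lambda>i j. B j i"] fin by auto
    define a where "a = (\<Sum>x\<in>F. c x *\<^sub>R x)"
    have a: "a \<in> I" unfolding a_def using I F by (intro subspace_sum) (auto simp: subspace_scale)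
    then have aA: "a \<in> A" using I by auto
    have N: "\<forall>y\<in>N. B a y = 0" using c(2) by (simp add: a_def sum_left)
    then have "(\<Sum>x\<in>P. (B a x)\<^sup>2) = 0" using square_eq[OF d aA] iso[OF a] by simp
    then have "\<forall>x\<in>P. B a x = 0" using fin by (simp add: sum_nonneg_eq_0_iff)
    with N have "a \<in> radical A B" by (intro orthogonal_imp_radical[OF d aA]) auto
    then show False using F(2) c(1) by (auto simp: independent_mod_def a_def)
  qed
  obtain F where F: "F \<subseteq> I" "independent_mod (radical A B) F"
      "\<And>i. i \<in> I \<Longrightarrow> \<exists>c. i - (\<Sum>x\<in>F. c x *\<^sub>R x) \<in> radical A B"
    using maximal_independent_mod[OF subspace_radical bound, where I = I] by blast
  have "finite F" "card F < card P"
    using F less bound[of F] by (auto simp: independent_mod_def)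
  then obtain c where c: "\<exists>j\<in>P. c j \<noteq> 0" "\<forall>i\<in>F. (\<Sum>j\<in>P. c j * B j i) = 0"
    using underdetermined[of F P "\<lambda>i j. B j i"] fin by auto
  define a where "a = (\<Sum>x\<in>P. c x *\<^sub>R x)"
  have aA: "a \<in> A" unfolding a_def using fin by (intro sum_mem)
  have aF: "B a x = 0" if "x \<in> F" for x using c(2) that by (simp add: a_def sum_left)
  have "B a i = 0" if i: "i \<in> I" for i
  proof -
    obtain k where k: "i - (\<Sum>x\<in>F. k x *\<^sub>R x) \<in> radical A B" using F(3) i by blast
    have "0 = B a (i - (\<Sum>x\<in>F. k x *\<^sub>R x))" using k aA sym by (auto simp: radical_def)
    then show ?thesis using aF by (simp add: diff_right sum_right)
  qed
  then have "B a a = 0" by (intro coiso aA)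
  moreover have "B a a = (\<Sum>x\<in>P. c x * c x)"
    using orthonormal_coeffs(1)[OF o, of _ c]
    by (subst (2) a_def) (simp add: sum_right a_def)
  ultimately have "\<forall>x\<in>P. c x = 0"
    using fin by (simp add: sum_nonneg_eq_0_iff)
  with c(1) show False by auto
qed

lemma card_eq_of_lagrangian:
  assumes d: "diagonalizes A B P N" and I: "subspace I" "I \<subseteq> A"
    and iso: "\<And>i. i \<in> I \<Longrightarrow> B i i = 0"
    and coiso: "\<And>a. a \<in> A \<Longrightarrow> (\<And>i. i \<in> I \<Longrightarrow> B a i = 0) \<Longrightarrow> B a a = 0"
  shows "card P = card N"
proof (rule antisym)
  show "card P \<le> card N" by (rule card_le_of_lagrangian[OF assms])
  show "card N \<le> card P"
    by (rule sym_form.card_le_of_lagrangian[OF uminus diagonalizes_uminus[OF d] I])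
      (use iso coiso in auto)
qed

end

lemma card_axes:
  assumes "finite X" "finite Y" "(0::'a::zero) \<notin> X"
  shows "card ((\<lambda>x. (x, 0::'b::zero)) ` X \<union> Pair 0 ` Y) = card X + card Y"
  using assms by (subst card_Un_disjoint) (auto simp: card_image inj_on_def)

text \<open>\<open>\<Delta>\<close> is a Lagrangian subspace for the difference of the two forms, whose signature therefore vanishes.\<close>

lemma signature_eq_of_lagrangian_relation:
  assumes A: "sym_form A B" and dA: "diagonalizes A B P N"
    and C: "sym_form C B'" and dC: "diagonalizes C B' P' N'"
    and \<Delta>: "subspace \<Delta>" "\<Delta> \<subseteq> A \<times> C"
    and iso: "\<And>a c. (a, c) \<in> \<Delta> \<Longrightarrow> B a a = B' c c"
    and coiso: "\<And>a c. a \<in> A \<Longrightarrow> c \<in> C \<Longrightarrow> (\<And>x y. (x, y) \<in> \<Delta> \<Longrightarrow> B a x = B' c y) \<Longrightarrow> B a a = B' c c"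
  shows "int (card P) - int (card N) = int (card P') - int (card N')"
proof -
  interpret A: sym_form A B by (rule A)
  interpret C: sym_form C B' by (rule C)
  define Q where "Q = (\<lambda>p q. B (fst p) (fst q) - B' (snd p) (snd q))"
  have bilQ: "bilinear Q"
    by (auto simp: Q_def bilinear_def linear_iff A.add_left A.add_right C.add_left C.add_right
        A.scale_left A.scale_right C.scale_left C.scale_right algebra_simps)
  interpret Q: sym_form "A \<times> C" Q
    by unfold_locales (use A.subsp C.subsp bilQ A.sym C.sym in \<open>auto simp: Q_def subspace_Times\<close>)
  \<comment> \<open>The form \<open>B'\<close> enters \<open>Q\<close> with a minus sign, which
    exchanges the roles of \<open>P'\<close> and \<open>N'\<close>.\<close>
  let ?P = "(\<lambda>x. (x, 0)) ` P \<union> (\<lambda>y. (0, y)) ` N'" and ?N = "(\<lambda>x. (x, 0)) ` N \<union> (\<lambda>y. (0, y)) ` P'"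
  note z = bilinear_lzero[OF A.bil] bilinear_rzero[OF A.bil] bilinear_lzero[OF C.bil] bilinear_rzero[OF C.bil]
  have oA: "orthonormal_pair A B P N" and oC: "orthonormal_pair C B' P' N'"
    using dA dC by (auto simp: diagonalizes_def)
  note oA' = oA[unfolded orthonormal_pair_def] and oC' = oC[unfolded orthonormal_pair_def]
  have nz: "0 \<notin> P" "0 \<notin> N" "0 \<notin> P'" "0 \<notin> N'"
    using oA'[THEN conjunct2, THEN conjunct2, THEN conjunct2, THEN conjunct2]
      oC'[THEN conjunct2, THEN conjunct2, THEN conjunct2, THEN conjunct2] z
    by (metis zero_neq_one neg_equal_0_iff_equal)+
  have oNP: "\<forall>x\<in>P'. \<forall>y\<in>N'. B' y x = 0" using oC' C.sym by (metis subsetD)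
  have "orthonormal_pair (A \<times> C) Q ?P ?N"
    unfolding orthonormal_pair_def ball_Un ball_simps Q_def fst_conv snd_conv z
    using oA' oC' nz oNP subspace_0[OF A.subsp] subspace_0[OF C.subsp]
    by (intro conjI; (blast | simp split: if_splits))
  moreover have "Q a a = 0" if "a \<in> A \<times> C" "\<forall>x\<in>?P \<union> ?N. Q a x = 0" for a
  proof -
    have "\<forall>x\<in>P \<union> N. B (fst a) x = 0" "\<forall>x\<in>P' \<union> N'. B' (snd a) x = 0"
      using that(2) unfolding ball_Un ball_simps Q_def fst_conv snd_conv z by auto
    then show ?thesis using that(1) dA dC by (auto simp: Q_def diagonalizes_def)
  qed
  ultimately have dQ: "diagonalizes (A \<times> C) Q ?P ?N" by (auto simp: diagonalizes_def)
  have "card ?P = card ?N"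
  proof (rule Q.card_eq_of_lagrangian[OF dQ \<Delta>])
    show "Q i i = 0" if "i \<in> \<Delta>" for i using iso that by (cases i) (auto simp: Q_def)
    show "Q a a = 0" if "a \<in> A \<times> C" "\<And>i. i \<in> \<Delta> \<Longrightarrow> Q a i = 0" for a
      using that coiso[of "fst a" "snd a"] by (fastforce simp: Q_def)
  qed
  moreover have "card ?P = card P + card N'" "card ?N = card N + card P'"
    using oA' oC' nz by (auto intro: card_axes)
  ultimately show ?thesis by simp
qed

definition signature :: "'a::real_vector set \<Rightarrow> ('a \<Rightarrow> 'a \<Rightarrow> real) \<Rightarrow> int" where
  "signature A B = (SOME s. \<exists>P N. diagonalizes A B P N \<and> s = int (card P) - int (card N))"

text \<open>Sylvester's law of inertia, which makes the choice in \<open>signature\<close> harmless: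
  the diagonal of \<open>A \<times> A\<close> is a Lagrangian relation between the form and
  itself.\<close>

lemma (in sym_form) signature_eq:
  assumes "diagonalizes A B P N"
  shows "signature A B = int (card P) - int (card N)"
proof -
  have "\<exists>P N. diagonalizes A B P N \<and> signature A B = int (card P) - int (card N)"
    unfolding signature_def
    by (rule someI_ex[of "\<lambda>s. \<exists>P N. diagonalizes A B P N \<and> s = int (card P) - int (card N)"])
      (use assms in metis)
  then obtain P' N' where PN: "diagonalizes A B P' N'"
    "signature A B = int (card P') - int (card N')" by auto
  have "int (card P') - int (card N') = int (card P) - int (card N)"
  proof (rule signature_eq_of_lagrangian_relation[OF sym_form_axioms PN(1) sym_form_axioms assms])
    let ?D = "(\<lambda>a. (a, a)) ` A"
    show "subspace ?D"
      using subsp by (auto simp: subspace_def zero_prod_def)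
    show "B a a = B c c" if "a \<in> A" "c \<in> A" "\<And>x y. (x, y) \<in> ?D \<Longrightarrow> B a x = B c y" for a c
      using that(1,2) that(3)[of a a] that(3)[of c c] sym[of a c] by auto
  qed auto
  with PN show ?thesis by simp
qed

text \<open>Finite dimension in the guise of finitely many linear functionals that separate points.
  This is immediate for functions of finite support and bounds independent families through
  \<open>underdetermined\<close>.\<close>

definition finite_coords :: "'a::real_vector set \<Rightarrow> bool" where
  "finite_coords A \<longleftrightarrow> (\<exists>(m::nat) (f :: nat \<Rightarrow> 'a \<Rightarrow> real). (\<forall>i<m. linear (f i)) \<and>
     (\<forall>a\<in>A. (\<forall>i<m. f i a = 0) \<longrightarrow> a = 0))"

lemma independent_bound_coords:
  assumes "finite_coords A" "subspace A"
  shows "\<exists>m. \<forall>F\<subseteq>A. \<forall>R. 0 \<in> R \<longrightarrow> independent_mod R F \<longrightarrow> card F \<le> m"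
proof -
  obtain m and f :: "nat \<Rightarrow> 'a \<Rightarrow> real" where f: "\<And>i. i < m \<Longrightarrow> linear (f i)"
    "\<And>a. a \<in> A \<Longrightarrow> (\<And>i. i < m \<Longrightarrow> f i a = 0) \<Longrightarrow> a = 0"
    using assms unfolding finite_coords_def by blast
  have "card F \<le> m" if F: "F \<subseteq> A" "0 \<in> R" "independent_mod R F" for F R
  proof (rule ccontr)
    assume "\<not> card F \<le> m"
    moreover have "finite F" using F by (simp add: independent_mod_def)
    ultimately obtain c where c: "\<exists>x\<in>F. c x \<noteq> 0" "\<And>i. i < m \<Longrightarrow> (\<Sum>x\<in>F. c x * f i x) = 0"
      using underdetermined[of "{..<m}" F f] by auto
    have "(\<Sum>x\<in>F. c x *\<^sub>R x) \<in> A"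
      using assms(2) F by (intro subspace_sum) (auto simp: subspace_scale)
    moreover have "f i (\<Sum>x\<in>F. c x *\<^sub>R x) = 0" if "i < m" for i
      using c(2)[OF that] f(1)[OF that] by (simp add: linear_sum linear_scale)
    ultimately have "(\<Sum>x\<in>F. c x *\<^sub>R x) = 0" by (rule f(2))
    then show False using F c(1) by (auto simp: independent_mod_def)
  qed
  then show ?thesis by blast
qed

context sym_form
begin

lemma orthonormal_independent:
  assumes o: "orthonormal_pair A B P N" and s: "(\<Sum>x\<in>P \<union> N. c x *\<^sub>R x) \<in> radical A B"
  shows "\<forall>x\<in>P \<union> N. c x = 0"
proof -
  note o' = o[unfolded orthonormal_pair_def]
  have "P \<inter> N = {}"
  proof (rule ccontr)
    assume "P \<inter> N \<noteq> {}"
    then obtain x where "x \<in> P" "x \<in> N" by auto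
    then show False using o' by fastforce
  qed
  then have "(\<Sum>x\<in>P \<union> N. c x *\<^sub>R x) = (\<Sum>x\<in>P. c x *\<^sub>R x) + (\<Sum>x\<in>N. c x *\<^sub>R x)"
    using o' by (simp add: sum.union_disjoint)
  moreover have "\<forall>z\<in>P \<union> N. B (\<Sum>x\<in>P \<union> N. c x *\<^sub>R x) z = 0"
    using s o' by (auto simp: radical_def)
  ultimately have z: "\<forall>z\<in>P \<union> N. B (\<Sum>x\<in>P. c x *\<^sub>R x) z + B (\<Sum>x\<in>N. c x *\<^sub>R x) z = 0"
    by (simp add: add_left)
  show ?thesis
  proof
    fix x assume x: "x \<in> P \<union> N"
    then have "B (\<Sum>x\<in>P. c x *\<^sub>R x) x + B (\<Sum>x\<in>N. c x *\<^sub>R x) x = 0" using z by blast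
    then show "c x = 0" using x orthonormal_coeffs[OF o, of x c] by auto
  qed
qed

text \<open>A pair of greatest total size works: a non-isotropic vector orthogonal to it could be
  rescaled to square 1 or -1 and adjoined.\<close>

lemma exists_diagonalizes:
  assumes fc: "finite_coords A"
  shows "\<exists>P N. diagonalizes A B P N"
proof -
  obtain m where m: "\<And>F R. F \<subseteq> A \<Longrightarrow> 0 \<in> R \<Longrightarrow> independent_mod R F \<Longrightarrow> card F \<le> m"
    using independent_bound_coords[OF fc subsp] by metis
  have bound: "card (P \<union> N) \<le> m" if "orthonormal_pair A B P N" for P N
  proof (rule m[of _ "radical A B"])
    show "P \<union> N \<subseteq> A" "independent_mod (radical A B) (P \<union> N)"
      using orthonormal_independent[OF that] that
      by (auto simp: independent_mod_def orthonormal_pair_def)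
    show "0 \<in> radical A B" by (rule subspace_0[OF subspace_radical])
  qed
  have "orthonormal_pair A B {} {}" by (simp add: orthonormal_pair_def)
  then have "\<exists>q. orthonormal_pair A B (fst q) (snd q) \<and>
      (\<forall>q'. orthonormal_pair A B (fst q') (snd q') \<longrightarrow>
        card (fst q' \<union> snd q') \<le> card (fst q \<union> snd q))"
    by (intro ex_has_greatest_nat[where k = "({}, {})" and b = "Suc m"])
      (use bound in \<open>auto simp: less_Suc_eq_le\<close>)
  then obtain q where q: "orthonormal_pair A B (fst q) (snd q)"
    "\<forall>q'. orthonormal_pair A B (fst q') (snd q') \<longrightarrow>
        card (fst q' \<union> snd q') \<le> card (fst q \<union> snd q)" by auto
  define P N where "P = fst q" and "N = snd q"
  have PN: "orthonormal_pair A B P N" using q by (simp add: P_def N_def)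
  have max: "card (P' \<union> N') \<le> card (P \<union> N)" if "orthonormal_pair A B P' N'" for P' N'
    using q(2)[rule_format, of "(P', N')"] that by (simp add: P_def N_def)
  note o = PN[unfolded orthonormal_pair_def]
  have "B a a = 0" if a: "a \<in> A" "\<forall>x\<in>P \<union> N. B a x = 0" for a
  proof (rule ccontr)
    assume nz: "B a a \<noteq> 0"
    define b where "b = (1 / sqrt \<bar>B a a\<bar>) *\<^sub>R a"
    have b: "b \<in> A" using a subsp by (simp add: b_def subspace_scale)
    have bx: "B b x = 0" "B x b = 0" if "x \<in> P \<union> N" for x
      using that a o sym[of b x] b by (auto simp: b_def scale_left)
    have bb: "B b b = sgn (B a a)"
      using nz by (simp add: b_def scale_left scale_right sgn_if field_simps)
    have notin: "b \<notin> P \<union> N"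
      using bx(1)[of b] bb nz by (auto simp: sgn_if split: if_splits)
    have "card (insert b (P \<union> N)) = Suc (card (P \<union> N))"
      using notin o by (intro card_insert_disjoint) auto
    moreover have "card (insert b (P \<union> N)) \<le> card (P \<union> N)"
    proof (cases "0 < B a a")
      case True
      then have "orthonormal_pair A B (insert b P) N"
        unfolding orthonormal_pair_def using o bx bb b notin by auto
      from max[OF this] show ?thesis by simp
    next
      case False
      then have "orthonormal_pair A B P (insert b N)"
        unfolding orthonormal_pair_def using o bx bb b notin nz by (auto simp: sgn_if)
      from max[OF this] show ?thesis by simp
    qed
    ultimately show False by simp
  qed
  with PN show ?thesis by (auto simp: diagonalizes_def)
qed

end

lemma signature_cong_of_lagrangian_relation:
  assumes A: "sym_form A B" "finite_coords A" and C: "sym_form C B'" "finite_coords C"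
    and \<Delta>: "subspace \<Delta>" "\<Delta> \<subseteq> A \<times> C"
    and iso: "\<And>a c. (a, c) \<in> \<Delta> \<Longrightarrow> B a a = B' c c"
    and coiso: "\<And>a c. a \<in> A \<Longrightarrow> c \<in> C \<Longrightarrow> (\<And>x y. (x, y) \<in> \<Delta> \<Longrightarrow> B a x = B' c y) \<Longrightarrow> B a a = B' c c"
  shows "signature A B = signature C B'"
proof -
  obtain P N where 1: "diagonalizes A B P N" using sym_form.exists_diagonalizes[OF A] by auto
  obtain P' N' where 2: "diagonalizes C B' P' N'" using sym_form.exists_diagonalizes[OF C] by auto
  show ?thesis
    unfolding sym_form.signature_eq[OF A(1) 1] sym_form.signature_eq[OF C(1) 2]
    by (rule signature_eq_of_lagrangian_relation[OF A(1) 1 C(1) 2 \<Delta> iso coiso])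
qed

text \<open>The non-isotropic \<open>e i\<close>, rescaled to \<open>g i\<close>, form an
  orthonormal pair; an isotropic \<open>e i\<close> is orthogonal to the whole family and thus lies
  in the radical. This links \<open>signature\<close> with the count made in
  \<open>has_signature\<close>.\<close>

lemma (in sym_form) signature_orthogonal_family:
  fixes e :: "nat \<Rightarrow> 'a"
  assumes eA: "\<And>i. i < n \<Longrightarrow> e i \<in> A"
    and orth: "\<And>i j. i < n \<Longrightarrow> j < n \<Longrightarrow> i \<noteq> j \<Longrightarrow> B (e i) (e j) = 0"
    and span: "\<And>a. a \<in> A \<Longrightarrow> \<exists>c. a - (\<Sum>i<n. c i *\<^sub>R e i) \<in> radical A B"
  shows "signature A B = int (card {i. i < n \<and> B (e i) (e i) > 0}) - int (card {i. i < n \<and> B (e i) (e i) < 0})"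
proof -
  define g where "g i = (1 / sqrt \<bar>B (e i) (e i)\<bar>) *\<^sub>R e i" for i
  let ?p = "{i. i < n \<and> B (e i) (e i) > 0}" and ?m = "{i. i < n \<and> B (e i) (e i) < 0}"
  have gg: "B (g i) (g j) = (if i = j then sgn (B (e i) (e i)) else 0)" if "i < n" "j < n" for i j
    using that orth by (simp add: g_def scale_left scale_right sgn_if field_simps)
  have inj: "inj_on g (?p \<union> ?m)"
  proof (rule inj_onI)
    fix i j assume ij: "i \<in> ?p \<union> ?m" "j \<in> ?p \<union> ?m" "g i = g j"
    then have "B (g i) (g j) \<noteq> 0" using gg[of j j] by (auto simp: sgn_if)
    then show "i = j" using gg[of i j] ij by (auto split: if_splits)
  qed
  have gA: "g i \<in> A" if "i < n" for i using eA[OF that] subsp by (simp add: g_def subspace_scale)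
  have "orthonormal_pair A B (g ` ?p) (g ` ?m)"
    unfolding orthonormal_pair_def
    using inj gg gA by (auto simp: inj_on_def)
  moreover have "B a a = 0" if a: "a \<in> A" "\<forall>x\<in>g ` ?p \<union> g ` ?m. B a x = 0" for a
  proof -
    obtain c where c: "a - (\<Sum>i<n. c i *\<^sub>R e i) \<in> radical A B" using span a by blast
    define r where "r = a - (\<Sum>i<n. c i *\<^sub>R e i)"
    have r: "r \<in> A" "\<And>b. b \<in> A \<Longrightarrow> B b r = 0"
      using c sym by (auto simp: radical_def r_def)
    have "B a (e i) = 0" if i: "i < n" for i
    proof (cases "B (e i) (e i) = 0")
      case True
      have "B (e i) a = B (e i) r + (\<Sum>j<n. c j * B (e i) (e j))"
        by (simp add: r_def diff_right sum_right)
      also have "B (e i) r = 0" using r(2)[OF eA[OF i]] .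
      also have "(\<Sum>j<n. c j * B (e i) (e j)) = 0"
      proof (rule sum.neutral, rule ballI)
        fix j assume "j \<in> {..<n}"
        then show "c j * B (e i) (e j) = 0" using True orth[OF i, of j] by (cases "i = j") auto
      qed
      finally show ?thesis using sym[OF a(1) eA[OF i]] by simp
    next
      case False
      then have "i \<in> ?p \<union> ?m" using i by auto
      then have "g i \<in> g ` ?p \<union> g ` ?m" by blast
      then have "B a (g i) = 0" using a by blast
      then show ?thesis using False by (simp add: g_def scale_right)
    qed
    then have "(\<Sum>i<n. c i * B a (e i)) = 0" by simp
    moreover have "B a a = B a r + (\<Sum>i<n. c i * B a (e i))"
      by (simp add: r_def diff_right sum_right)
    ultimately show ?thesis using r a by simp
  qed
  ultimately have "diagonalizes A B (g ` ?p) (g ` ?m)" by (auto simp: diagonalizes_def)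
  from signature_eq[OF this] show ?thesis
    using inj by (simp add: card_image inj_on_Un)
qed

text \<open>The form is positive definite on the span of \<open>P\<close>, which therefore meets the
  isotropic common kernel of the \<open>f i\<close> in 0 only.\<close>

lemma (in sym_form) card_le_of_isotropic_kernel:
  assumes o: "orthonormal_pair A B P N" and I: "finite I"
    and f: "\<And>i. i \<in> I \<Longrightarrow> linear (f i :: _ \<Rightarrow> real)"
    and ker: "\<And>a. a \<in> A \<Longrightarrow> (\<And>i. i \<in> I \<Longrightarrow> f i a = 0) \<Longrightarrow> B a a = 0"
  shows "card P \<le> card I"
proof (rule ccontr)
  assume "\<not> card P \<le> card I"
  moreover have fin: "finite P" "P \<subseteq> A" using o by (auto simp: orthonormal_pair_def)
  ultimately obtain c where c: "\<exists>x\<in>P. c x \<noteq> 0" "\<And>i. i \<in> I \<Longrightarrow> (\<Sum>x\<in>P. c x * f i x) = 0"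
    using underdetermined[of I P f] I by auto
  define a where "a = (\<Sum>x\<in>P. c x *\<^sub>R x)"
  have "a \<in> A" unfolding a_def using fin by (intro sum_mem)
  moreover have "f i a = 0" if "i \<in> I" for i
    using c(2)[OF that] f[OF that] by (simp add: a_def linear_sum linear_scale)
  ultimately have "B a a = 0" by (rule ker)
  moreover have "B a a = (\<Sum>x\<in>P. c x * c x)"
    using orthonormal_coeffs(1)[OF o, of _ c]
    by (subst (2) a_def) (simp add: sum_right a_def)
  ultimately have "\<forall>x\<in>P. c x = 0"
    using fin by (simp add: sum_nonneg_eq_0_iff)
  with c(1) show False by auto
qed

lemma (in sym_form) abs_signature_le:
  assumes fc: "finite_coords A" and I: "finite I"
    and f: "\<And>i. i \<in> I \<Longrightarrow> linear (f i :: _ \<Rightarrow> real)"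
    and ker: "\<And>a. a \<in> A \<Longrightarrow> (\<And>i. i \<in> I \<Longrightarrow> f i a = 0) \<Longrightarrow> B a a = 0"
  shows "\<bar>signature A B\<bar> \<le> int (card I)"
proof -
  obtain P N where d: "diagonalizes A B P N" using exists_diagonalizes[OF fc] by auto
  have "card P \<le> card I"
    by (rule card_le_of_isotropic_kernel[of P N, OF _ I f ker]) (use d in \<open>auto simp: diagonalizes_def\<close>)
  moreover have "card N \<le> card I"
    by (rule sym_form.card_le_of_isotropic_kernel[OF uminus, of N P, OF _ I f])
      (use diagonalizes_uminus[OF d] ker in \<open>auto simp: diagonalizes_def\<close>)
  ultimately show ?thesis using signature_eq[OF d] by simp
qed

text \<open>\<open>T\<close> is an orthogonal sum given by inclusions \<open>\<iota>\<close> and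
  projections \<open>\<pi>\<close>, since the summands live in another type. A sign -1 exchanges the
  positive and the negative vectors of its summand.\<close>

lemma signature_direct_sum:
  fixes s :: "'t \<Rightarrow> int"
  assumes T: "sym_form T BT" and K: "finite K"
    and A: "\<And>t. t \<in> K \<Longrightarrow> sym_form (A t) (b t)" "\<And>t. t \<in> K \<Longrightarrow> finite_coords (A t)"
    and s: "\<And>t. t \<in> K \<Longrightarrow> s t = 1 \<or> s t = - 1"
    and \<iota>: "\<And>t x. t \<in> K \<Longrightarrow> x \<in> A t \<Longrightarrow> \<iota> t x \<in> T"
    and \<pi>: "\<And>t w. t \<in> K \<Longrightarrow> w \<in> T \<Longrightarrow> \<pi> t w \<in> A t"
    and \<pi>\<iota>: "\<And>t t' x. t \<in> K \<Longrightarrow> t' \<in> K \<Longrightarrow> x \<in> A t \<Longrightarrow> \<pi> t' (\<iota> t x) = (if t = t' then x else 0)"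
    and BT: "\<And>t w x. t \<in> K \<Longrightarrow> w \<in> T \<Longrightarrow> x \<in> A t \<Longrightarrow> BT w (\<iota> t x) = of_int (s t) * b t (\<pi> t w) x"
      "\<And>w. w \<in> T \<Longrightarrow> BT w w = (\<Sum>t\<in>K. of_int (s t) * b t (\<pi> t w) (\<pi> t w))"
  shows "signature T BT = (\<Sum>t\<in>K. s t * signature (A t) (b t))"
proof -
  have "\<exists>P N. diagonalizes (A t) (b t) P N" if "t \<in> K" for t
    using sym_form.exists_diagonalizes[OF A] that by blast
  then obtain P N where d: "\<And>t. t \<in> K \<Longrightarrow> diagonalizes (A t) (b t) (P t) (N t)" by metis
  define P' N' where "P' t = (if s t = 1 then P t else N t)" and "N' t = (if s t = 1 then N t else P t)" for t
  have o: "orthonormal_pair (A t) (\<lambda>x y. of_int (s t) * b t x y) (P' t) (N' t)" if t: "t \<in> K" for t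
    using d[OF t] s[OF t] sym_form.diagonalizes_uminus[OF A(1)[OF t] d[OF t]]
    by (auto simp: P'_def N'_def diagonalizes_def)
  note o' = o[unfolded orthonormal_pair_def]
  have sub: "P' t \<subseteq> A t" "N' t \<subseteq> A t" "finite (P' t)" "finite (N' t)" if "t \<in> K" for t
    using o'[OF that] by auto
  have bz: "b t 0 x = 0" if "t \<in> K" for t x
    using sym_form.bil[OF A(1)[OF that]] by (rule bilinear_lzero)
  have BTi: "BT (\<iota> t x) (\<iota> t' y) = (if t = t' then of_int (s t) * b t x y else 0)"
    if "t \<in> K" "t' \<in> K" "x \<in> A t" "y \<in> A t'" for t t' x y
    using that BT(1)[of t' "\<iota> t x" y] \<iota> \<pi>\<iota> bz by simp
  have inj: "inj_on (\<iota> t) (A t)" if "t \<in> K" for t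
    using \<pi>\<iota>[OF that that] by (metis inj_onI)
  have nz: "0 \<notin> P' t" "0 \<notin> N' t" if t: "t \<in> K" for t
  proof -
    show "0 \<notin> P' t"
    proof
      assume "0 \<in> P' t"
      then have "of_int (s t) * b t 0 0 = 1" using o'[OF t] by (metis (full_types))
      then show False using bz[OF t] by simp
    qed
    show "0 \<notin> N' t"
    proof
      assume "0 \<in> N' t"
      then have "of_int (s t) * b t 0 0 = -1" using o'[OF t] by (metis (full_types))
      then show False using bz[OF t] by simp
    qed
  qed
  have ne: "\<iota> t x \<noteq> \<iota> t' y" if "t \<in> K" "t' \<in> K" "t \<noteq> t'" "x \<in> A t" "y \<in> A t'" "x \<noteq> 0" for t t' x y
    using \<pi>\<iota>[of t t x] \<pi>\<iota>[of t' t y] that by auto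
  have disj: "\<iota> t ` X \<inter> \<iota> t' ` Y = {}"
    if "t \<in> K" "t' \<in> K" "t \<noteq> t'" "X \<subseteq> A t" "Y \<subseteq> A t'" "0 \<notin> X" for t t' X Y
  proof -
    have "\<iota> t x \<noteq> \<iota> t' y" if "x \<in> X" "y \<in> Y" for x y
      using ne[of t t' x y] that \<open>t \<in> K\<close> \<open>t' \<in> K\<close> \<open>t \<noteq> t'\<close> \<open>X \<subseteq> A t\<close> \<open>Y \<subseteq> A t'\<close> \<open>0 \<notin> X\<close>
      by (metis subsetD)
    then show ?thesis by blast
  qed
  have BT_rel: "BT x y = (if x = y then v else 0)"
    if xy: "x \<in> (\<Union>t\<in>K. \<iota> t ` X t)" "y \<in> (\<Union>t\<in>K. \<iota> t ` X t)"
      and X: "\<And>t. t \<in> K \<Longrightarrow> X t \<subseteq> A t" "\<And>t. t \<in> K \<Longrightarrow> 0 \<notin> X t"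
      and v: "\<And>t u w. t \<in> K \<Longrightarrow> u \<in> X t \<Longrightarrow> w \<in> X t \<Longrightarrow> of_int (s t) * b t u w = (if u = w then v else 0)"
    for x y X v
  proof -
    obtain t u where 1: "t \<in> K" "u \<in> X t" "x = \<iota> t u" using xy(1) by blast
    obtain t' w where 2: "t' \<in> K" "w \<in> X t'" "y = \<iota> t' w" using xy(2) by blast
    have m: "u \<in> A t" "w \<in> A t'" "u \<noteq> 0" using 1 2 X by (metis subsetD)+
    show ?thesis
    proof (cases "t = t'")
      case True
      then have "x = y \<longleftrightarrow> u = w" using 1 2 m inj by (auto simp: inj_on_def)
      then show ?thesis using BTi[of t t' u w] 1 2 m True v[of t u w] by simp
    next
      case False
      then show ?thesis using BTi[of t t' u w] ne[of t t' u w] 1 2 m by simp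
    qed
  qed
  let ?P = "\<Union>t\<in>K. \<iota> t ` P' t" and ?N = "\<Union>t\<in>K. \<iota> t ` N' t"
  have "orthonormal_pair T BT ?P ?N"
    unfolding orthonormal_pair_def
  proof (intro conjI ballI)
    show "finite ?P" "finite ?N" using K sub by auto
    show "?P \<subseteq> T" "?N \<subseteq> T" using \<iota> sub by blast+
    show "BT x y = (if x = y then 1 else 0)" if "x \<in> ?P" "y \<in> ?P" for x y
      using that by (rule BT_rel) (use o' sub nz in auto)
    show "BT x y = (if x = y then -1 else 0)" if "x \<in> ?N" "y \<in> ?N" for x y
      using that by (rule BT_rel) (use o' sub nz in auto)
    show "BT x y = 0" if xy: "x \<in> ?P" "y \<in> ?N" for x y
    proof -
      obtain t u where 1: "t \<in> K" "u \<in> P' t" "x = \<iota> t u" using xy(1) by blast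
      obtain t' v where 2: "t' \<in> K" "v \<in> N' t'" "y = \<iota> t' v" using xy(2) by blast
      note * = 1(1) 2(1) 1(2) 2(2) 1(3) 2(3)
      have m: "u \<in> A t" "v \<in> A t'" using * sub by (metis subsetD)+
      have "of_int (s t) * b t u v = 0" if "t = t'" using o'[OF *(1)] * that by auto
      then show ?thesis using BTi[of t t' u v] * m by auto
    qed
  qed
  moreover have "BT w w = 0" if w: "w \<in> T" "\<forall>x\<in>?P \<union> ?N. BT w x = 0" for w
  proof -
    have "b t (\<pi> t w) (\<pi> t w) = 0" if t: "t \<in> K" for t
    proof -
      have "b t (\<pi> t w) x = 0" if x: "x \<in> P t \<union> N t" for x
      proof -
        have x': "x \<in> P' t \<union> N' t" using x by (auto simp: P'_def N'_def)
        then have "\<iota> t x \<in> ?P \<union> ?N" using t by blast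
        then have "BT w (\<iota> t x) = 0" using w by blast
        moreover have "x \<in> A t" using x' sub[OF t] by blast
        ultimately show ?thesis using BT(1)[OF t w(1)] s[OF t] by auto
      qed
      then show ?thesis using d[OF t] \<pi>[OF t w(1)] by (auto simp: diagonalizes_def)
    qed
    then show ?thesis using BT(2)[OF w(1)] by simp
  qed
  ultimately have "diagonalizes T BT ?P ?N" by (auto simp: diagonalizes_def)
  from sym_form.signature_eq[OF T this]
  have "signature T BT = int (card ?P) - int (card ?N)" .
  also have "card ?P = (\<Sum>t\<in>K. card (P' t))"
  proof -
    have "card ?P = (\<Sum>t\<in>K. card (\<iota> t ` P' t))"
      by (intro card_UN_disjoint ballI impI disj) (use K sub nz in auto)
    also have "\<dots> = (\<Sum>t\<in>K. card (P' t))"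
      by (intro sum.cong refl card_image inj_on_subset[OF inj]) (use sub in auto)
    finally show ?thesis .
  qed
  also have "card ?N = (\<Sum>t\<in>K. card (N' t))"
  proof -
    have "card ?N = (\<Sum>t\<in>K. card (\<iota> t ` N' t))"
      by (intro card_UN_disjoint ballI impI disj) (use K sub nz in auto)
    also have "\<dots> = (\<Sum>t\<in>K. card (N' t))"
      by (intro sum.cong refl card_image inj_on_subset[OF inj]) (use sub in auto)
    finally show ?thesis .
  qed
  also have "int (\<Sum>t\<in>K. card (P' t)) - int (\<Sum>t\<in>K. card (N' t)) = (\<Sum>t\<in>K. int (card (P' t)) - int (card (N' t)))"
    by (simp add: sum_subtractf)
  also have "\<dots> = (\<Sum>t\<in>K. s t * signature (A t) (b t))"
  proof (rule sum.cong[OF refl])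
    fix t assume t: "t \<in> K"
    show "int (card (P' t)) - int (card (N' t)) = s t * signature (A t) (b t)"
      using sym_form.signature_eq[OF A(1)[OF t] d[OF t]] s[OF t] by (auto simp: P'_def N'_def)
  qed
  finally show ?thesis .
qed

lemma finite_coordsI:
  assumes "finite I" "\<And>i. i \<in> I \<Longrightarrow> linear (f i :: _ \<Rightarrow> real)"
    "\<And>a. a \<in> A \<Longrightarrow> (\<And>i. i \<in> I \<Longrightarrow> f i a = 0) \<Longrightarrow> a = 0"
  shows "finite_coords A"
proof -
  obtain g where g: "bij_betw g {0..<card I} I"
    using ex_bij_betw_nat_finite[OF assms(1)] by auto
  have "linear (f (g i))" if "i < card I" for i
    using assms(2)[of "g i"] bij_betwE[OF g] that by simp
  moreover have "a = 0" if "a \<in> A" "\<forall>i<card I. f (g i) a = 0" for a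
  proof (rule assms(3)[OF that(1)])
    fix i assume "i \<in> I"
    then have "i \<in> g ` {0..<card I}" using g by (simp add: bij_betw_def)
    then show "f i a = 0" using that(2) by auto
  qed
  ultimately show ?thesis
    unfolding finite_coords_def by (intro exI[of _ "card I"] exI[of _ "\<lambda>i. f (g i)"]) auto
qed

lemma finite_coords_euclidean: "finite_coords (A :: 'a::euclidean_space set)"
  by (rule finite_coordsI[of Basis "\<lambda>b x. x \<bullet> b"])
    (auto simp: linear_iff inner_add_left intro: euclidean_eqI)

lemma finite_coords_fun:
  fixes A :: "('i \<Rightarrow> 'a::euclidean_space) set"
  assumes "finite S" "\<And>a i. a \<in> A \<Longrightarrow> i \<notin> S \<Longrightarrow> a i = 0"
  shows "finite_coords A"
proof (rule finite_coordsI[of "S \<times> Basis" "\<lambda>(i, b) a. a i \<bullet> b"])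
  show "finite (S \<times> (Basis :: 'a set))" using assms by simp
  show "linear (case k of (i, b) \<Rightarrow> \<lambda>a. a i \<bullet> b)" for k :: "'i \<times> 'a"
    by (cases k) (auto simp: linear_iff inner_add_left)
  show "a = 0" if a: "a \<in> A" "\<And>k. k \<in> S \<times> Basis \<Longrightarrow> (case k of (i, b) \<Rightarrow> \<lambda>a. a i \<bullet> b) a = 0" for a
  proof
    fix i
    show "a i = 0 i"
    proof (cases "i \<in> S")
      case True
      then have "a i \<bullet> b = 0" if "b \<in> Basis" for b using a(2)[of "(i, b)"] that by simp
      then have "a i = 0" by (subst euclidean_eq_iff) simp
      then show ?thesis by simp
    qed (use assms a in simp)
  qed
qed

section \<open>The Maslov cocycle\<close>

type_synonym 'h symp_map = "'h symp_space \<Rightarrow> 'h symp_space"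

lemma bilinear_symp_form: "bilinear symp_form"
  by (auto simp: bilinear_def linear_iff symp_form_def inner_add_left inner_add_right algebra_simps)

lemmas symp_form_bilinear_simps =
  bilinear_ladd[OF bilinear_symp_form] bilinear_radd[OF bilinear_symp_form]
  bilinear_lsub[OF bilinear_symp_form] bilinear_rsub[OF bilinear_symp_form]
  bilinear_lmul[OF bilinear_symp_form] bilinear_rmul[OF bilinear_symp_form]
  bilinear_lzero[OF bilinear_symp_form] bilinear_rzero[OF bilinear_symp_form]
  bilinear_lneg[OF bilinear_symp_form] bilinear_rneg[OF bilinear_symp_form]

lemma symp_form_swap: "symp_form x y = - symp_form y x"
  by (simp add: symp_form_def inner_commute)

lemma symp_form_self [simp]: "symp_form x x = 0"
  by (simp add: symp_form_def inner_commute)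

lemma symp_form_horizontal: "snd x = 0 \<Longrightarrow> snd y = 0 \<Longrightarrow> symp_form x y = 0"
  by (simp add: symp_form_def)

lemma Sp_simps:
  "x \<otimes>\<^bsub>Sp\<^esub> y = x \<circ> y" "\<one>\<^bsub>Sp\<^esub> = id"
  by (simp_all add: Sp_def)

lemma Sp_linear: "x \<in> carrier Sp \<Longrightarrow> linear x"
  and Sp_bij: "x \<in> carrier Sp \<Longrightarrow> bij x"
  and Sp_form: "x \<in> carrier Sp \<Longrightarrow> symp_form (x u) (x v) = symp_form u v"
  by (simp_all add: Sp_def del: split_paired_All)

lemma Sp_mult_closed: "x \<in> carrier Sp \<Longrightarrow> y \<in> carrier Sp \<Longrightarrow> x \<circ> y \<in> carrier Sp"
  by (simp add: Sp_def linear_compose bij_comp del: split_paired_All)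

lemma Sp_one_closed: "id \<in> carrier Sp"
  by (simp add: Sp_def linear_iff)

text \<open>\<open>maslov_space x y\<close> is \<open>{(w\<^sub>0, w\<^sub>1, w\<^sub>2) \<in> L \<times> x L \<times> x y L. w\<^sub>0 + w\<^sub>1 + w\<^sub>2 = 0}\<close> for the Lagrangian
  subspace \<open>L = \<real>\<^sup>h \<times> 0\<close>, where the three components are pulled back to \<open>L\<close>.\<close>

definition maslov_space ::
  "('h::finite symp_space \<Rightarrow> 'h symp_space) \<Rightarrow> 'h symp_map \<Rightarrow>
   ('h symp_space \<times> 'h symp_space \<times> 'h symp_space) set" where
  "maslov_space x y = {(w0, w1, w2). snd w0 = 0 \<and> snd w1 = 0 \<and> snd w2 = 0 \<and> w0 + x w1 + x (y w2) = 0}"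

definition maslov_form ::
  "('h::finite symp_space \<Rightarrow> 'h symp_space) \<Rightarrow> 'h symp_space \<times> 'h symp_space \<times> 'h symp_space \<Rightarrow>
   'h symp_space \<times> 'h symp_space \<times> 'h symp_space \<Rightarrow> real" where
  "maslov_form x w v = symp_form (fst w) (x (fst (snd v)))"

definition maslov_cocycle ::
  "('h::finite symp_space \<Rightarrow> 'h symp_space) \<times> 'h symp_map \<Rightarrow> real" where
  "maslov_cocycle = (\<lambda>(x, y). of_int (signature (maslov_space x y) (maslov_form x)))"

text \<open>Two vectors of the same Lagrangian pair to zero. Writing the third components as minus
  the sum of the first two and expanding their vanishing pairing leaves exactly the claimed
  symmetry.\<close>

lemma symp_form_triangle_sym:
  fixes x y :: "'h::finite symp_space \<Rightarrow> 'h symp_space"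
  assumes x: "x \<in> carrier Sp" and y: "y \<in> carrier Sp"
    and L: "snd a = 0" "snd b = 0" "snd c = 0" "snd a' = 0" "snd b' = 0" "snd c' = 0"
    and s: "a + x b + x (y c) = 0" "a' + x b' + x (y c') = 0"
  shows "symp_form a (x b') = symp_form a' (x b)"
proof -
  have 1: "symp_form a a' = 0" "symp_form (x b) (x b') = 0" "symp_form (x (y c)) (x (y c')) = 0"
    using L by (simp_all add: Sp_form[OF x] Sp_form[OF y] symp_form_horizontal)
  have c: "x (y c) = - a - x b" "x (y c') = - a' - x b'"
    using s by (simp_all add: eq_neg_iff_add_eq_0 add.commute add.left_commute algebra_simps)
  from 1(3) have "symp_form (- a - x b) (- a' - x b') = 0" unfolding c .
  then have "symp_form a (x b') + symp_form (x b) a' = 0"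
    using 1(1,2) by (simp add: symp_form_bilinear_simps)
  then show ?thesis using symp_form_swap[of "x b" a'] by simp
qed

lemma sym_form_maslov:
  assumes x: "x \<in> carrier Sp" and y: "y \<in> carrier Sp"
  shows "sym_form (maslov_space x y) (maslov_form x)"
proof
  note lx = Sp_linear[OF x] and ly = Sp_linear[OF y]
  have "maslov_space x y = {w. (snd (fst w), snd (fst (snd w)), snd (snd (snd w)),
      fst w + x (fst (snd w)) + x (y (snd (snd w)))) = 0}"
    by (auto simp: maslov_space_def zero_prod_def)
  also have "subspace \<dots>"
    by (intro linear_subspace_kernel)
      (auto simp: linear_iff linear_add[OF lx] linear_add[OF ly] linear_scale[OF lx]
        linear_scale[OF ly] scaleR_add_right)
  finally show "subspace (maslov_space x y)" .
  show "bilinear (maslov_form x)"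
    by (auto simp: bilinear_def linear_iff maslov_form_def linear_add[OF lx] linear_scale[OF lx]
        symp_form_bilinear_simps)
  show "maslov_form x u v = maslov_form x v u" if uv: "u \<in> maslov_space x y" "v \<in> maslov_space x y" for u v
    unfolding maslov_form_def
    by (rule symp_form_triangle_sym[OF x y, where c = "snd (snd u)" and c' = "snd (snd v)"])
      (use uv in \<open>auto simp: maslov_space_def\<close>)
qed

lemma abs_maslov_cocycle_le:
  fixes x y :: "'h::finite symp_space \<Rightarrow> 'h symp_space"
  assumes "x \<in> carrier Sp" "y \<in> carrier Sp"
  shows "\<bar>maslov_cocycle (x, y)\<bar> \<le> real CARD('h)"
proof -
  have "\<bar>signature (maslov_space x y) (maslov_form x)\<bar> \<le> int (card (UNIV :: 'h set))"
  proof (rule sym_form.abs_signature_le[OF sym_form_maslov[OF assms] finite_coords_euclidean,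
        where f = "\<lambda>i w. fst (fst w) $ i"])
    show "linear (\<lambda>w. fst (fst w) $ i :: real)" for i by (simp add: linear_iff)
    show "maslov_form x a a = 0" if "a \<in> maslov_space x y" "\<And>i. i \<in> UNIV \<Longrightarrow> fst (fst a) $ i = 0" for a
    proof -
      have "fst a = 0" using that by (auto simp: maslov_space_def prod_eq_iff vec_eq_iff)
      then show ?thesis by (simp add: maslov_form_def symp_form_bilinear_simps)
    qed
    show "finite (UNIV :: 'h set)" by simp
  qed
  then show ?thesis unfolding maslov_cocycle_def by simp
qed

text \<open>The images of \<open>L\<close> are points of a projective line with coordinates
  \<open>p / r\<close> and \<open>p' / r'\<close>. A closed triple is \<open>l v\<close> for its
  last component \<open>v\<close>, and on these the form is \<open>k\<close> times the Euclidean
  inner product, where \<open>k = r'\<^sup>2 * (p' / r' - p / r)\<close>; so it is definite or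
  zero.\<close>

lemma maslov_cocycle_eq:
  fixes x y :: "'h::finite symp_space \<Rightarrow> 'h symp_space"
  assumes x: "x \<in> carrier Sp" and y: "y \<in> carrier Sp"
    and xL: "\<And>v. x (v, 0) = (p *\<^sub>R v, r *\<^sub>R v)" and xyL: "\<And>v. x (y (v, 0)) = (p' *\<^sub>R v, r' *\<^sub>R v)"
    and r: "r \<noteq> 0" "r' \<noteq> 0"
  shows "maslov_cocycle (x, y) = real CARD('h) * sgn (p' / r' - p / r)"
proof -
  define k where "k = r' * (p' - p * r' / r)"
  define l :: "real^'h \<Rightarrow> 'h symp_space \<times> 'h symp_space \<times> 'h symp_space" where
    "l v = (((p * r' / r - p') *\<^sub>R v, 0), (- (r' / r) *\<^sub>R v, 0), (v, 0))" for v
  interpret sym_form "maslov_space x y" "maslov_form x" by (rule sym_form_maslov[OF x y])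
  have l: "l v \<in> maslov_space x y" for v
    using r by (simp add: l_def maslov_space_def xL xyL algebra_simps zero_prod_def divide_simps
        flip: scaleR_add_left)
  have ll: "maslov_form x (l u) (l v) = k * (u \<bullet> v)" for u v
    using r by (simp add: l_def maslov_form_def symp_form_def xL k_def field_simps)
  have onto: "w = l (fst (snd (snd w)))" if "w \<in> maslov_space x y" for w
  proof -
    define a b c where "a = fst (fst w)" and "b = fst (fst (snd w))" and "c = fst (snd (snd w))"
    have w: "w = ((a, 0), (b, 0), (c, 0))"
      using that by (auto simp: maslov_space_def a_def b_def c_def prod_eq_iff)
    have "(a, 0) + x (b, 0) + x (y (c, 0)) = 0"
      using that by (simp add: maslov_space_def w)
    then have 1: "a + p *\<^sub>R b + p' *\<^sub>R c = 0" and 2: "r *\<^sub>R b + r' *\<^sub>R c = 0"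
      by (auto simp: xL xyL zero_prod_def)
    have "(1 / r) *\<^sub>R (r *\<^sub>R b + r' *\<^sub>R c) = 0" using 2 by simp
    then have b: "b = - (r' / r) *\<^sub>R c" using r by (simp add: scaleR_add_right eq_neg_iff_add_eq_0)
    have a: "a = (p * r' / r - p') *\<^sub>R c"
      using 1 by (simp add: b scaleR_left_diff_distrib) (simp add: algebra_simps eq_neg_iff_add_eq_0)
    show ?thesis unfolding w l_def by (simp add: a b)
  qed
  obtain g where g: "bij_betw g {0..<CARD('h)} (UNIV :: 'h set)"
    using ex_bij_betw_nat_finite[of "UNIV :: 'h set"] by auto
  have linl: "linear l" by (auto simp: linear_iff l_def algebra_simps)
  have sig: "signature (maslov_space x y) (maslov_form x) =
      int (card {i. i < CARD('h) \<and> maslov_form x (l (axis (g i) 1)) (l (axis (g i) 1)) > 0})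
    - int (card {i. i < CARD('h) \<and> maslov_form x (l (axis (g i) 1)) (l (axis (g i) 1)) < 0})"
  proof (rule signature_orthogonal_family)
    show "l (axis (g i) 1) \<in> maslov_space x y" for i by (rule l)
    show "maslov_form x (l (axis (g i) 1)) (l (axis (g j) 1)) = 0" if "i < CARD('h)" "j < CARD('h)" "i \<noteq> j" for i j
      using that g by (auto simp: ll inner_axis_axis bij_betw_def inj_on_def)
    show "\<exists>c. a - (\<Sum>i<CARD('h). c i *\<^sub>R l (axis (g i) 1)) \<in> radical (maslov_space x y) (maslov_form x)"
      if a: "a \<in> maslov_space x y" for a
    proof -
      define v where "v = fst (snd (snd a))"
      have "(\<Sum>i<CARD('h). (v $ g i) *\<^sub>R (axis (g i) 1 :: real^'h)) = (\<Sum>i\<in>UNIV. (v $ i) *\<^sub>R axis i 1)"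
        by (rule sum.reindex_bij_betw[of g "{..<CARD('h)}" UNIV "\<lambda>i. (v $ i) *\<^sub>R axis i 1"])
          (use g in \<open>simp add: atLeast0LessThan\<close>)
      also have "\<dots> = v" by (simp add: vec_eq_iff axis_def if_distrib cong: if_cong)
      finally have "l v = l (\<Sum>i<CARD('h). (v $ g i) *\<^sub>R (axis (g i) 1 :: real^'h))" by simp
      also have "\<dots> = (\<Sum>i<CARD('h). (v $ g i) *\<^sub>R l (axis (g i) 1))"
        using linl by (simp add: linear_sum linear_scale)
      finally have "l v = \<dots>" .
      then have "a - (\<Sum>i<CARD('h). (v $ g i) *\<^sub>R l (axis (g i) 1)) = 0"
        using onto[OF a] by (simp add: v_def)
      then show ?thesis
        using subspace_0[OF subspace_radical] by (intro exI[of _ "\<lambda>i. v $ g i"]) simp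
    qed
  qed
  have kk: "maslov_form x (l (axis (g i) 1)) (l (axis (g i) 1)) = k" for i
    by (simp add: ll inner_axis_axis)
  have "k = r'\<^sup>2 * (p' / r' - p / r)"
    using r by (simp add: k_def power2_eq_square field_simps)
  moreover have "0 < r'\<^sup>2" using r by simp
  ultimately have "sgn k = sgn (p' / r' - p / r)" by (metis mult.left_neutral sgn_mult sgn_pos)
  moreover have "maslov_cocycle (x, y) = real CARD('h) * sgn k"
    unfolding maslov_cocycle_def by (simp add: sig kk sgn_if)
  ultimately show ?thesis by simp
qed

section \<open>The signature of a local system on a surface\<close>

type_synonym 'h side_fun = "nat \<times> nat \<Rightarrow> 'h symp_space"

lemma sides_iff [simp]: "(t, i) \<in> sides S \<longleftrightarrow> t < ntri S \<and> i < 3"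
  by (simp add: sides_def)

lemma finite_sides: "finite (sides S)"
  by (simp add: sides_def)

text \<open>The coefficient of the side in the boundary of the fundamental cycle.\<close>

definition side_weight :: "tri_surface \<Rightarrow> nat \<times> nat \<Rightarrow> real" where
  "side_weight S a = (-1) ^ snd a * of_int (tri_sign S (fst a))"

lemma sum_sides:
  "(\<Sum>a\<in>sides S. side_weight S a * f a) =
   (\<Sum>t<ntri S. of_int (tri_sign S t) * (f (t, 0) - f (t, 1) + f (t, 2)))"
proof -
  have "(\<Sum>a\<in>sides S. side_weight S a * f a) = (\<Sum>t<ntri S. \<Sum>i<3. side_weight S (t, i) * f (t, i))"
    unfolding sides_def by (simp add: sum.cartesian_product)
  also have "\<dots> = (\<Sum>t<ntri S. of_int (tri_sign S t) * (f (t, 0) - f (t, 1) + f (t, 2)))"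
    by (intro sum.cong refl) (simp add: side_weight_def numeral_3_eq_3 numeral_2_eq_2 algebra_simps)
  finally show ?thesis .
qed

locale oriented_surface =
  fixes S :: tri_surface
  assumes closed: "closed_oriented_surface S"
begin

lemma glue_sides: "a \<in> sides S \<Longrightarrow> glue S a \<in> sides S"
  and glue_neq: "a \<in> sides S \<Longrightarrow> glue S a \<noteq> a"
  and glue_glue: "a \<in> sides S \<Longrightarrow> glue S (glue S a) = a"
  using closed by (auto simp: closed_oriented_surface_def simp del: sides_iff)

lemma tri_sign_cases: "t < ntri S \<Longrightarrow> tri_sign S t = 1 \<or> tri_sign S t = - 1"
  using closed by (auto simp: closed_oriented_surface_def)

lemma weight_glue: 
  assumes a: "a \<in> sides S"
  shows "side_weight S (glue S a) = - side_weight S a"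
proof -
  obtain t i s j where *: "a = (t, i)" "glue S a = (s, j)" by (cases a, cases "glue S a")
  have "(-1) ^ i * tri_sign S t = - ((-1) ^ j * tri_sign S s)"
    using closed a * unfolding closed_oriented_surface_def by blast
  then have "real_of_int ((-1) ^ i * tri_sign S t) = real_of_int (- ((-1) ^ j * tri_sign S s))" by simp
  then show ?thesis using * by (simp add: side_weight_def)
qed

text \<open>Glued sides have opposite weights. The symmetry of the cup product, its vanishing on
  coboundaries and its comparison with the corner form all come down to collecting the terms into
  such an \<open>f\<close>.\<close>

lemma sum_glue_invariant:
  assumes f: "\<And>a. a \<in> sides S \<Longrightarrow> f (glue S a) = f a"
  shows "(\<Sum>t<ntri S. of_int (tri_sign S t) * (f (t, 0) - f (t, 1) + f (t, 2))) = (0::real)"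
proof -
  have "bij_betw (glue S) (sides S) (sides S)"
    by (rule bij_betw_byWitness[of _ "glue S"]) (auto simp: glue_glue glue_sides simp del: sides_iff)
  then have "(\<Sum>a\<in>sides S. side_weight S a * f a) = (\<Sum>a\<in>sides S. side_weight S (glue S a) * f (glue S a))"
    by (rule sum.reindex_bij_betw[symmetric])
  also have "\<dots> = (\<Sum>a\<in>sides S. - (side_weight S a * f a))"
    by (rule sum.cong) (auto simp: f weight_glue simp del: sides_iff)
  finally show ?thesis by (simp add: sum_negf sum_sides)
qed

end

lemma Sp_inv_closed:
  assumes x: "x \<in> carrier Sp"
  shows "inv_into UNIV x \<in> carrier Sp"
proof -
  have s: "x (inv_into UNIV x v) = v" for v using Sp_bij[OF x] by (simp add: bij_is_surj surj_f_inv_f)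
  have "linear (inv_into UNIV x)" using Sp_linear[OF x] Sp_bij[OF x]
    by (simp add: bij_is_inj bij_is_surj linear_injective_isomorphism inj_linear_imp_inv_linear)
  moreover have "symp_form (inv_into UNIV x u) (inv_into UNIV x v) = symp_form u v" for u v
    using Sp_form[OF x, of "inv_into UNIV x u" "inv_into UNIV x v"] by (simp add: s)
  ultimately show ?thesis using Sp_bij[OF x] by (simp add: Sp_def bij_imp_bij_inv del: split_paired_All)
qed

lemma Sp_apply_inv: "x \<in> carrier Sp \<Longrightarrow> x (inv_into UNIV x v) = v"
  by (simp add: Sp_bij bij_is_surj surj_f_inv_f)

lemma Sp_inv_apply: "x \<in> carrier Sp \<Longrightarrow> inv_into UNIV x (x v) = v"
  by (simp add: Sp_bij bij_is_inj)

section \<open>Twisted 1-cocycles and Maslov triples of a symplectic local system\<close>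

locale symplectic_surface = oriented_surface +
  fixes \<phi> :: "nat \<times> nat \<Rightarrow> 'h::finite symp_space \<Rightarrow> 'h symp_space"
  assumes ls: "local_system Sp S \<phi>"
begin

abbreviation "n \<equiv> ntri S"
abbreviation "cup \<equiv> cup_pairing S \<phi>"
abbreviation "Z \<equiv> cocycles1 S \<phi>"
abbreviation "x t \<equiv> \<phi> (t, 2)"
abbreviation "y t \<equiv> \<phi> (t, 0)"
abbreviation sg :: "nat \<Rightarrow> real" where "sg t \<equiv> of_int (tri_sign S t)"

lemma \<phi>_Sp: "a \<in> sides S \<Longrightarrow> \<phi> a \<in> carrier Sp"
  and \<phi>_glue: "a \<in> sides S \<Longrightarrow> \<phi> (glue S a) = \<phi> a"
  using ls by (auto simp: local_system_def simp del: sides_iff)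

lemma xy_Sp: "t < n \<Longrightarrow> x t \<in> carrier Sp" "t < n \<Longrightarrow> y t \<in> carrier Sp"
  by (auto intro: \<phi>_Sp)

lemma \<phi>_1: "t < n \<Longrightarrow> \<phi> (t, Suc 0) = x t \<circ> y t"
  using ls by (simp add: local_system_def Sp_simps)

lemmas lin_x = Sp_linear[OF xy_Sp(1)] and lin_y = Sp_linear[OF xy_Sp(2)]

lemmas lin_simps = linear_add[OF lin_x] linear_add[OF lin_y] linear_diff[OF lin_x] linear_diff[OF lin_y]
  linear_neg[OF lin_x] linear_neg[OF lin_y] linear_scale[OF lin_x] linear_scale[OF lin_y]
  linear_0[OF lin_x] linear_0[OF lin_y]

lemma bilinear_cup: "bilinear (cup)"
  by (auto simp: bilinear_def linear_iff cup_pairing_def lin_simps symp_form_bilinear_simps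
      sum.distrib[symmetric] sum_distrib_left algebra_simps intro!: sum.cong)

lemma cocycleD: 
  assumes "u \<in> Z"
  shows "a \<in> sides S \<Longrightarrow> u (glue S a) = u a" "a \<notin> sides S \<Longrightarrow> u a = 0"
    "t < n \<Longrightarrow> u (t, 1) = u (t, 2) + x t (u (t, 0))"
  using assms by (auto simp: cocycles1_def cochains1_def algebra_simps simp del: sides_iff split_paired_All)

lemma cocycleI:
  assumes "\<And>a. a \<in> sides S \<Longrightarrow> u (glue S a) = u a" "\<And>a. a \<notin> sides S \<Longrightarrow> u a = 0"
    "\<And>t. t < n \<Longrightarrow> u (t, 1) = u (t, 2) + x t (u (t, 0))"
  shows "u \<in> Z"
  using assms by (auto simp: cocycles1_def cochains1_def algebra_simps simp del: sides_iff)

lemma subspace_Z: "subspace Z"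
  unfolding subspace_def
proof (intro conjI ballI allI)
  show "0 \<in> Z" by (rule cocycleI) (auto simp: lin_simps)
  show "u + v \<in> Z" if "u \<in> Z" "v \<in> Z" for u v
    using cocycleD[OF that(1)] cocycleD[OF that(2)] by (intro cocycleI) (auto simp: lin_simps simp del: sides_iff)
  show "c *\<^sub>R u \<in> Z" if "u \<in> Z" for c u
    using cocycleD[OF that] by (intro cocycleI) (auto simp: lin_simps algebra_simps simp del: sides_iff)
qed

text \<open>Two signs cancel: 1-cocycles anticommute up to a coboundary, and
  \<open>symp_form\<close> is skew. Explicitly, expanding \<open>f\<close> on side 1 by the cocycle
  equation shows that the difference of the two products is minus the coboundary of
  \<open>f\<close>.\<close>

lemma cup_sym:
  assumes u: "u \<in> Z" and v: "v \<in> Z"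
  shows "cup u v = cup v u"
proof -
  define f where "f a = symp_form (u a) (v a)" for a
  have "cup u v - cup v u = - (\<Sum>t<n. sg t * (f (t, 0) - f (t, 1) + f (t, 2)))"
    unfolding cup_pairing_def sum_subtractf[symmetric] sum_negf[symmetric]
  proof (rule sum.cong[OF refl])
    fix t assume "t \<in> {..<n}"
    then have t: "t < n" by simp
    have "f (t, 0) = symp_form (x t (u (t, 0))) (x t (v (t, 0)))"
      by (simp add: f_def Sp_form[OF xy_Sp(1)[OF t]])
    moreover have "f (t, 1) = symp_form (u (t, 2) + x t (u (t, 0))) (v (t, 2) + x t (v (t, 0)))"
      by (simp add: f_def cocycleD(3)[OF u t, simplified] cocycleD(3)[OF v t, simplified])
    ultimately show "sg t * symp_form (u (t, 2)) (x t (v (t, 0))) - sg t * symp_form (v (t, 2)) (x t (u (t, 0)))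
        = - (sg t * (f (t, 0) - f (t, 1) + f (t, 2)))"
      using symp_form_swap[of "v (t, 2)" "x t (u (t, 0))"]
      by (simp add: f_def symp_form_bilinear_simps algebra_simps)
  qed
  also have "\<dots> = 0"
    using sum_glue_invariant[of f] cocycleD(1)[OF u] cocycleD(1)[OF v] by (simp add: f_def del: sides_iff)
  finally show ?thesis by simp
qed

lemma sym_form_Z: "sym_form Z (cup)"
  by unfold_locales (use subspace_Z bilinear_cup cup_sym in auto)

lemma finite_coords_Z: "finite_coords Z"
  by (rule finite_coords_fun[OF finite_sides[of S]]) (auto dest: cocycleD simp del: sides_iff)

text \<open>The index set of the sides is reused: here \<open>(t, i)\<close> is the corner of
  \<open>t\<close> at vertex \<open>i\<close>. There is no condition across glued sides, so this is
  the direct sum of the Maslov spaces of all triangles.\<close>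

definition corner_space :: "'h side_fun set" where
  "corner_space = {w. (\<forall>a. a \<notin> sides S \<longrightarrow> w a = 0) \<and>
     (\<forall>t<n. (w (t, 0), w (t, 1), w (t, 2)) \<in> maslov_space (x t) (y t))}"

definition corner_form :: "'h side_fun \<Rightarrow> 'h side_fun \<Rightarrow> real" where
  "corner_form w v = (\<Sum>t<n. sg t * symp_form (w (t, 0)) (x t (v (t, 1))))"

lemma corner_spaceD:
  assumes "w \<in> corner_space"
  shows "a \<notin> sides S \<Longrightarrow> w a = 0" "a \<in> sides S \<Longrightarrow> snd (w a) = 0"
    "t < n \<Longrightarrow> w (t, 0) + x t (w (t, 1)) + x t (y t (w (t, 2))) = 0"
proof -
  show "a \<notin> sides S \<Longrightarrow> w a = 0" "t < n \<Longrightarrow> w (t, 0) + x t (w (t, 1)) + x t (y t (w (t, 2))) = 0"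
    using assms by (auto simp: corner_space_def maslov_space_def simp del: sides_iff split_paired_All)
  assume "a \<in> sides S"
  then obtain t i where a: "a = (t, i)" "t < n" "i < 3" by (cases a) auto
  then have "i = 0 \<or> i = 1 \<or> i = 2" by auto
  then show "snd (w a) = 0" using a assms by (auto simp: corner_space_def maslov_space_def)
qed

lemma corner_spaceI:
  assumes "\<And>a. a \<notin> sides S \<Longrightarrow> w a = 0" "\<And>a. a \<in> sides S \<Longrightarrow> snd (w a) = 0"
    "\<And>t. t < n \<Longrightarrow> w (t, 0) + x t (w (t, 1)) + x t (y t (w (t, 2))) = 0"
  shows "w \<in> corner_space"
  unfolding corner_space_def maslov_space_def
  using assms(1) assms(2)[of "(_, 0)"] assms(2)[of "(_, 1)"] assms(2)[of "(_, 2)"] assms(3) by auto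

lemma sym_form_corner: "sym_form corner_space corner_form"
proof
  show "subspace corner_space"
    unfolding subspace_def
  proof (intro conjI ballI allI)
    show "0 \<in> corner_space" by (rule corner_spaceI) (auto simp: lin_simps)
    show "u + v \<in> corner_space" if "u \<in> corner_space" "v \<in> corner_space" for u v
    proof (rule corner_spaceI)
      show "(u + v) (t, 0) + x t ((u + v) (t, 1)) + x t (y t ((u + v) (t, 2))) = 0" if t: "t < n" for t
      proof -
        have "(u (t, 0) + x t (u (t, 1)) + x t (y t (u (t, 2)))) + (v (t, 0) + x t (v (t, 1)) + x t (y t (v (t, 2)))) = 0"
          using corner_spaceD(3)[OF \<open>u \<in> corner_space\<close> t] corner_spaceD(3)[OF \<open>v \<in> corner_space\<close> t] by simp
        then show ?thesis using t by (simp add: lin_simps add_ac)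
      qed
    qed (use corner_spaceD[OF that(1)] corner_spaceD[OF that(2)] in \<open>auto simp del: sides_iff\<close>)
    show "c *\<^sub>R u \<in> corner_space" if "u \<in> corner_space" for c u
    proof (rule corner_spaceI)
      show "(c *\<^sub>R u) (t, 0) + x t ((c *\<^sub>R u) (t, 1)) + x t (y t ((c *\<^sub>R u) (t, 2))) = 0" if t: "t < n" for t
      proof -
        have "c *\<^sub>R (u (t, 0) + x t (u (t, 1)) + x t (y t (u (t, 2)))) = 0"
          using corner_spaceD(3)[OF \<open>u \<in> corner_space\<close> t] by simp
        then show ?thesis using t by (simp add: lin_simps scaleR_add_right)
      qed
    qed (use corner_spaceD[OF that] in \<open>auto simp del: sides_iff\<close>)
  qed
  show "bilinear corner_form"
    by (auto simp: bilinear_def linear_iff corner_form_def lin_simps symp_form_bilinear_simps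
        sum.distrib[symmetric] sum_distrib_left algebra_simps intro!: sum.cong)
  show "corner_form u v = corner_form v u" if "u \<in> corner_space" "v \<in> corner_space" for u v
    unfolding corner_form_def
  proof (rule sum.cong[OF refl])
    fix t assume "t \<in> {..<n}"
    then have t: "t < n" by simp
    have "symp_form (u (t, 0)) (x t (v (t, 1))) = symp_form (v (t, 0)) (x t (u (t, 1)))"
      by (rule symp_form_triangle_sym[OF xy_Sp[OF t], where c = "u (t, 2)" and c' = "v (t, 2)"])
        (use t corner_spaceD[OF that(1)] corner_spaceD[OF that(2)] in auto)
    then show "sg t * symp_form (u (t, 0)) (x t (v (t, 1))) = sg t * symp_form (v (t, 0)) (x t (u (t, 1)))"
      by simp
  qed
qed

lemma finite_coords_corner: "finite_coords corner_space"
  by (rule finite_coords_fun[OF finite_sides[of S]]) (auto dest: corner_spaceD simp del: sides_iff)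

lemma signature_corner:
  "signature corner_space corner_form =
   (\<Sum>t<n. tri_sign S t * signature (maslov_space (x t) (y t)) (maslov_form (x t)))"
proof -
  define \<pi> where "\<pi> t w = (w (t, 0), w (t, 1), w (t, 2))" for t and w :: "'h side_fun"
  define \<iota> where "\<iota> t q = (\<lambda>(s, i::nat). if s = t \<and> i < 3 then (if i = 0 then fst q else if i = 1 then fst (snd q)
     else snd (snd q)) else 0)" for t :: nat and q :: "'h symp_space \<times> 'h symp_space \<times> 'h symp_space"
  show ?thesis
  proof (rule signature_direct_sum[OF sym_form_corner, of "{..<n}" _ _ "tri_sign S" \<iota> \<pi>])
    fix t assume "t \<in> {..<n}"
    then have t: "t < n" by simp
    show "sym_form (maslov_space (x t) (y t)) (maslov_form (x t))"
      by (rule sym_form_maslov[OF xy_Sp[OF t]])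
    show "finite_coords (maslov_space (x t) (y t))" by (rule finite_coords_euclidean)
    show "tri_sign S t = 1 \<or> tri_sign S t = - 1" by (rule tri_sign_cases[OF t])
    show "\<iota> t q \<in> corner_space" if "q \<in> maslov_space (x t) (y t)" for q
    proof (rule corner_spaceI)
      show "\<iota> t q (s, 0) + x s (\<iota> t q (s, 1)) + x s (y s (\<iota> t q (s, 2))) = 0" if s: "s < n" for s
      proof (cases "s = t")
        case True
        then show ?thesis using \<open>q \<in> _\<close> by (auto simp: \<iota>_def maslov_space_def)
      next
        case False
        then show ?thesis using s by (simp add: \<iota>_def lin_simps)
      qed
    qed (use that t in \<open>auto simp: \<iota>_def maslov_space_def split: prod.splits if_splits\<close>)
    show "\<pi> t w \<in> maslov_space (x t) (y t)" if "w \<in> corner_space" for w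
      using that t by (simp add: corner_space_def \<pi>_def)
    show "\<pi> t' (\<iota> t q) = (if t = t' then q else 0)" for t' q
      by (simp add: \<pi>_def \<iota>_def zero_prod_def)
    show "corner_form w (\<iota> t q) = of_int (tri_sign S t) * maslov_form (x t) (\<pi> t w) q" for w q
    proof -
      have "corner_form w (\<iota> t q) = (\<Sum>s<n. if s = t then sg t * symp_form (w (t, 0)) (x t (fst (snd q))) else 0)"
        unfolding corner_form_def
        by (rule sum.cong) (auto simp: \<iota>_def lin_simps symp_form_bilinear_simps)
      then show ?thesis using t by (simp add: maslov_form_def \<pi>_def)
    qed
  next
    show "corner_form w w = (\<Sum>t<n. of_int (tri_sign S t) * maslov_form (x t) (\<pi> t w) (\<pi> t w))" for w
      by (simp add: corner_form_def maslov_form_def \<pi>_def)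
  qed simp
qed

text \<open>Piecewise flat sections on the flags (side, endpoint): \<open>p\<close> and \<open>q\<close> give the values at the start
  and at the end of a side. They induce a 1-cochain on the sides and a function on the corners.\<close>

definition side_diff :: "'h side_fun \<times> 'h side_fun \<Rightarrow> 'h side_fun" where
  "side_diff pq = (\<lambda>a. if a \<in> sides S then fst pq a - \<phi> a (snd pq a) else 0)"

text \<open>Vertex 0 is the start of sides 2 and 1, vertex 1 the start of side 0 and the end of side
  2, vertex 2 the end of sides 1 and 0.\<close>

definition corner_diff :: "'h side_fun \<times> 'h side_fun \<Rightarrow> 'h side_fun" where
  "corner_diff pq = (\<lambda>(t, i). if (t, i) \<in> sides S then
     if i = 0 then fst pq (t, 2) - fst pq (t, 1)
     else if i = 1 then fst pq (t, 0) - snd pq (t, 2)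
     else snd pq (t, 1) - snd pq (t, 0) else 0)"

definition glue_inv :: "'h side_fun \<Rightarrow> bool" where
  "glue_inv p \<longleftrightarrow> (\<forall>a\<in>sides S. p (glue S a) = p a)"

lemma linear_side_diff: "linear side_diff"
proof -
  have "\<phi> a (u + v) = \<phi> a u + \<phi> a v" "\<phi> a (c *\<^sub>R u) = c *\<^sub>R \<phi> a u" if "a \<in> sides S" for a u v c
    using Sp_linear[OF \<phi>_Sp[OF that]] by (simp_all add: linear_add linear_scale)
  then show ?thesis
    by (auto simp: linear_iff side_diff_def fun_eq_iff algebra_simps simp del: sides_iff)
qed

lemma linear_corner_diff: "linear corner_diff"
  by (auto simp: linear_iff corner_diff_def fun_eq_iff algebra_simps)

lemma corner_diff_simps:
  "t < n \<Longrightarrow> corner_diff pq (t, 0) = fst pq (t, 2) - fst pq (t, 1)"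
  "t < n \<Longrightarrow> corner_diff pq (t, Suc 0) = fst pq (t, 0) - snd pq (t, 2)"
  "t < n \<Longrightarrow> corner_diff pq (t, 2) = snd pq (t, 1) - snd pq (t, 0)"
  "a \<notin> sides S \<Longrightarrow> corner_diff pq a = 0"
  by (auto simp: corner_diff_def split: prod.splits)

text \<open>Both sides are the alternating sum of the six flag values of the triangle, transported
  to vertex 0, once grouped by corners and once by sides. Hence the corner triple closes up iff the
  side differences satisfy the cocycle equation.\<close>

lemma corner_diff_closed_iff:
  assumes t: "t < n"
  shows "corner_diff pq (t, 0) + x t (corner_diff pq (t, 1)) + x t (y t (corner_diff pq (t, 2))) =
    side_diff pq (t, 2) + x t (side_diff pq (t, 0)) - side_diff pq (t, 1)"
  using t by (simp add: corner_diff_simps side_diff_def \<phi>_1 lin_simps algebra_simps)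

text \<open>Here \<open>s i\<close> and \<open>e i\<close> will be the values at the start and the
  end of side \<open>i\<close>, transported to vertex 0. The first bracket collects one correction
  for each corner, the second one for each side.\<close>

lemma hexagon_identity:
  fixes s0 :: "'h symp_space"
  assumes "s2 - s1 + (s0 - e2) + (e1 - e0) = 0"
  shows "symp_form (s2 - e2) (s0 - e0) = symp_form (s2 - s1) (s0 - e2)
     - (symp_form s1 s2 + symp_form e2 s0 + symp_form e0 e1)
     + (symp_form s2 e2 + symp_form s0 e0 - symp_form s1 e1)"
proof -
  have e1: "e1 = s1 - s2 + e2 - s0 + e0"
    using assms by (simp add: algebra_simps eq_diff_eq)
  show ?thesis unfolding e1
    using symp_form_swap[of e2 s2] symp_form_swap[of e0 s2] symp_form_swap[of s1 s2] symp_form_swap[of s0 s2]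
      symp_form_swap[of e2 s0] symp_form_swap[of e0 s0] symp_form_swap[of s1 s0]
      symp_form_swap[of e2 e0] symp_form_swap[of s1 e0] symp_form_swap[of s1 e2]
    by (simp add: symp_form_bilinear_simps)
qed

text \<open>For a section with values in \<open>L\<close> the corner corrections of
  \<open>hexagon_identity\<close> would vanish. Only horizontal corner differences are assumed, as
  \<open>coisotropic\<close> requires; the corrections are then differences of the potential
  \<open>F\<close>, and regrouped by sides they cancel through the gluing together with the side
  corrections.\<close>

lemma cup_eq_corner_form:
  assumes inv: "glue_inv (fst pq)" "glue_inv (snd pq)"
    and hor: "\<And>a. a \<in> sides S \<Longrightarrow> snd (corner_diff pq a) = 0"
    and closed: "\<And>t. t < n \<Longrightarrow>
      corner_diff pq (t, 0) + x t (corner_diff pq (t, 1)) + x t (y t (corner_diff pq (t, 2))) = 0"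
  shows "cup (side_diff pq) (side_diff pq) = corner_form (corner_diff pq) (corner_diff pq)"
proof -
  obtain p q where pq: "pq = (p, q)" by (cases pq)
  define F where "F v = fst v \<bullet> snd v" for v :: "'h symp_space"
  define f where "f a = symp_form (p a) (\<phi> a (q a)) + F (p a) - F (q a)" for a
  have F: "symp_form u v = F u - F v" if "snd u = snd v" for u v :: "'h symp_space"
    using that by (simp add: F_def symp_form_def inner_commute)
  have "cup (side_diff pq) (side_diff pq) - corner_form (corner_diff pq) (corner_diff pq)
    = (\<Sum>t<n. sg t * (f (t, 0) - f (t, 1) + f (t, 2)))"
    unfolding cup_pairing_def corner_form_def sum_subtractf[symmetric]
  proof (rule sum.cong[OF refl])
    fix t assume "t \<in> {..<n}"
    then have t: "t < n" by simp
    have c: "p (t, 2) - p (t, 1) + (x t (p (t, 0)) - x t (q (t, 2))) + (x t (y t (q (t, 1))) - x t (y t (q (t, 0)))) = 0"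
      using closed[OF t] t by (simp add: corner_diff_simps pq lin_simps)
    have h: "snd (p (t, 2)) = snd (p (t, 1))" "snd (p (t, 0)) = snd (q (t, 2))" "snd (q (t, 1)) = snd (q (t, 0))"
      using hor[of "(t, 0)"] hor[of "(t, 1)"] hor[of "(t, 2)"] t by (simp_all add: corner_diff_simps pq)
    have "symp_form (p (t, 1)) (p (t, 2)) = F (p (t, 1)) - F (p (t, 2))"
      "symp_form (x t (q (t, 2))) (x t (p (t, 0))) = F (q (t, 2)) - F (p (t, 0))"
      "symp_form (x t (y t (q (t, 0)))) (x t (y t (q (t, 1)))) = F (q (t, 0)) - F (q (t, 1))"
      using t h by (simp_all add: F Sp_form[OF xy_Sp(1)] Sp_form[OF xy_Sp(2)])
    moreover have "symp_form (p (t, 2)) (x t (q (t, 2))) = f (t, 2) - F (p (t, 2)) + F (q (t, 2))"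
      "symp_form (x t (p (t, 0))) (x t (y t (q (t, 0)))) = f (t, 0) - F (p (t, 0)) + F (q (t, 0))"
      "symp_form (p (t, 1)) (x t (y t (q (t, 1)))) = f (t, 1) - F (p (t, 1)) + F (q (t, 1))"
      using t by (simp_all add: f_def \<phi>_1 Sp_form[OF xy_Sp(1)])
    ultimately have "symp_form (p (t, 2) - x t (q (t, 2))) (x t (p (t, 0)) - x t (y t (q (t, 0))))
      = symp_form (p (t, 2) - p (t, 1)) (x t (p (t, 0)) - x t (q (t, 2))) + (f (t, 0) - f (t, 1) + f (t, 2))"
      using hexagon_identity[OF c] by simp
    then have "symp_form (side_diff pq (t, 2)) (x t (side_diff pq (t, 0))) =
       symp_form (corner_diff pq (t, 0)) (x t (corner_diff pq (t, 1))) + (f (t, 0) - f (t, 1) + f (t, 2))"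
      using t by (simp add: side_diff_def corner_diff_simps pq lin_simps)
    then show "sg t * symp_form (side_diff pq (t, 2)) (x t (side_diff pq (t, 0))) -
       sg t * symp_form (corner_diff pq (t, 0)) (x t (corner_diff pq (t, 1))) = sg t * (f (t, 0) - f (t, 1) + f (t, 2))"
      unfolding right_diff_distrib[symmetric] by simp
  qed
  also have "\<dots> = 0"
    using sum_glue_invariant[of f] inv by (simp add: f_def glue_inv_def pq \<phi>_glue del: sides_iff)
  finally show ?thesis by simp
qed

end

lemma symp_form_represents:
  fixes l :: "'h::finite symp_space \<Rightarrow> real"
  assumes "linear l"
  shows "\<exists>\<eta>. \<forall>v. l v = symp_form \<eta> v"
proof -
  have "l v = symp_form (snd (adjoint l 1), - fst (adjoint l 1)) v" for v
    using adjoint_works[OF assms, of v 1] by (simp add: symp_form_def inner_prod_def inner_commute)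
  then show ?thesis by blast
qed

text \<open>Lagrange multipliers: by \<open>ker\<close>, \<open>f\<close> factors on
  \<open>W\<close> through \<open>C\<close>, explicitly through the right inverse \<open>g\<close>.
  The factor is a sum of functionals of the single coordinates, each represented by the
  nondegenerate \<open>symp_form\<close>.\<close>

lemma symp_multipliers:
  fixes C :: "'a::real_vector \<Rightarrow> nat \<Rightarrow> 'h::finite symp_space"
  assumes C: "linear C" and f: "linear (f :: 'a \<Rightarrow> real)" and W: "subspace W"
    and ker: "\<And>\<xi>. \<xi> \<in> W \<Longrightarrow> C \<xi> = 0 \<Longrightarrow> f \<xi> = 0"
    and supp: "\<And>\<xi> t. t \<ge> n \<Longrightarrow> C \<xi> t = 0"
  shows "\<exists>\<eta>. \<forall>\<xi>\<in>W. f \<xi> = (\<Sum>t<n. symp_form (\<eta> t) (C \<xi> t))"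
proof -
  obtain g where g: "range g \<subseteq> W" "linear g" "\<And>\<xi>. \<xi> \<in> W \<Longrightarrow> C (g (C \<xi>)) = C \<xi>"
    using linear_exists_right_inverse_on[OF C W] by auto
  define \<delta> where "\<delta> t v = (\<lambda>s::nat. if s = t then v else 0)" for t and v :: "'h symp_space"
  have "linear (\<lambda>v. f (g (\<delta> t v)))" for t
  proof -
    have "linear (\<delta> t)" by (auto simp: linear_iff \<delta>_def fun_eq_iff)
    then show ?thesis using linear_compose[OF linear_compose[OF _ g(2)] f] by (simp add: o_def)
  qed
  then have "\<forall>t. \<exists>\<eta>. \<forall>v. f (g (\<delta> t v)) = symp_form \<eta> v" using symp_form_represents by blast
  then obtain \<eta> where \<eta>: "\<And>t v. f (g (\<delta> t v)) = symp_form (\<eta> t) v" by metis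
  have "f \<xi> = (\<Sum>t<n. symp_form (\<eta> t) (C \<xi> t))" if \<xi>: "\<xi> \<in> W" for \<xi>
  proof -
    have "C (\<xi> - g (C \<xi>)) = 0" using g(3)[OF \<xi>] by (simp add: linear_diff[OF C])
    moreover have "\<xi> - g (C \<xi>) \<in> W" using g(1) \<xi> W by (intro subspace_diff) auto
    ultimately have "f (\<xi> - g (C \<xi>)) = 0" by (intro ker)
    then have f1: "f \<xi> = f (g (C \<xi>))" by (simp add: linear_diff[OF f])
    have "C \<xi> = (\<Sum>t<n. \<delta> t (C \<xi> t))"
    proof
      fix s
      have "(\<Sum>t<n. \<delta> t (C \<xi> t) s) = (\<Sum>t<n. if t = s then C \<xi> s else 0)"
        by (rule sum.cong) (auto simp: \<delta>_def)
      also have "\<dots> = C \<xi> s" using supp[of s \<xi>] by auto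
      finally show "C \<xi> s = (\<Sum>t<n. \<delta> t (C \<xi> t)) s" by (simp add: sum_fun_apply)
    qed
    then have "f (g (C \<xi>)) = f (g (\<Sum>t<n. \<delta> t (C \<xi> t)))" by (rule arg_cong)
    also have "\<dots> = (\<Sum>t<n. f (g (\<delta> t (C \<xi> t))))"
      by (simp add: linear_sum[OF g(2)] linear_sum[OF f])
    finally show ?thesis by (simp add: f1 \<eta>)
  qed
  then show ?thesis by blast
qed

section \<open>The Lagrangian relation between cocycles and corner triples\<close>

context symplectic_surface
begin

definition flag_space :: "('h side_fun \<times> 'h side_fun) set" where
  "flag_space = {pq. glue_inv (fst pq) \<and> glue_inv (snd pq) \<and>
     (\<forall>a. a \<notin> sides S \<longrightarrow> fst pq a = 0 \<and> snd pq a = 0) \<and>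
     (\<forall>a. snd (fst pq a) = 0 \<and> snd (snd pq a) = 0)}"

definition closing ::
  "'h side_fun \<times> 'h side_fun \<Rightarrow> nat \<Rightarrow> 'h symp_space" where
  "closing pq t = (if t < n then corner_diff pq (t, 0) + x t (corner_diff pq (t, 1)) +
     x t (y t (corner_diff pq (t, 2))) else 0)"

lemma subspace_flag_space: "subspace flag_space"
  by (auto simp: subspace_def flag_space_def glue_inv_def simp del: sides_iff)

lemma linear_closing: "linear closing"
  using linear_corner_diff
  by (auto simp: linear_iff closing_def fun_eq_iff lin_simps scaleR_add_right)

text \<open>The test section is supported on one glued pair of sides, with a value \<open>v\<close>
  in \<open>L\<close> built from the jump of \<open>Q\<close>. The opposite weights turn the sum
  into a nonzero multiple of the squared norm of \<open>v\<close>. In effect, the jump is orthogonal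
  to \<open>L\<close>, so it lies in \<open>L\<close>.\<close>

lemma snd_eq_of_glue_test:
  assumes test: "\<And>p. glue_inv p \<Longrightarrow> (\<And>a. a \<notin> sides S \<Longrightarrow> p a = 0) \<Longrightarrow> (\<And>a. snd (p a) = 0) \<Longrightarrow>
      (\<Sum>a\<in>sides S. side_weight S a * symp_form (Q a) (p a)) = 0"
    and a: "a \<in> sides S"
  shows "snd (Q a) = snd (Q (glue S a))"
proof -
  define v :: "'h symp_space" where "v = (snd (Q a) - snd (Q (glue S a)), 0)"
  define p where "p b = (if b = a \<or> b = glue S a then v else 0)" for b
  have "glue_inv p"
    unfolding glue_inv_def
  proof
    fix b assume "b \<in> sides S"
    then have "glue S b = a \<longleftrightarrow> b = glue S a" "glue S b = glue S a \<longleftrightarrow> b = a"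
      using glue_glue[OF a] glue_glue[of b] by metis+
    then show "p (glue S b) = p b" by (auto simp: p_def)
  qed
  moreover have "p b = 0" if "b \<notin> sides S" for b
    using that a glue_sides[OF a] by (auto simp: p_def simp del: sides_iff)
  moreover have "snd (p b) = 0" for b by (simp add: p_def v_def)
  ultimately have "(\<Sum>b\<in>sides S. side_weight S b * symp_form (Q b) (p b)) = 0"
    by (rule test)
  then have "0 = (\<Sum>b\<in>sides S. side_weight S b * symp_form (Q b) (p b))" by simp
  also have "\<dots> = (\<Sum>b\<in>{a, glue S a}. side_weight S b * symp_form (Q b) (p b))"
    by (rule sum.mono_neutral_right)
      (use a glue_sides finite_sides in \<open>auto simp: p_def symp_form_bilinear_simps simp del: sides_iff\<close>)
  also have "\<dots> = side_weight S a * symp_form (Q a) v + side_weight S (glue S a) * symp_form (Q (glue S a)) v"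
    using glue_neq[OF a] by (simp add: p_def)
  also have "\<dots> = - side_weight S a * (fst v \<bullet> fst v)"
    using a by (simp add: weight_glue symp_form_def v_def inner_commute inner_diff_left inner_diff_right algebra_simps del: sides_iff)
  finally have "side_weight S a * (fst v \<bullet> fst v) = 0" by simp
  moreover have "side_weight S a \<noteq> 0"
    using a tri_sign_cases[of "fst a"] by (cases a) (auto simp: side_weight_def)
  ultimately show ?thesis by (simp add: v_def)
qed

text \<open>In the application \<open>a\<close>, \<open>b\<close>, \<open>c\<close> lie in three
  Lagrangians, one for each vertex, and \<open>k0\<close>, \<open>k1\<close>, \<open>k2\<close> in
  the intersection of the two Lagrangians at the ends of side 0, 1, 2. Such changes of a closed
  triple lie in the radical of the Maslov form.\<close>

lemma symp_form_perturb:
  assumes "a + b + c = 0"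
    and "symp_form a k1 = 0" "symp_form a k2 = 0" "symp_form k1 k2 = 0"
    and "symp_form b k0 = 0" "symp_form b k2 = 0" "symp_form k0 k2 = 0"
    and "symp_form c k0 = 0" "symp_form c k1 = 0" "symp_form k0 k1 = 0"
  shows "symp_form (a + k2 - k1) (b + k0 - k2) = symp_form a b"
proof -
  have "symp_form (a + b + c) k0 = 0" "symp_form (a + b + c) k1 = 0"
    using assms(1) by (simp_all add: symp_form_bilinear_simps)
  then have "symp_form a k0 = 0" "symp_form b k1 = 0"
    using assms(2-) by (simp_all add: symp_form_bilinear_simps)
  then show ?thesis
    using assms(2-) symp_form_swap[of b k1] symp_form_swap[of b k2] symp_form_swap[of k0 k1]
      symp_form_swap[of k0 k2]
    by (simp add: symp_form_bilinear_simps)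
qed

text \<open>The aim is a glue-invariant flag section with side differences \<open>u\<close> and with
  corner differences equal to \<open>w\<close> up to terms that do not change the form;
  \<open>cup_eq_corner_form\<close> then gives the claim. The section need not be in
  \<open>flag_space\<close>.\<close>

lemma coisotropic:
  assumes u: "u \<in> Z" and w: "w \<in> corner_space"
    and orth: "\<And>pq. pq \<in> flag_space \<Longrightarrow> closing pq = 0 \<Longrightarrow>
      cup u (side_diff pq) = corner_form w (corner_diff pq)"
  shows "cup u u = corner_form w w"
proof -
  interpret Z: sym_form Z "cup" by (rule sym_form_Z)
  interpret C: sym_form corner_space corner_form by (rule sym_form_corner)
  define f where "f pq = cup u (side_diff pq) - corner_form w (corner_diff pq)" for pq
  have linf: "linear f"
    using linear_side_diff linear_corner_diff
    by (auto simp: linear_iff f_def Z.add_right Z.scale_right C.add_right C.scale_right algebra_simps)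
  \<comment> \<open>The constraint \<open>closing pq = 0\<close> is traded for multipliers, so that
    arbitrary members of \<open>flag_space\<close> can serve as test sections.\<close>
  obtain \<eta>0 where \<eta>0: "\<And>pq. pq \<in> flag_space \<Longrightarrow> f pq = (\<Sum>t<n. symp_form (\<eta>0 t) (closing pq t))"
    using symp_multipliers[OF linear_closing linf subspace_flag_space, of n]
    by (auto simp: f_def orth closing_def)
  define \<eta> where "\<eta> t = sg t *\<^sub>R \<eta>0 t" for t
  have \<eta>0_eq: "symp_form (\<eta>0 t) v = sg t * symp_form (\<eta> t) v" if "t < n" for t v
    using tri_sign_cases[OF that] by (auto simp: \<eta>_def symp_form_bilinear_simps)
  define xi yi where "xi t = inv_into UNIV (x t)" and "yi t = inv_into UNIV (y t)" for t
  have xi: "x t (xi t v) = v" "xi t (x t v) = v" "y t (yi t v) = v" "yi t (y t v) = v" if "t < n" for t v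
    using xy_Sp[OF that] by (simp_all add: xi_def yi_def Sp_apply_inv Sp_inv_apply)
  have inv_\<phi>: "inv_into UNIV (\<phi> (t, Suc 0)) v = yi t (xi t v)" if "t < n" for t v
    using xy_Sp[OF that] \<phi>_1[OF that] by (simp add: xi_def yi_def o_inv_distrib Sp_bij)
  have lin_xi: "linear (xi t)" "linear (yi t)" if "t < n" for t
    using xy_Sp[OF that] by (simp_all add: xi_def yi_def Sp_linear Sp_inv_closed)
  note xi_simps = linear_add[OF lin_xi(1)] linear_add[OF lin_xi(2)] linear_diff[OF lin_xi(1)] linear_diff[OF lin_xi(2)]
    linear_neg[OF lin_xi(1)] linear_neg[OF lin_xi(2)]
  have form_xi: "symp_form (xi t a) b = symp_form a (x t b)" "symp_form (yi t a) b = symp_form a (y t b)"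
    if "t < n" for t a b
    using Sp_form[OF xy_Sp(1)[OF that], of "xi t a" b] Sp_form[OF xy_Sp(2)[OF that], of "yi t a" b]
    by (simp_all add: xi that)
  \<comment> \<open>The coefficients of the start values \<open>p\<close> and of the end values
    \<open>q\<close> in the functional minus its multiplier term, as \<open>key\<close>
    confirms.\<close>
  define Q where "Q = (\<lambda>(t, i::nat). if i = 0 then xi t (u (t, 2) - w (t, 0) - \<eta> t) else - \<eta> t)"
  define R where "R = (\<lambda>(t, i::nat). if i = 0 then yi t (xi t (\<eta> t - u (t, 2)))
    else if i = 1 then yi t (xi t (\<eta> t)) else xi t (w (t, 0) + \<eta> t))"
  have key: "(\<Sum>a\<in>sides S. side_weight S a * (symp_form (Q a) (p a) + symp_form (R a) (q a))) = 0"
    if pq: "(p, q) \<in> flag_space" for p q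
  proof -
    have "(\<Sum>a\<in>sides S. side_weight S a * (symp_form (Q a) (p a) + symp_form (R a) (q a))) =
       f (p, q) - (\<Sum>t<n. symp_form (\<eta>0 t) (closing (p, q) t))"
      unfolding sum_sides f_def cup_pairing_def corner_form_def sum_subtractf[symmetric]
    proof (rule sum.cong[OF refl])
      fix t assume "t \<in> {..<n}"
      then have t: "t < n" by simp
      have "symp_form (Q (t, 0)) (p (t, 0)) + symp_form (R (t, 0)) (q (t, 0))
         - (symp_form (Q (t, 1)) (p (t, 1)) + symp_form (R (t, 1)) (q (t, 1)))
         + (symp_form (Q (t, 2)) (p (t, 2)) + symp_form (R (t, 2)) (q (t, 2)))
        = symp_form (u (t, 2)) (x t (side_diff (p, q) (t, 0))) -
          symp_form (w (t, 0)) (x t (corner_diff (p, q) (t, 1))) - symp_form (\<eta> t) (closing (p, q) t)"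
        using t by (simp add: Q_def R_def form_xi side_diff_def corner_diff_simps closing_def lin_simps
            symp_form_bilinear_simps)
      then show "sg t * (symp_form (Q (t, 0)) (p (t, 0)) + symp_form (R (t, 0)) (q (t, 0))
         - (symp_form (Q (t, 1)) (p (t, 1)) + symp_form (R (t, 1)) (q (t, 1)))
         + (symp_form (Q (t, 2)) (p (t, 2)) + symp_form (R (t, 2)) (q (t, 2))))
        = sg t * symp_form (u (t, 2)) (x t (side_diff (p, q) (t, 0))) -
          sg t * symp_form (w (t, 0)) (x t (corner_diff (p, q) (t, 1))) - symp_form (\<eta>0 t) (closing (p, q) t)"
        by (simp only: \<eta>0_eq[OF t] right_diff_distrib)
    qed
    then show ?thesis using \<eta>0[OF pq] by simp
  qed
  have sQ: "snd (Q a) = snd (Q (glue S a))" if "a \<in> sides S" for a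
  proof (rule snd_eq_of_glue_test[OF _ that])
    show "(\<Sum>a\<in>sides S. side_weight S a * symp_form (Q a) (p a)) = 0"
      if "glue_inv p" "\<And>a. a \<notin> sides S \<Longrightarrow> p a = 0" "\<And>a. snd (p a) = 0" for p
      using key[of p 0] that by (simp add: flag_space_def glue_inv_def symp_form_bilinear_simps del: sides_iff)
  qed
  have sR: "snd (R a) = snd (R (glue S a))" if "a \<in> sides S" for a
  proof (rule snd_eq_of_glue_test[OF _ that])
    show "(\<Sum>a\<in>sides S. side_weight S a * symp_form (R a) (p a)) = 0"
      if "glue_inv p" "\<And>a. a \<notin> sides S \<Longrightarrow> p a = 0" "\<And>a. snd (p a) = 0" for p
      using key[of 0 p] that by (simp add: flag_space_def glue_inv_def symp_form_bilinear_simps del: sides_iff)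
  qed
  \<comment> \<open>With start values \<open>- X\<close> and end values chosen to give side
    differences \<open>u\<close>, the corner differences are exactly \<open>w\<close> in every
    triangle. What may fail is agreement across glued sides.\<close>
  define X where "X = (\<lambda>(t, i::nat). if i = 0 then xi t (u (t, 2) - w (t, 0) - \<eta> t) - w (t, 1)
    else if i = 1 then - \<eta> t else - \<eta> t - w (t, 0))"
  note wD = corner_spaceD[OF w] and uD = cocycleD[OF u]
  have w0: "snd (w (t, 0)) = 0" "snd (w (t, Suc 0)) = 0" "snd (w (t, 2)) = 0" if "t < n" for t
    using that wD(2)[of "(t, 0)"] wD(2)[of "(t, 1)"] wD(2)[of "(t, 2)"] by auto
  have w2: "y t (w (t, 2)) = - xi t (w (t, 0)) - w (t, Suc 0)" if t: "t < n" for t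
  proof -
    have "xi t (w (t, 0) + x t (w (t, 1)) + x t (y t (w (t, 2)))) = 0"
      using wD(3)[OF t] linear_0[OF lin_xi(1)[OF t]] by simp
    then have 0: "xi t (w (t, 0)) + w (t, Suc 0) + y t (w (t, 2)) = 0"
      using t by (simp add: xi_simps xi)
    have "y t (w (t, 2)) = (xi t (w (t, 0)) + w (t, Suc 0) + y t (w (t, 2))) - xi t (w (t, 0)) - w (t, Suc 0)"
      by simp
    then show ?thesis unfolding 0 by simp
  qed
  have three: "P a" if "a \<in> sides S" "\<And>t. t < n \<Longrightarrow> P (t, 0)" "\<And>t. t < n \<Longrightarrow> P (t, Suc 0)" "\<And>t. t < n \<Longrightarrow> P (t, 2)"
    for P :: "nat \<times> nat \<Rightarrow> bool" and a
  proof -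
    obtain t i where a: "a = (t, i)" "t < n" "i < 3" using \<open>a \<in> sides S\<close> by (cases a) auto
    then have "i = 0 \<or> i = Suc 0 \<or> i = 2" by auto
    then show ?thesis using a that by auto
  qed
  have X_start: "snd (X a) = snd (Q a)" if "a \<in> sides S" for a
    using that by (rule three) (simp_all add: X_def Q_def w0)
  have X_end: "snd (inv_into UNIV (\<phi> a) (X a)) = - snd (R a)" if "a \<in> sides S" for a
    using that
  proof (rule three)
    fix t assume t: "t < n"
    have "yi t (xi t (u (t, 2) - w (t, 0) - \<eta> t) - w (t, 1)) = yi t (xi t (u (t, 2) - \<eta> t) + y t (w (t, 2)))"
      using t w2[OF t] by (simp add: xi_simps)
    also have "\<dots> = yi t (xi t (u (t, 2) - \<eta> t)) + w (t, 2)"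
      using t by (simp add: xi_simps xi)
    finally have e: "yi t (X (t, 0)) = yi t (xi t (u (t, 2) - \<eta> t)) + w (t, 2)" by (simp add: X_def)
    show "snd (inv_into UNIV (\<phi> (t, 0)) (X (t, 0))) = - snd (R (t, 0))"
      unfolding yi_def[symmetric] e using t w0[OF t] by (simp add: R_def xi_simps)
    show "snd (inv_into UNIV (\<phi> (t, Suc 0)) (X (t, Suc 0))) = - snd (R (t, Suc 0))"
      using t by (simp add: X_def R_def inv_\<phi> xi_simps)
    show "snd (inv_into UNIV (\<phi> (t, 2)) (X (t, 2))) = - snd (R (t, 2))"
      using t by (simp add: X_def R_def xi_simps flip: xi_def)
  qed
  \<comment> \<open>By \<open>X_start\<close>, \<open>X_end\<close>, \<open>sQ\<close> and
    \<open>sR\<close>, the jump of \<open>X\<close> across a side lies in \<open>L\<close> at both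
    ends. Averaging over the glued pair restores invariance and alters the corner differences only
    by the half jumps \<open>\<kappa>\<close>, which \<open>symp_form_perturb\<close>
    absorbs.\<close>
  define X0 where "X0 a = (1 / 2) *\<^sub>R (X a + X (glue S a))" for a
  define \<kappa> where "\<kappa> a = (1 / 2) *\<^sub>R (X a - X (glue S a))" for a
  have X0_eq: "X0 a = X a - \<kappa> a" for a
    by (simp add: X0_def \<kappa>_def algebra_simps flip: scaleR_add_left)
  have \<kappa>_start: "snd (\<kappa> a) = 0" if "a \<in> sides S" for a
    using that X_start[OF that] X_start[OF glue_sides[OF that]] sQ[OF that] by (simp add: \<kappa>_def)
  have \<kappa>_end: "snd (inv_into UNIV (\<phi> a) (\<kappa> a)) = 0" if "a \<in> sides S" for a
  proof -
    have "linear (inv_into UNIV (\<phi> a))" using \<phi>_Sp[OF that] by (simp add: Sp_linear Sp_inv_closed)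
    then show ?thesis
      using X_end[OF that] X_end[OF glue_sides[OF that]] sR[OF that] \<phi>_glue[OF that]
      by (simp add: \<kappa>_def linear_scale linear_diff)
  qed
  define p where "p a = (if a \<in> sides S then - X0 a else 0)" for a
  define q where "q a = (if a \<in> sides S then - inv_into UNIV (\<phi> a) (X0 a + u a) else 0)" for a
  have X0_glue: "X0 (glue S a) = X0 a" if "a \<in> sides S" for a
    using glue_glue[OF that] by (simp add: X0_def add.commute)
  have inv: "glue_inv p" "glue_inv q"
    using X0_glue uD(1) \<phi>_glue glue_sides by (simp_all add: glue_inv_def p_def q_def del: sides_iff)
  have side: "side_diff (p, q) = u"
  proof
    fix a
    show "side_diff (p, q) a = u a"
    proof (cases "a \<in> sides S")
      case True
      then have "\<phi> a \<in> carrier Sp" by (rule \<phi>_Sp)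
      then show ?thesis
        using True by (simp add: side_diff_def p_def q_def linear_neg[OF Sp_linear] Sp_apply_inv del: sides_iff)
    next
      case False
      then show ?thesis using uD(2)[OF False] by (simp add: side_diff_def del: sides_iff)
    qed
  qed
  have D0: "corner_diff (p, q) (t, 0) = w (t, 0) + \<kappa> (t, 2) - \<kappa> (t, Suc 0)" if t: "t < n" for t
    using t by (simp add: corner_diff_simps p_def X0_eq) (simp add: X_def)
  have D1: "corner_diff (p, q) (t, Suc 0) = w (t, Suc 0) + \<kappa> (t, 0) - xi t (\<kappa> (t, 2))" if t: "t < n" for t
    using t by (simp add: corner_diff_simps p_def q_def X0_eq flip: xi_def) (simp add: X_def xi_simps)
  have u1: "u (t, Suc 0) = u (t, 2) + x t (u (t, 0))" if "t < n" for t using uD(3)[OF that] by simp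
  have D2: "corner_diff (p, q) (t, 2) = w (t, 2) + yi t (xi t (\<kappa> (t, Suc 0))) - yi t (\<kappa> (t, 0))" if t: "t < n" for t
  proof -
    have "w (t, 2) = yi t (- xi t (w (t, 0)) - w (t, Suc 0))" using w2[OF t] xi(4)[OF t] by metis
    then show ?thesis
      using t by (simp add: corner_diff_simps p_def q_def X0_eq inv_\<phi> flip: yi_def) (simp add: X_def xi_simps xi u1)
  qed
  have \<kappa>0: "snd (\<kappa> (t, 0)) = 0" "snd (\<kappa> (t, Suc 0)) = 0" "snd (\<kappa> (t, 2)) = 0" 
      "snd (yi t (\<kappa> (t, 0))) = 0" "snd (yi t (xi t (\<kappa> (t, Suc 0)))) = 0" "snd (xi t (\<kappa> (t, 2))) = 0" if t: "t < n" for t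
    using t \<kappa>_start[of "(t, 0)"] \<kappa>_start[of "(t, 1)"] \<kappa>_start[of "(t, 2)"]
      \<kappa>_end[of "(t, 0)"] \<kappa>_end[of "(t, 1)"] \<kappa>_end[of "(t, 2)"] inv_\<phi>[OF t]
    by (auto simp: xi_def yi_def)
  have hor: "snd (corner_diff (p, q) a) = 0" if "a \<in> sides S" for a
    using that by (rule three) (simp_all add: D0 D1 D2 \<kappa>0 w0)
  have closed: "corner_diff (p, q) (t, 0) + x t (corner_diff (p, q) (t, 1)) + x t (y t (corner_diff (p, q) (t, 2))) = 0"
    if "t < n" for t
    unfolding corner_diff_closed_iff[OF that] side using u1[OF that] by simp
  have "cup u u = corner_form (corner_diff (p, q)) (corner_diff (p, q))"
    using cup_eq_corner_form[of "(p, q)"] inv hor closed side by simp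
  also have "\<dots> = corner_form w w"
    unfolding corner_form_def
  proof (rule sum.cong[OF refl])
    fix t assume "t \<in> {..<n}"
    then have t: "t < n" by simp
    note fx = Sp_form[OF xy_Sp(1)[OF t]] and fy = Sp_form[OF xy_Sp(2)[OF t]]
    have "symp_form (w (t, 0) + \<kappa> (t, 2) - \<kappa> (t, Suc 0))
        (x t (w (t, Suc 0)) + x t (\<kappa> (t, 0)) - \<kappa> (t, 2)) = symp_form (w (t, 0)) (x t (w (t, Suc 0)))"
    proof (rule symp_form_perturb)
      show "w (t, 0) + x t (w (t, Suc 0)) + x t (y t (w (t, 2))) = 0" using wD(3)[OF t] by simp
      show "symp_form (w (t, 0)) (\<kappa> (t, Suc 0)) = 0" "symp_form (w (t, 0)) (\<kappa> (t, 2)) = 0"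
        "symp_form (\<kappa> (t, Suc 0)) (\<kappa> (t, 2)) = 0"
        using t by (simp_all add: symp_form_horizontal w0 \<kappa>0)
      have "symp_form (x t (w (t, Suc 0))) (x t (xi t (\<kappa> (t, 2)))) = 0"
        "symp_form (x t (\<kappa> (t, 0))) (x t (xi t (\<kappa> (t, 2)))) = 0"
        "symp_form (x t (w (t, Suc 0))) (x t (\<kappa> (t, 0))) = 0"
        using t by (simp_all add: fx symp_form_horizontal w0 \<kappa>0)
      then show "symp_form (x t (w (t, Suc 0))) (x t (\<kappa> (t, 0))) = 0"
        "symp_form (x t (w (t, Suc 0))) (\<kappa> (t, 2)) = 0" "symp_form (x t (\<kappa> (t, 0))) (\<kappa> (t, 2)) = 0"
        using t by (simp_all add: xi)
      have "symp_form (x t (y t (w (t, 2)))) (x t (y t (yi t (\<kappa> (t, 0))))) = 0"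
        "symp_form (x t (y t (w (t, 2)))) (x t (y t (yi t (xi t (\<kappa> (t, Suc 0)))))) = 0"
        "symp_form (x t (y t (yi t (\<kappa> (t, 0))))) (x t (y t (yi t (xi t (\<kappa> (t, Suc 0)))))) = 0"
        unfolding fx fy using t by (simp_all add: symp_form_horizontal w0 \<kappa>0)
      then show "symp_form (x t (y t (w (t, 2)))) (x t (\<kappa> (t, 0))) = 0"
        "symp_form (x t (y t (w (t, 2)))) (\<kappa> (t, Suc 0)) = 0" "symp_form (x t (\<kappa> (t, 0))) (\<kappa> (t, Suc 0)) = 0"
        using t by (simp_all add: xi)
    qed
    then show "sg t * symp_form (corner_diff (p, q) (t, 0)) (x t (corner_diff (p, q) (t, 1)))
       = sg t * symp_form (w (t, 0)) (x t (w (t, 1)))"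
      using t by (simp add: D0 D1 lin_simps xi)
  qed
  finally show ?thesis .
qed

lemma signature_cup:
  "signature Z (cup) =
   (\<Sum>t<n. tri_sign S t * signature (maslov_space (x t) (y t)) (maslov_form (x t)))"
proof -
  let ?\<Xi> = "{pq \<in> flag_space. closing pq = 0}"
  let ?\<Delta> = "(\<lambda>pq. (side_diff pq, corner_diff pq)) ` ?\<Xi>"
  have closed: "corner_diff pq (t, 0) + x t (corner_diff pq (t, 1)) + x t (y t (corner_diff pq (t, 2))) = 0"
    if "closing pq = 0" "t < n" for pq t
    using fun_cong[OF that(1), of t] that(2) by (simp add: closing_def)
  have hor: "snd (corner_diff pq a) = 0" if "pq \<in> flag_space" for pq a
    using that by (cases a) (auto simp: flag_space_def corner_diff_def)
  have "signature Z (cup) = signature corner_space corner_form"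
  proof (rule signature_cong_of_lagrangian_relation[OF sym_form_Z finite_coords_Z sym_form_corner finite_coords_corner])
    have "subspace ?\<Xi>"
    proof -
      have "?\<Xi> = flag_space \<inter> {pq. closing pq = 0}" by auto
      then show ?thesis
        using subspace_flag_space linear_subspace_kernel[OF linear_closing] by (simp add: subspace_inter)
    qed
    moreover have "linear (\<lambda>pq. (side_diff pq, corner_diff pq))"
      using linear_side_diff linear_corner_diff by (simp add: linear_iff)
    ultimately show "subspace ?\<Delta>" by (intro linear_subspace_image)
    show "?\<Delta> \<subseteq> Z \<times> corner_space"
    proof safe
      fix p q assume pq: "(p, q) \<in> flag_space" "closing (p, q) = 0"
      have inv: "p (glue S a) = p a" "q (glue S a) = q a" if "a \<in> sides S" for a
        using pq that by (auto simp: flag_space_def glue_inv_def simp del: sides_iff)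
      show "side_diff (p, q) \<in> Z"
      proof (rule cocycleI)
        show "side_diff (p, q) (t, 1) = side_diff (p, q) (t, 2) + x t (side_diff (p, q) (t, 0))" if "t < n" for t
          using closed[OF pq(2) that] corner_diff_closed_iff[OF that, of "(p, q)"] by simp
      qed (auto simp: side_diff_def inv \<phi>_glue glue_sides simp del: sides_iff)
      show "corner_diff (p, q) \<in> corner_space"
        by (rule corner_spaceI) (use closed[OF pq(2)] hor[OF pq(1)] in \<open>auto simp: corner_diff_simps(4) simp del: sides_iff\<close>)
    qed
    show "cup u u = corner_form w w" if "(u, w) \<in> ?\<Delta>" for u w
    proof -
      obtain pq where pq: "pq \<in> flag_space" "closing pq = 0" "u = side_diff pq" "w = corner_diff pq"
        using \<open>(u, w) \<in> ?\<Delta>\<close> by auto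
      show ?thesis unfolding pq(3,4)
        by (rule cup_eq_corner_form) (use pq(1) hor[OF pq(1)] closed[OF pq(2)] in \<open>auto simp: flag_space_def\<close>)
    qed
    show "cup u u = corner_form w w"
      if "u \<in> Z" "w \<in> corner_space" "\<And>u' w'. (u', w') \<in> ?\<Delta> \<Longrightarrow> cup u u' = corner_form w w'" for u w
      by (rule coisotropic[OF that(1,2)]) (use that(3) in blast)
  qed
  then show ?thesis using signature_corner by simp
qed

end

text \<open>To the vectors of a diagonalization is added a basis \<open>G\<close> of the radical
  modulo \<open>R\<close>. It is needed because \<open>has_signature\<close> asks for a basis of
  cocycles modulo coboundaries, and of the coboundaries only the inclusion in the radical is
  shown.\<close>

lemma (in sym_form) exists_orthogonal_basis_mod:
  assumes fc: "finite_coords A" and R: "subspace R" "R \<subseteq> radical A B"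
  obtains m and e :: "nat \<Rightarrow> 'a" where
    "\<And>i. i < m \<Longrightarrow> e i \<in> A" "\<And>i j. i < m \<Longrightarrow> j < m \<Longrightarrow> i \<noteq> j \<Longrightarrow> B (e i) (e j) = 0"
    "\<And>a. a \<in> A \<Longrightarrow> \<exists>c. a - (\<Sum>i<m. c i *\<^sub>R e i) \<in> R"
    "\<And>c i. (\<Sum>i<m. c i *\<^sub>R e i) \<in> R \<Longrightarrow> i < m \<Longrightarrow> c i = 0"
proof -
  obtain P N where d: "diagonalizes A B P N" using exists_diagonalizes[OF fc] by auto
  note o = d[unfolded diagonalizes_def, THEN conjunct1]
  note o' = o[unfolded orthonormal_pair_def]
  obtain k where k: "\<forall>F\<subseteq>A. \<forall>R. 0 \<in> R \<longrightarrow> independent_mod R F \<longrightarrow> card F \<le> k"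
    using independent_bound_coords[OF fc subsp] by auto
  have "card F \<le> k" if "F \<subseteq> radical A B" "independent_mod R F" for F
    using that k subspace_0[OF R(1)] by (auto simp: radical_def)
  then obtain G where G: "G \<subseteq> radical A B" "independent_mod R G"
      "\<forall>r\<in>radical A B. \<exists>c. r - (\<Sum>x\<in>G. c x *\<^sub>R x) \<in> R"
    using maximal_independent_mod[OF R(1), of "radical A B" k] by auto
  have finG: "finite G" using G by (simp add: independent_mod_def)
  have PN: "P \<inter> N = {}"
  proof (rule ccontr)
    assume "P \<inter> N \<noteq> {}"
    then obtain x where "x \<in> P" "x \<in> N" by auto
    then show False using o' by fastforce
  qed
  have G0: "B x y = 0" "B y x = 0" if "x \<in> G" "y \<in> A" for x y
    using that G(1) sym[of y x] by (auto simp: radical_def)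
  have PNG: "(P \<union> N) \<inter> G = {}"
  proof (rule ccontr)
    assume "(P \<union> N) \<inter> G \<noteq> {}"
    then obtain x where x: "x \<in> P \<union> N" "x \<in> G" by auto
    then have "B x x = 0" using G0 o' by blast
    then show False using x o' by auto
  qed
  define E where "E = P \<union> N \<union> G"
  have finE: "finite E" using o' finG by (simp add: E_def)
  have EA: "E \<subseteq> A" using o' G(1) by (auto simp: E_def radical_def)
  have sumE: "(\<Sum>x\<in>E. c x *\<^sub>R x) = (\<Sum>x\<in>P \<union> N. c x *\<^sub>R x) + (\<Sum>x\<in>G. c x *\<^sub>R x)" for c
    unfolding E_def using o' finG PNG by (intro sum.union_disjoint) auto
  have sumPN: "(\<Sum>x\<in>P \<union> N. c x *\<^sub>R x) = (\<Sum>x\<in>P. c x *\<^sub>R x) + (\<Sum>x\<in>N. c x *\<^sub>R x)" for c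
    using o' PN by (intro sum.union_disjoint) auto
  have indep: "\<forall>x\<in>E. c x = 0" if "(\<Sum>x\<in>E. c x *\<^sub>R x) \<in> R" for c
  proof -
    have "(\<Sum>x\<in>G. c x *\<^sub>R x) \<in> radical A B"
      using G(1) subspace_radical by (intro subspace_sum) (auto intro: subspace_scale)
    then have "(\<Sum>x\<in>E. c x *\<^sub>R x) - (\<Sum>x\<in>G. c x *\<^sub>R x) \<in> radical A B"
      using that R(2) by (intro subspace_diff[OF subspace_radical]) auto
    then have PN0: "\<forall>x\<in>P \<union> N. c x = 0" by (intro orthonormal_independent[OF o]) (simp add: sumE)
    then have "(\<Sum>x\<in>P \<union> N. c x *\<^sub>R x) = 0" by (intro sum.neutral) auto
    then have "(\<Sum>x\<in>G. c x *\<^sub>R x) \<in> R" using that by (simp add: sumE)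
    then have "\<forall>x\<in>G. c x = 0" using G(2) by (simp add: independent_mod_def)
    with PN0 show ?thesis by (auto simp: E_def)
  qed
  have span: "\<exists>c. a - (\<Sum>x\<in>E. c x *\<^sub>R x) \<in> R" if a: "a \<in> A" for a
  proof -
    define r where "r = a - (\<Sum>x\<in>P. B a x *\<^sub>R x) + (\<Sum>y\<in>N. B a y *\<^sub>R y)"
    have "r \<in> radical A B" unfolding r_def by (rule decompose[OF d a])
    then obtain c where c: "r - (\<Sum>x\<in>G. c x *\<^sub>R x) \<in> R" using G(3) by auto
    define k where "k x = (if x \<in> P then B a x else if x \<in> N then - B a x else c x)" for x
    have "(\<Sum>x\<in>P. k x *\<^sub>R x) = (\<Sum>x\<in>P. B a x *\<^sub>R x)"
      by (rule sum.cong) (auto simp: k_def)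
    moreover have "(\<Sum>x\<in>N. k x *\<^sub>R x) = (\<Sum>x\<in>N. - (B a x *\<^sub>R x))"
      by (rule sum.cong) (use PN in \<open>auto simp: k_def\<close>)
    moreover have "(\<Sum>x\<in>G. k x *\<^sub>R x) = (\<Sum>x\<in>G. c x *\<^sub>R x)"
      by (rule sum.cong) (use PNG in \<open>auto simp: k_def\<close>)
    ultimately have "a - (\<Sum>x\<in>E. k x *\<^sub>R x) = r - (\<Sum>x\<in>G. c x *\<^sub>R x)"
      by (simp add: sumE sumPN r_def sum_negf)
    then show ?thesis using c by metis
  qed
  have orth: "B x y = 0" if "x \<in> E" "y \<in> E" "x \<noteq> y" for x y
  proof -
    have "B y x = 0" if "x \<in> N" "y \<in> P" for x y using that o' by auto
    then have "B x y = 0" if "x \<in> N" "y \<in> P" for x y using that o' sym[of x y] by auto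
    then show ?thesis using that o' G0 EA by (auto simp: E_def)
  qed
  obtain e where e: "bij_betw e {0..<card E} E" using ex_bij_betw_nat_finite[OF finE] by auto
  have e': "bij_betw e {..<card E} E" using e by (simp add: atLeast0LessThan)
  have re: "(\<Sum>i<card E. c (e i) *\<^sub>R e i) = (\<Sum>x\<in>E. c x *\<^sub>R x)" for c
    by (rule sum.reindex_bij_betw[OF e'])
  have eE: "e i \<in> E" if "i < card E" for i using bij_betwE[OF e'] that by auto
  have ie: "inj_on e {..<card E}" using e' by (simp add: bij_betw_def)
  show thesis
  proof (rule that)
    show "e i \<in> A" if "i < card E" for i using eE[OF that] EA by auto
    show "B (e i) (e j) = 0" if "i < card E" "j < card E" "i \<noteq> j" for i j
      using that orth[of "e i" "e j"] eE inj_on_eq_iff[OF ie, of i j] by auto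
    show "\<exists>c. a - (\<Sum>i<card E. c i *\<^sub>R e i) \<in> R" if a: "a \<in> A" for a
    proof -
      obtain c where "a - (\<Sum>x\<in>E. c x *\<^sub>R x) \<in> R" using span[OF a] by auto
      then show ?thesis by (intro exI[of _ "\<lambda>i. c (e i)"]) (simp add: re)
    qed
    show "c i = 0" if c: "(\<Sum>i<card E. c i *\<^sub>R e i) \<in> R" and i: "i < card E" for c i
    proof -
      define c' where "c' = c \<circ> inv_into {..<card E} e"
      have c': "c' (e i) = c i" if "i < card E" for i using ie that by (simp add: c'_def)
      then have "(\<Sum>i<card E. c' (e i) *\<^sub>R e i) = (\<Sum>i<card E. c i *\<^sub>R e i)" by simp
      then have "(\<Sum>x\<in>E. c' x *\<^sub>R x) \<in> R" using c unfolding re by simp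
      then show ?thesis using indep[of c'] eE[OF i] c'[OF i] by auto
    qed
  qed
qed

section \<open>From cocycles to the form on twisted cohomology\<close>

context symplectic_surface
begin

abbreviation "Bd \<equiv> coboundary0 S \<phi> ` cochains0 S"

lemma cochains0D:
  assumes "w \<in> cochains0 S" "a \<in> sides S"
  shows "w (fst (glue S a), side_start (snd (glue S a))) = w (fst a, side_start (snd a))"
    "w (fst (glue S a), side_end (snd (glue S a))) = w (fst a, side_end (snd a))"
proof -
  obtain t i s j where *: "a = (t, i)" "glue S a = (s, j)" by (cases a, cases "glue S a")
  have "w (t, side_start i) = w (s, side_start j) \<and> w (t, side_end i) = w (s, side_end j)"
    using assms * unfolding cochains0_def by blast
  with * show "w (fst (glue S a), side_start (snd (glue S a))) = w (fst a, side_start (snd a))"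
    "w (fst (glue S a), side_end (snd (glue S a))) = w (fst a, side_end (snd a))" by auto
qed

lemma coboundary0_apply:
  "a \<in> sides S \<Longrightarrow> coboundary0 S \<phi> w a = \<phi> a (w (fst a, side_end (snd a))) - w (fst a, side_start (snd a))"
  "a \<notin> sides S \<Longrightarrow> coboundary0 S \<phi> w a = 0"
  by (auto simp: coboundary0_def simp del: sides_iff split: prod.splits)

lemma coboundary0_in_Z:
  assumes w: "w \<in> cochains0 S"
  shows "coboundary0 S \<phi> w \<in> Z"
proof (rule cocycleI)
  show "coboundary0 S \<phi> w (glue S a) = coboundary0 S \<phi> w a" if "a \<in> sides S" for a
    using cochains0D[OF w that] that glue_sides[OF that] \<phi>_glue[OF that] by (simp add: coboundary0_apply)
  show "coboundary0 S \<phi> w (t, 1) = coboundary0 S \<phi> w (t, 2) + x t (coboundary0 S \<phi> w (t, 0))" if "t < n" for t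
    using that by (simp add: coboundary0_apply \<phi>_1 lin_simps side_start_def side_end_def)
qed (simp add: coboundary0_apply del: sides_iff)

text \<open>The Leibniz rule: up to sign, the product of a cocycle and a coboundary is the
  coboundary of \<open>f\<close>, which pairs \<open>u\<close> on a side with the value of
  \<open>w\<close> at its end.\<close>

lemma cup_coboundary0:
  assumes u: "u \<in> Z" and w: "w \<in> cochains0 S"
  shows "cup u (coboundary0 S \<phi> w) = 0"
proof -
  define f where "f a = symp_form (u a) (\<phi> a (w (fst a, side_end (snd a))))" for a
  have "cup u (coboundary0 S \<phi> w) = - (\<Sum>t<n. sg t * (f (t, 0) - f (t, 1) + f (t, 2)))"
    unfolding cup_pairing_def sum_negf[symmetric]
  proof (rule sum.cong[OF refl])
    fix t assume "t \<in> {..<n}"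
    then have t: "t < n" by simp
    have "f (t, 0) = symp_form (x t (u (t, 0))) (x t (y t (w (t, 2))))"
      by (simp add: f_def Sp_form[OF xy_Sp(1)[OF t]] side_end_def)
    moreover have "f (t, 1) = symp_form (u (t, 2) + x t (u (t, 0))) (x t (y t (w (t, 2))))"
      using cocycleD(3)[OF u t] t by (simp add: f_def \<phi>_1 side_end_def)
    ultimately show "sg t * symp_form (u (t, 2)) (x t (coboundary0 S \<phi> w (t, 0)))
        = - (sg t * (f (t, 0) - f (t, 1) + f (t, 2)))"
      using t by (simp add: f_def coboundary0_apply lin_simps symp_form_bilinear_simps side_start_def side_end_def algebra_simps)
  qed
  also have "\<dots> = 0"
    using sum_glue_invariant[of f] cocycleD(1)[OF u] cochains0D[OF w] \<phi>_glue by (simp add: f_def del: sides_iff)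
  finally show ?thesis .
qed

lemma Bd_subset_radical: "Bd \<subseteq> radical Z (cup)"
  using coboundary0_in_Z cup_coboundary0 cup_sym by (auto simp: radical_def)

lemma subspace_Bd: "subspace Bd"
proof (rule linear_subspace_image)
  have "\<phi> a (u + v) = \<phi> a u + \<phi> a v" "\<phi> a (c *\<^sub>R u) = c *\<^sub>R \<phi> a u" if "a \<in> sides S" for a u v c
    using Sp_linear[OF \<phi>_Sp[OF that]] by (simp_all add: linear_add linear_scale)
  then show "linear (coboundary0 S \<phi>)"
    by (auto simp: linear_iff coboundary0_def fun_eq_iff algebra_simps simp del: sides_iff)
  show "subspace (cochains0 S)"
    unfolding subspace_def
  proof (intro conjI ballI allI)
    show "0 \<in> cochains0 S" by (auto simp: cochains0_def)
    show "v + w \<in> cochains0 S" if "v \<in> cochains0 S" "w \<in> cochains0 S" for v w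
      using cochains0D[OF that(1)] cochains0D[OF that(2)]
      by (fastforce simp: cochains0_def simp del: sides_iff)
    show "c *\<^sub>R w \<in> cochains0 S" if "w \<in> cochains0 S" for c w
      using cochains0D[OF that] by (fastforce simp: cochains0_def simp del: sides_iff)
  qed
qed

lemma H1_class_eq: "H1_class S \<phi> u = {v. v - u \<in> Bd}"
  by (simp add: H1_class_def fun_diff_def)

lemma H1_class_eq_iff: "H1_class S \<phi> u = H1_class S \<phi> v \<longleftrightarrow> u - v \<in> Bd"
proof
  assume "H1_class S \<phi> u = H1_class S \<phi> v"
  moreover have "u \<in> H1_class S \<phi> u" using subspace_0[OF subspace_Bd] by (simp add: H1_class_eq)
  ultimately show "u - v \<in> Bd" by (simp add: H1_class_eq)
next
  assume uv: "u - v \<in> Bd"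
  have "w - u \<in> Bd \<longleftrightarrow> w - v \<in> Bd" for w
    using subspace_add[OF subspace_Bd uv, of "w - u"] subspace_diff[OF subspace_Bd _ uv, of "w - v"] by auto
  then show "H1_class S \<phi> u = H1_class S \<phi> v" by (simp add: H1_class_eq)
qed

lemma H1_form_eq:
  assumes u: "u \<in> Z" and v: "v \<in> Z"
  shows "H1_form S \<phi> (H1_class S \<phi> u) (H1_class S \<phi> v) = cup u v"
proof -
  interpret sym_form Z "cup" by (rule sym_form_Z)
  have eq: "cup u' v' = cup u v" if "u' - u \<in> Bd" "v' - v \<in> Bd" for u' v'
  proof -
    have r: "u' - u \<in> radical Z (cup)" "v' - v \<in> radical Z (cup)"
      using that Bd_subset_radical by auto
    then have "v' - v + v \<in> Z" using v subsp by (intro subspace_add) (auto simp: radical_def)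
    then have "v' \<in> Z" by simp
    then have "cup (u' - u) v' = 0" "cup u (v' - v) = 0"
      using r u sym by (auto simp: radical_def)
    then show ?thesis by (simp add: diff_left diff_right)
  qed
  have mem: "u \<in> H1_class S \<phi> u" "v \<in> H1_class S \<phi> v"
    using subspace_0[OF subspace_Bd] by (simp_all add: H1_class_eq)
  show ?thesis
    unfolding H1_form_def
  proof (rule the_equality)
    show "\<forall>u'\<in>H1_class S \<phi> u. \<forall>v'\<in>H1_class S \<phi> v. cup u' v' = cup u v"
      using eq by (simp add: H1_class_eq)
    show "r = cup u v"
      if "\<forall>u'\<in>H1_class S \<phi> u. \<forall>v'\<in>H1_class S \<phi> v. cup u' v' = r" for r
      using that[rule_format, OF mem] by simp
  qed
qed

lemma H1_combination: "(\<lambda>a. \<Sum>i<m. c i *\<^sub>R e i a) = (\<Sum>i<m. c i *\<^sub>R e i)"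
  for e :: "nat \<Rightarrow> 'h side_fun"
  by (simp add: fun_eq_iff sum_fun_apply)

lemma has_signature_imp_eq:
  assumes "has_signature S \<phi> s"
  shows "s = signature Z (cup)"
proof -
  interpret sym_form Z "cup" by (rule sym_form_Z)
  obtain m e where b: "H1_basis S \<phi> m e"
    and orth: "\<forall>i<m. \<forall>j<m. i \<noteq> j \<longrightarrow> H1_form S \<phi> (H1_class S \<phi> (e i)) (H1_class S \<phi> (e j)) = 0"
    and s: "s = int (card {i. i < m \<and> H1_form S \<phi> (H1_class S \<phi> (e i)) (H1_class S \<phi> (e i)) > 0})
       - int (card {i. i < m \<and> H1_form S \<phi> (H1_class S \<phi> (e i)) (H1_class S \<phi> (e i)) < 0})"
    using assms unfolding has_signature_def by blast
  have eZ: "e i \<in> Z" if "i < m" for i using b that by (simp add: H1_basis_def)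
  have form: "H1_form S \<phi> (H1_class S \<phi> (e i)) (H1_class S \<phi> (e j)) = cup (e i) (e j)"
    if "i < m" "j < m" for i j by (rule H1_form_eq[OF eZ[OF that(1)] eZ[OF that(2)]])
  have "signature Z (cup) = int (card {i. i < m \<and> cup (e i) (e i) > 0})
     - int (card {i. i < m \<and> cup (e i) (e i) < 0})"
  proof (rule signature_orthogonal_family)
    show "\<exists>c. a - (\<Sum>i<m. c i *\<^sub>R e i) \<in> radical Z (cup)" if "a \<in> Z" for a
    proof -
      have "H1_class S \<phi> a \<in> H1 S \<phi>" using that by (simp add: H1_def)
      then obtain c where "H1_class S \<phi> a = H1_class S \<phi> (\<Sum>i<m. c i *\<^sub>R e i)"
        using b unfolding H1_basis_def H1_combination by blast
      then show ?thesis using Bd_subset_radical by (auto simp: H1_class_eq_iff)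
    qed
  qed (use eZ orth form in auto)
  then show ?thesis unfolding s using form by (simp cong: conj_cong)
qed

lemma ex_has_signature: "\<exists>s. has_signature S \<phi> s"
proof -
  interpret sym_form Z "cup" by (rule sym_form_Z)
  obtain m and e :: "nat \<Rightarrow> 'h side_fun" where e: "\<And>i. i < m \<Longrightarrow> e i \<in> Z"
      "\<And>i j. i < m \<Longrightarrow> j < m \<Longrightarrow> i \<noteq> j \<Longrightarrow> cup (e i) (e j) = 0"
    and span: "\<And>a. a \<in> Z \<Longrightarrow> \<exists>c. a - (\<Sum>i<m. c i *\<^sub>R e i) \<in> Bd"
    and ind: "\<And>c i. (\<Sum>i<m. c i *\<^sub>R e i) \<in> Bd \<Longrightarrow> i < m \<Longrightarrow> c i = 0"
    by (rule exists_orthogonal_basis_mod[OF finite_coords_Z subspace_Bd Bd_subset_radical]) (rule that)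
  have "\<exists>!c. (\<forall>i\<ge>m. c i = 0) \<and> X = H1_class S \<phi> (\<Sum>i<m. c i *\<^sub>R e i)" if X: "X \<in> H1 S \<phi>" for X
  proof -
    obtain a where a: "a \<in> Z" "X = H1_class S \<phi> a" using X by (auto simp: H1_def)
    obtain c where c: "a - (\<Sum>i<m. c i *\<^sub>R e i) \<in> Bd" using span a by blast
    show ?thesis
    proof (rule ex1I[of _ "\<lambda>i. if i < m then c i else 0"])
      show "(\<forall>i\<ge>m. (if i < m then c i else 0) = 0) \<and>
          X = H1_class S \<phi> (\<Sum>i<m. (if i < m then c i else 0) *\<^sub>R e i)"
        using c by (simp add: a H1_class_eq_iff)
    next
      fix c' assume c': "(\<forall>i\<ge>m. c' i = 0) \<and> X = H1_class S \<phi> (\<Sum>i<m. c' i *\<^sub>R e i)"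
      then have "a - (\<Sum>i<m. c' i *\<^sub>R e i) \<in> Bd" by (simp add: a H1_class_eq_iff)
      from subspace_diff[OF subspace_Bd this c]
      have *: "(\<Sum>i<m. (c i - c' i) *\<^sub>R e i) \<in> Bd" by (simp add: scaleR_left_diff_distrib sum_subtractf)
      have "\<forall>i<m. c i - c' i = 0"
        by (intro allI impI) (rule ind[of "\<lambda>i. c i - c' i", OF *])
      then show "c' = (\<lambda>i. if i < m then c i else 0)" using c' by (auto simp: fun_eq_iff)
    qed
  qed
  then have "H1_basis S \<phi> m e" using e(1) by (simp add: H1_basis_def H1_combination)
  moreover have "\<forall>i<m. \<forall>j<m. i \<noteq> j \<longrightarrow> H1_form S \<phi> (H1_class S \<phi> (e i)) (H1_class S \<phi> (e j)) = 0"
    using e by (simp add: H1_form_eq)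
  ultimately show ?thesis unfolding has_signature_def by blast
qed

text \<open>The signature becomes the value of \<open>maslov_cocycle\<close> on the pushed forward
  fundamental cycle. Once the cocycle identity is known, it therefore depends on the homology class
  only.\<close>

theorem has_signature_iff:
  "has_signature S \<phi> s \<longleftrightarrow> real_of_int s = (\<Sum>t<n. sg t * maslov_cocycle (\<phi> (t, 2), \<phi> (t, 0)))"
proof -
  have *: "has_signature S \<phi> s \<longleftrightarrow> s = signature Z (cup)"
    using ex_has_signature has_signature_imp_eq by metis
  have "(\<Sum>t<n. sg t * maslov_cocycle (\<phi> (t, 2), \<phi> (t, 0))) = of_int (signature Z (cup))"
    unfolding signature_cup by (simp add: maslov_cocycle_def)
  then show ?thesis unfolding * by simp
qed

end

text \<open>The boundary of a tetrahedron; the triangle \<open>t\<close> is the face opposite to the vertex \<open>t\<close>.\<close>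

definition tetrahedron :: tri_surface where
  "tetrahedron = \<lparr>ntri = 4, glue = (\<lambda>(t, i). if i < t then (i, t - 1) else (i + 1, t)),
     tri_sign = (\<lambda>t. (-1) ^ t)\<rparr>"

lemma closed_tetrahedron: "closed_oriented_surface tetrahedron"
proof -
  have less: "t < (4::nat) \<longleftrightarrow> t = 0 \<or> t = 1 \<or> t = 2 \<or> t = 3" "i < (3::nat) \<longleftrightarrow> i = 0 \<or> i = 1 \<or> i = 2" for t i
    by auto
  show ?thesis
    by (auto simp: closed_oriented_surface_def tetrahedron_def less split: if_splits)
qed

lemma (in sym_form) signature_eq_0:
  assumes "\<And>a. a \<in> A \<Longrightarrow> B a a = 0"
  shows "signature A B = 0"
  using signature_eq[of "{}" "{}"] assms by (simp add: diagonalizes_def orthonormal_pair_def)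

text \<open>The cocycle identity says that the signature of a local system on the 2-sphere vanishes.\<close>

lemma maslov_cocycle: "bar_cocycle2 Sp (maslov_cocycle :: _ \<Rightarrow> real)"
  unfolding bar_cocycle2_def
proof (intro ballI)
  fix x y z :: "'h::finite symp_space \<Rightarrow> 'h symp_space"
  assume xyz: "x \<in> carrier Sp" "y \<in> carrier Sp" "z \<in> carrier Sp"
  \<comment> \<open>With \<open>x\<close>, \<open>y\<close>, \<open>z\<close> on the edges 01, 12,
    23 of the tetrahedron, row \<open>t\<close> lists the labels of sides 0, 1, 2 of the face
    opposite to vertex \<open>t\<close>.\<close>
  define \<phi> where "\<phi> = (\<lambda>(t, i). [[z, y \<circ> z, y], [z, x \<circ> y \<circ> z, x \<circ> y],
      [y \<circ> z, x \<circ> y \<circ> z, x], [y, x \<circ> y, x]] ! t ! i)"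
  have less: "t < (4::nat) \<longleftrightarrow> t = 0 \<or> t = 1 \<or> t = 2 \<or> t = 3" "i < (3::nat) \<longleftrightarrow> i = 0 \<or> i = 1 \<or> i = 2" for t i
    by auto
  have sum4: "(\<Sum>t<4. f t) = f 0 + f 1 + f 2 + f (3::nat)" for f :: "nat \<Rightarrow> real"
    by (simp add: eval_nat_numeral)
  interpret symplectic_surface tetrahedron \<phi>
  proof
    show "closed_oriented_surface tetrahedron" by (rule closed_tetrahedron)
    show "local_system Sp tetrahedron \<phi>"
      using xyz by (auto simp: local_system_def tetrahedron_def less \<phi>_def Sp_simps Sp_mult_closed o_assoc)
  qed
  have "cup_pairing tetrahedron \<phi> u u = 0" if u: "u \<in> cocycles1 tetrahedron \<phi>" for u
  proof -
    have g: "u (1, 0) = u (0, 0)" "u (2, 0) = u (0, 1)" "u (3, 0) = u (0, 2)" "u (2, 1) = u (1, 1)"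
      "u (3, 1) = u (1, 2)" "u (3, 2) = u (2, 2)"
      using cocycleD(1)[OF u, of "(0, 0)"] cocycleD(1)[OF u, of "(0, 1)"] cocycleD(1)[OF u, of "(0, 2)"]
        cocycleD(1)[OF u, of "(1, 1)"] cocycleD(1)[OF u, of "(1, 2)"] cocycleD(1)[OF u, of "(2, 2)"]
      by (simp_all add: tetrahedron_def eval_nat_numeral)
    have c: "u (0, 1) = u (0, 2) + y (u (0, 0))" "u (1, 2) = u (2, 2) + x (u (0, 2))"
      using cocycleD(3)[OF u, of 0] cocycleD(3)[OF u, of 3] g by (simp_all add: tetrahedron_def \<phi>_def)
    \<comment> \<open>These four terms are the coboundary of the cup square of \<open>u\<close>,
      evaluated on the solid tetrahedron. It vanishes by the cocycle equations on faces 0 and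
      3.\<close>
    have "cup_pairing tetrahedron \<phi> u u = symp_form (u (0, 2)) (y (u (0, 0))) - symp_form (u (1, 2)) (x (y (u (0, 0))))
        + symp_form (u (2, 2)) (x (u (0, 1))) - symp_form (u (2, 2)) (x (u (0, 2)))"
      using g by (simp add: cup_pairing_def tetrahedron_def \<phi>_def sum4)
    also have "\<dots> = 0"
      by (simp add: c[simplified] linear_add[OF Sp_linear[OF xyz(1)]] symp_form_bilinear_simps Sp_form[OF xyz(1)])
    finally show ?thesis .
  qed
  then have "signature (cocycles1 tetrahedron \<phi>) (cup_pairing tetrahedron \<phi>) = 0"
    by (rule sym_form.signature_eq_0[OF sym_form_Z])
  then have "has_signature tetrahedron \<phi> 0" using ex_has_signature has_signature_imp_eq by metis
  then have "0 = (\<Sum>t<ntri tetrahedron. of_int (tri_sign tetrahedron t) * maslov_cocycle (\<phi> (t, 2), \<phi> (t, 0)))"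
    unfolding has_signature_iff by simp
  also have "\<dots> = maslov_cocycle (y, z) - maslov_cocycle (x \<circ> y, z) + maslov_cocycle (x, y \<circ> z) - maslov_cocycle (x, y)"
    by (simp add: tetrahedron_def \<phi>_def sum4)
  finally show "maslov_cocycle (y, z) - maslov_cocycle (x \<otimes>\<^bsub>Sp\<^esub> y, z) + maslov_cocycle (x, y \<otimes>\<^bsub>Sp\<^esub> z) - maslov_cocycle (x, y) = 0"
    by (simp add: Sp_simps)
qed

section \<open>Cycles and surfaces\<close>

lemma cochain_eval_superset:
  assumes "finite K" "Poly_Mapping.keys z \<subseteq> K"
  shows "cochain_eval c z = (\<Sum>p\<in>K. of_int (Poly_Mapping.lookup z p) * c p)"
  unfolding cochain_eval_def using assms by (intro sum.mono_neutral_left) (auto simp: in_keys_iff)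

lemma cochain_eval_0 [simp]: "cochain_eval c 0 = 0"
  by (simp add: cochain_eval_def)

lemma cochain_eval_frag_of [simp]: "cochain_eval c (frag_of p) = c p"
  by (simp add: cochain_eval_def keys_frag_of)

lemma cochain_eval_add: "cochain_eval c (z + w) = cochain_eval c z + cochain_eval c w"
proof -
  let ?K = "Poly_Mapping.keys z \<union> Poly_Mapping.keys w"
  have "Poly_Mapping.keys (z + w) \<subseteq> ?K" by (rule keys_add)
  then show ?thesis
    by (simp add: cochain_eval_superset[of ?K] lookup_add algebra_simps sum.distrib)
qed

lemma cochain_eval_cmul: "cochain_eval c (frag_cmul k z) = of_int k * cochain_eval c z"
  using cochain_eval_superset[OF finite_keys keys_cmul, of c k z]
  by (simp add: cochain_eval_def sum_distrib_left mult.assoc)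

lemma cochain_eval_uminus: "cochain_eval c (- z) = - cochain_eval c z"
  using cochain_eval_cmul[of c "- 1" z] by simp

lemma cochain_eval_diff: "cochain_eval c (z - w) = cochain_eval c z - cochain_eval c w"
  using cochain_eval_add[of c z "- w"] by (simp add: cochain_eval_uminus)

lemma cochain_eval_sum: "cochain_eval c (\<Sum>i\<in>I. z i) = (\<Sum>i\<in>I. cochain_eval c (z i))"
  by (induction I rule: infinite_finite_induct) (simp_all add: cochain_eval_add)

lemma cochain_eval_diff_left: "cochain_eval (\<lambda>p. c p - c' p) z = cochain_eval c z - cochain_eval c' z"
  by (simp add: cochain_eval_def algebra_simps sum_subtractf)

lemma cochain_eval_bar_d3:
  assumes c: "bar_cocycle2 G c" and z: "Poly_Mapping.keys z \<subseteq> carrier G \<times> carrier G \<times> carrier G"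
  shows "cochain_eval c (bar_d3 G z) = 0"
  unfolding bar_d3_def frag_extend_def cochain_eval_sum
proof (rule sum.neutral, rule ballI)
  fix i assume "i \<in> Poly_Mapping.keys z"
  then obtain x y w where "i = (x, y, w)" "x \<in> carrier G" "y \<in> carrier G" "w \<in> carrier G"
    using z by blast
  then show "cochain_eval c (frag_cmul (Poly_Mapping.lookup z i) (case i of (x, y, z) \<Rightarrow>
      frag_of (y, z) - frag_of (x \<otimes>\<^bsub>G\<^esub> y, z) + frag_of (x, y \<otimes>\<^bsub>G\<^esub> z) - frag_of (x, y))) = 0"
    using c by (auto simp: cochain_eval_cmul cochain_eval_add cochain_eval_diff bar_cocycle2_def)
qed

definition bar_cycles :: "('g, 'm) monoid_scheme \<Rightarrow> ('g \<times> 'g \<Rightarrow>\<^sub>0 int) set" where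
  "bar_cycles G = {z. Poly_Mapping.keys z \<subseteq> carrier G \<times> carrier G \<and> bar_d2 G z = 0}"

lemma carrier_bar_H2:
  assumes "group G"
  shows "carrier (bar_H2 G) =
    (\<lambda>z. (\<lambda>w. bar_d3 G w + z) ` {w. Poly_Mapping.keys w \<subseteq> carrier G \<times> carrier G \<times> carrier G}) ` bar_cycles G"
proof -
  interpret G: group G by fact
  let ?F2 = "free_Abelian_group (carrier G \<times> carrier G)" and ?F1 = "free_Abelian_group (carrier G)"
  have "Poly_Mapping.keys (bar_d2 G z) \<subseteq> carrier G" if "Poly_Mapping.keys z \<subseteq> carrier G \<times> carrier G" for z
  proof -
    have "Poly_Mapping.keys (frag_of b - frag_of (a \<otimes>\<^bsub>G\<^esub> b) + frag_of a) \<subseteq> carrier G"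
      if "a \<in> carrier G" "b \<in> carrier G" for a b
    proof -
      have "Poly_Mapping.keys (frag_of b - frag_of (a \<otimes>\<^bsub>G\<^esub> b) + frag_of a) \<subseteq> {b, a \<otimes>\<^bsub>G\<^esub> b, a}"
        using keys_add[of "frag_of b - frag_of (a \<otimes>\<^bsub>G\<^esub> b)" "frag_of a"] keys_diff[of "frag_of b" "frag_of (a \<otimes>\<^bsub>G\<^esub> b)"]
        by (auto simp: keys_frag_of)
      then show ?thesis using that by auto
    qed
    note 1 = this
    have "Poly_Mapping.keys (case p of (a, b) \<Rightarrow> frag_of b - frag_of (a \<otimes>\<^bsub>G\<^esub> b) + frag_of a) \<subseteq> carrier G"
      if "p \<in> Poly_Mapping.keys z" for p
      using 1[of "fst p" "snd p"] that \<open>Poly_Mapping.keys z \<subseteq> _\<close> by (cases p) auto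
    then show ?thesis
      unfolding bar_d2_def by (intro order.trans[OF keys_frag_extend] UN_least)
  qed
  then have "group_hom ?F2 ?F1 (bar_d2 G)"
    by (intro group_hom.intro group_hom_axioms.intro homI) (auto simp: bar_d2_def frag_extend_add)
  then have "subgroup (kernel ?F2 ?F1 (bar_d2 G)) ?F2" by (rule group_hom.subgroup_kernel)
  then have "carrier (subgroup_generated ?F2 (kernel ?F2 ?F1 (bar_d2 G))) = kernel ?F2 ?F1 (bar_d2 G)"
    by (rule subgroup.carrier_subgroup_generated_subgroup)
  also have "\<dots> = bar_cycles G" by (auto simp: kernel_def bar_cycles_def)
  finally have c: "carrier (subgroup_generated ?F2 (kernel ?F2 ?F1 (bar_d2 G))) = bar_cycles G" .
  show ?thesis
    unfolding bar_H2_def carrier_FactGroup c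
    by (intro image_cong refl) (auto simp: r_coset_def)
qed

lemma mem_carrier_bar_H2:
  assumes "group G" "X \<in> carrier (bar_H2 G)"
  obtains z where "z \<in> X" "z \<in> bar_cycles G"
    "\<And>z' c. z' \<in> X \<Longrightarrow> bar_cocycle2 G c \<Longrightarrow> cochain_eval c z' = cochain_eval c z"
proof -
  obtain z where z: "z \<in> bar_cycles G"
    "X = (\<lambda>w. bar_d3 G w + z) ` {w. Poly_Mapping.keys w \<subseteq> carrier G \<times> carrier G \<times> carrier G}"
    using assms(2) unfolding carrier_bar_H2[OF assms(1)] by auto
  show thesis
  proof (rule that[OF _ z(1)])
    show "z \<in> X" unfolding z(2) by (rule image_eqI[of _ _ 0]) (simp_all add: bar_d3_def)
    show "cochain_eval c z' = cochain_eval c z" if "z' \<in> X" "bar_cocycle2 G c" for z' c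
      using that cochain_eval_bar_d3 unfolding z(2) by (auto simp: cochain_eval_add)
  qed
qed

lemma bar_cycle_mem_class:
  assumes "group G" "z \<in> bar_cycles G"
  shows "\<exists>X\<in>carrier (bar_H2 G). z \<in> X"
  unfolding carrier_bar_H2[OF assms(1)]
  by (intro bexI[OF _ imageI[OF assms(2)]] image_eqI[of _ _ 0]) (simp_all add: bar_d3_def)

text \<open>Multiplicities are unfolded, so that every summand can become one oriented
  triangle.\<close>

lemma chain_as_signed_list:
  assumes "Poly_Mapping.keys z \<subseteq> K"
  shows "\<exists>n (\<epsilon> :: nat \<Rightarrow> int) p. (\<forall>t<n. (\<epsilon> t = 1 \<or> \<epsilon> t = - 1) \<and> p t \<in> K) \<and>
    z = (\<Sum>t<n. frag_cmul (\<epsilon> t) (frag_of (p t)))"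
  using assms
proof (induction z rule: frag_induction)
  case zero
  show ?case by (intro exI[of _ 0]) auto
next
  case (one x)
  show ?case using one by (intro exI[of _ 1] exI[of _ "\<lambda>_. 1"] exI[of _ "\<lambda>_. x"]) auto
next
  case (diff a b)
  obtain n :: nat and \<epsilon> :: "nat \<Rightarrow> int" and p where 1: "\<And>t. t < n \<Longrightarrow> \<epsilon> t = 1 \<or> \<epsilon> t = - 1" "\<And>t. t < n \<Longrightarrow> p t \<in> K"
    "a = (\<Sum>t<n. frag_cmul (\<epsilon> t) (frag_of (p t)))"
    using diff.IH(1) by blast
  obtain m :: nat and \<delta> :: "nat \<Rightarrow> int" and q where 2: "\<And>t. t < m \<Longrightarrow> \<delta> t = 1 \<or> \<delta> t = - 1" "\<And>t. t < m \<Longrightarrow> q t \<in> K"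
    "b = (\<Sum>t<m. frag_cmul (\<delta> t) (frag_of (q t)))"
    using diff.IH(2) by blast
  define \<epsilon>' where "\<epsilon>' t = (if t < n then \<epsilon> t else - \<delta> (t - n))" for t
  define p' where "p' t = (if t < n then p t else q (t - n))" for t
  have "(\<Sum>t<n + m. frag_cmul (\<epsilon>' t) (frag_of (p' t))) =
     (\<Sum>t<n. frag_cmul (\<epsilon>' t) (frag_of (p' t))) + (\<Sum>t<m. frag_cmul (\<epsilon>' (n + t)) (frag_of (p' (n + t))))"
    by (induction m) (simp_all add: add.assoc)
  also have "\<dots> = a - b"
    unfolding 1(3) 2(3) by (simp add: \<epsilon>'_def p'_def sum_negf flip: minus_frag_cmul)
  finally have "a - b = (\<Sum>t<n + m. frag_cmul (\<epsilon>' t) (frag_of (p' t)))" by simp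
  moreover have "(\<epsilon>' t = 1 \<or> \<epsilon>' t = - 1) \<and> p' t \<in> K" if "t < n + m" for t
    using that 1(1,2)[of t] 2(1,2)[of "t - n"] by (auto simp: \<epsilon>'_def p'_def)
  ultimately show ?case by (intro exI[of _ "n + m"] exI[of _ \<epsilon>'] exI[of _ p'] conjI) auto
qed

lemma ex_label_preserving_bij:
  assumes "finite A" "finite B" and card: "\<And>g. card {a\<in>A. f a = g} = card {b\<in>B. f b = g}"
  shows "\<exists>\<pi>. bij_betw \<pi> A B \<and> (\<forall>a\<in>A. f (\<pi> a) = f a)"
proof -
  have "\<exists>h. bij_betw h {a\<in>A. f a = g} {b\<in>B. f b = g}" for g
    using assms by (intro finite_same_card_bij) auto
  then obtain h where h: "\<And>g. bij_betw (h g) {a\<in>A. f a = g} {b\<in>B. f b = g}" by metis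
  have hm: "h (f a) a \<in> B" "f (h (f a) a) = f a" if "a \<in> A" for a
    using bij_betwE[OF h[of "f a"]] that by auto
  have "bij_betw (\<lambda>a. h (f a) a) A B"
    unfolding bij_betw_def
  proof
    show "inj_on (\<lambda>a. h (f a) a) A"
    proof (rule inj_onI)
      fix a b assume ab: "a \<in> A" "b \<in> A" "h (f a) a = h (f b) b"
      then have "f a = f b" using hm(2) by metis
      then show "a = b" using ab h[of "f b"] by (auto simp: bij_betw_def inj_on_def)
    qed
    show "(\<lambda>a. h (f a) a) ` A = B"
    proof
      show "B \<subseteq> (\<lambda>a. h (f a) a) ` A"
      proof
        fix b assume "b \<in> B"
        then have "b \<in> h (f b) ` {a\<in>A. f a = f b}" using h[of "f b"] by (simp add: bij_betw_def)
        then obtain x where "b = h (f b) x" "x \<in> A" "f x = f b" by auto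
        then show "b \<in> (\<lambda>a. h (f a) a) ` A" by (intro image_eqI[of _ _ x]) auto
      qed
    qed (use hm in auto)
  qed
  then show ?thesis using hm(2) by blast
qed

text \<open>The sides \<open>(t, i)\<close> that occur with coefficient \<open>s\<close> in the boundary of \<open>\<Sum>\<^sub>t \<epsilon>\<^sub>t t\<close>.\<close>

definition signed_sides :: "nat \<Rightarrow> (nat \<Rightarrow> int) \<Rightarrow> int \<Rightarrow> (nat \<times> nat) set" where
  "signed_sides n \<epsilon> s = {(t, i). t < n \<and> i < 3 \<and> (-1) ^ i * \<epsilon> t = s}"

text \<open>\<open>\<pi>\<close> matters on positive sides only; negative sides are glued by its
  inverse, which makes the gluing an involution that always joins opposite signs.\<close>

definition matched_surface :: "nat \<Rightarrow> (nat \<Rightarrow> int) \<Rightarrow> (nat \<times> nat \<Rightarrow> nat \<times> nat) \<Rightarrow> tri_surface" where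
  "matched_surface n \<epsilon> \<pi> = \<lparr>ntri = n, glue = (\<lambda>a. if a \<in> signed_sides n \<epsilon> 1 then \<pi> a
     else inv_into (signed_sides n \<epsilon> 1) \<pi> a), tri_sign = \<epsilon>\<rparr>"

lemma matched_surface_simps [simp]:
  "ntri (matched_surface n \<epsilon> \<pi>) = n" "tri_sign (matched_surface n \<epsilon> \<pi>) = \<epsilon>"
  by (simp_all add: matched_surface_def)

lemma signed_sides_cases:
  assumes "\<And>t. t < n \<Longrightarrow> \<epsilon> t = 1 \<or> \<epsilon> t = - 1" "t < n" "i < 3"
  shows "(t, i) \<in> signed_sides n \<epsilon> 1 \<or> (t, i) \<in> signed_sides n \<epsilon> (- 1)"
  using assms(1)[OF assms(2)] assms(2,3) by (cases "even i") (auto simp: signed_sides_def)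

lemma
  assumes \<epsilon>: "\<And>t. t < n \<Longrightarrow> \<epsilon> t = 1 \<or> \<epsilon> t = - 1"
    and \<pi>: "bij_betw \<pi> (signed_sides n \<epsilon> 1) (signed_sides n \<epsilon> (- 1))"
  shows closed_matched_surface: "closed_oriented_surface (matched_surface n \<epsilon> \<pi>)"
    and label_matched_surface: "(\<And>a. a \<in> signed_sides n \<epsilon> 1 \<Longrightarrow> lab (\<pi> a) = lab a) \<Longrightarrow>
      a \<in> sides (matched_surface n \<epsilon> \<pi>) \<Longrightarrow> lab (glue (matched_surface n \<epsilon> \<pi>) a) = lab a"
proof -
  let ?P = "signed_sides n \<epsilon> 1" and ?N = "signed_sides n \<epsilon> (- 1)" and ?S = "matched_surface n \<epsilon> \<pi>"
  have disj: "a \<notin> ?P" if "a \<in> ?N" for a using that by (auto simp: signed_sides_def)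
  have cases: "a \<in> ?P \<or> a \<in> ?N" if "a \<in> sides ?S" for a
    using that signed_sides_cases[OF \<epsilon>] by (cases a) (auto simp: sides_def)
  have gP: "glue ?S a = \<pi> a" "\<pi> a \<in> ?N" if "a \<in> ?P" for a
    using that bij_betwE[OF \<pi>] by (auto simp: matched_surface_def)
  have gN: "glue ?S b = inv_into ?P \<pi> b" "inv_into ?P \<pi> b \<in> ?P" "\<pi> (inv_into ?P \<pi> b) = b" if "b \<in> ?N" for b
    using that disj[OF that] \<pi> bij_betwE[OF bij_betw_inv_into[OF \<pi>]] by (auto simp: matched_surface_def bij_betw_inv_into_right)
  have inv: "inv_into ?P \<pi> (\<pi> a) = a" if "a \<in> ?P" for a using \<pi> that by (rule bij_betw_inv_into_left)
  have sub: "?P \<subseteq> sides ?S" "?N \<subseteq> sides ?S" by (auto simp: signed_sides_def sides_def)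
  have sgn: "(-1) ^ snd a * \<epsilon> (fst a) = s" if "a \<in> signed_sides n \<epsilon> s" for a s
    using that by (auto simp: signed_sides_def)
  show "closed_oriented_surface ?S"
    unfolding closed_oriented_surface_def
  proof (intro conjI)
    show "\<forall>a\<in>sides ?S. glue ?S a \<in> sides ?S \<and> glue ?S a \<noteq> a \<and> glue ?S (glue ?S a) = a"
    proof
      fix a assume "a \<in> sides ?S"
      then consider "a \<in> ?P" | "a \<in> ?N" using cases by blast
      then show "glue ?S a \<in> sides ?S \<and> glue ?S a \<noteq> a \<and> glue ?S (glue ?S a) = a"
      proof cases
        case 1
        then show ?thesis
          using gP[OF 1] gN[OF gP(2)[OF 1]] inv[OF 1] sub disj[OF gP(2)[OF 1]] by (metis subsetD)
      next
        case 2
        then show ?thesis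
          using gN[OF 2] gP(1)[OF gN(2)[OF 2]] sub disj[OF 2] by (metis subsetD)
      qed
    qed
    show "\<forall>t<ntri ?S. tri_sign ?S t = 1 \<or> tri_sign ?S t = - 1" using \<epsilon> by simp
    have "(-1) ^ snd a * \<epsilon> (fst a) = - ((-1) ^ snd (glue ?S a) * \<epsilon> (fst (glue ?S a)))" if "a \<in> sides ?S" for a
    proof -
      consider "a \<in> ?P" | "a \<in> ?N" using cases \<open>a \<in> sides ?S\<close> by blast
      then show ?thesis
      proof cases
        case 1
        then show ?thesis using sgn[OF 1] sgn[OF gP(2)[OF 1]] gP(1)[OF 1] by simp
      next
        case 2
        then show ?thesis using sgn[OF 2] sgn[OF gN(2)[OF 2]] gN(1)[OF 2] by simp
      qed
    qed
    then show "\<forall>(t, i)\<in>sides ?S. \<forall>s j. glue ?S (t, i) = (s, j) \<longrightarrow>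
        (-1) ^ i * tri_sign ?S t = - ((-1) ^ j * tri_sign ?S s)"
      by (fastforce simp del: sides_iff)
  qed
  show "lab (glue ?S a) = lab a" if lab: "\<And>a. a \<in> ?P \<Longrightarrow> lab (\<pi> a) = lab a" and a: "a \<in> sides ?S"
  proof -
    consider "a \<in> ?P" | "a \<in> ?N" using cases a by blast
    then show ?thesis
    proof cases
      case 1
      then show ?thesis using gP lab by simp
    next
      case 2
      then show ?thesis using gN[OF 2] lab[OF gN(2)[OF 2]] by simp
    qed
  qed
qed

text \<open>To make a surface connected, each triangle \<open>k\<close> is cut open along one of its positive sides, with
  label \<open>g\<close> say, and the two triangles \<open>n + k\<close> and \<open>2 n + k\<close>, which are mapped to \<open>\<plusminus> [1 | g]\<close>, are
  inserted there. Their sides labelled \<open>1\<close> are glued cyclically.\<close>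

definition first_positive :: "(nat \<Rightarrow> int) \<Rightarrow> nat \<Rightarrow> nat \<times> nat" where
  "first_positive \<epsilon> k = (k, if \<epsilon> k = 1 then 0 else 1)"

definition connect_sign :: "nat \<Rightarrow> (nat \<Rightarrow> int) \<Rightarrow> nat \<Rightarrow> int" where
  "connect_sign n \<epsilon> t = (if t < n then \<epsilon> t else if t < 2 * n then 1 else - 1)"

definition cyc_suc :: "nat \<Rightarrow> nat \<Rightarrow> nat" where
  "cyc_suc n k = (if Suc k = n then 0 else Suc k)"

text \<open>Only the values on positive sides count: those of the old triangles, sides 0 and 2 of
  \<open>n + k\<close>, and side 1 of \<open>2 * n + k\<close>. Triangle \<open>n + k\<close> takes
  over the cut side, \<open>2 * n + k\<close> its former partner, and the two meet along their sides
  0; the sides 2, labelled by the unit, lead on to the next index.\<close>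

definition connect_glue :: "nat \<Rightarrow> (nat \<Rightarrow> int) \<Rightarrow> (nat \<times> nat \<Rightarrow> nat \<times> nat) \<Rightarrow> nat \<times> nat \<Rightarrow> nat \<times> nat" where
  "connect_glue n \<epsilon> \<pi> = (\<lambda>(t, i).
     if t < n then (if (t, i) = first_positive \<epsilon> t then (n + t, 1) else \<pi> (t, i))
     else if t < 2 * n then (if i = 0 then (n + t, 0) else (2 * n + cyc_suc n (t - n), 2))
     else \<pi> (first_positive \<epsilon> (t - 2 * n)))"

lemma first_positive_mem:
  assumes "\<And>t. t < n \<Longrightarrow> \<epsilon> t = 1 \<or> \<epsilon> t = - 1" "k < n"
  shows "first_positive \<epsilon> k \<in> signed_sides n \<epsilon> 1"
  using assms(1)[OF assms(2)] assms(2) by (auto simp: first_positive_def signed_sides_def)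

lemma signed_sides_connect:
  assumes "k < n" "s = 1 \<or> s = - 1"
  shows "(k, i) \<in> signed_sides (3 * n) (connect_sign n \<epsilon>) s \<longleftrightarrow> (k, i) \<in> signed_sides n \<epsilon> s"
    "(n + k, i) \<in> signed_sides (3 * n) (connect_sign n \<epsilon>) s \<longleftrightarrow> i < 3 \<and> (-1) ^ i = s"
    "(2 * n + k, i) \<in> signed_sides (3 * n) (connect_sign n \<epsilon>) s \<longleftrightarrow> i < 3 \<and> (-1) ^ i = - s"
  using assms by (auto simp: signed_sides_def connect_sign_def)

lemma less3_power: "i < (3::nat) \<and> (-1 :: int) ^ i = 1 \<longleftrightarrow> i = 0 \<or> i = 2" "i < (3::nat) \<and> (-1 :: int) ^ i = -1 \<longleftrightarrow> i = Suc 0"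
  by (cases "i = 0"; cases "i = 1"; cases "i = 2"; force)+

lemma less_3n_cases:
  assumes "t < 3 * (n::nat)"
  obtains "t < n" | k where "k < n" "t = n + k" | k where "k < n" "t = 2 * n + k"
  using assms that(2)[of "t - n"] that(3)[of "t - 2 * n"] that(1) by (cases "t < n"; cases "t < 2 * n") auto

lemma
  assumes n: "0 < n" and \<epsilon>: "\<And>t. t < n \<Longrightarrow> \<epsilon> t = 1 \<or> \<epsilon> t = - 1"
    and \<pi>: "bij_betw \<pi> (signed_sides n \<epsilon> 1) (signed_sides n \<epsilon> (- 1))"
  shows bij_connect_glue: "bij_betw (connect_glue n \<epsilon> \<pi>)
      (signed_sides (3 * n) (connect_sign n \<epsilon>) 1) (signed_sides (3 * n) (connect_sign n \<epsilon>) (- 1))"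
    and connected_connect: "connected_surface (matched_surface (3 * n) (connect_sign n \<epsilon>) (connect_glue n \<epsilon> \<pi>))"
proof -
  let ?P = "signed_sides n \<epsilon> 1" and ?N = "signed_sides n \<epsilon> (- 1)"
  let ?P' = "signed_sides (3 * n) (connect_sign n \<epsilon>) 1" and ?N' = "signed_sides (3 * n) (connect_sign n \<epsilon>) (- 1)"
  let ?g = "connect_glue n \<epsilon> \<pi>" and ?p = "first_positive \<epsilon>"
  define \<rho> where "\<rho> = inv_into ?P \<pi>"
  \<comment> \<open>The inverse of \<open>connect_glue\<close> on negative sides. The test on
    \<open>\<rho>\<close> asks whether the former partner is one of the sides that were cut;
    \<open>n - 1\<close> is the cyclic predecessor of 0.\<close>
  define h where "h = (\<lambda>(t, i::nat).
     if t < n then (if \<rho> (t, i) = ?p (fst (\<rho> (t, i))) then (2 * n + fst (\<rho> (t, i)), 1) else \<rho> (t, i))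
     else if t < 2 * n then ?p (t - n)
     else if i = 0 then (t - n, 0) else (n + (if t = 2 * n then n - 1 else t - 2 * n - 1), 2))"
  have \<rho>: "\<rho> (\<pi> a) = a" if "a \<in> ?P" for a
    using that \<pi> unfolding \<rho>_def by (rule bij_betw_inv_into_left[rotated])
  have \<pi>\<rho>: "\<pi> (\<rho> b) = b" "\<rho> b \<in> ?P" if "b \<in> ?N" for b
    using that bij_betw_inv_into_right[OF \<pi>] bij_betwE[OF bij_betw_inv_into[OF \<pi>]] by (auto simp: \<rho>_def)
  have \<pi>N: "\<pi> a \<in> ?N" if "a \<in> ?P" for a using bij_betwE[OF \<pi>] that by auto
  have pP: "?p k \<in> ?P" if "k < n" for k by (rule first_positive_mem[OF \<epsilon> that])
  have fp: "fst (?p k) = k" for k by (simp add: first_positive_def)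
  have lt: "fst a < n" if "a \<in> signed_sides n \<epsilon> s" for a s using that by (auto simp: signed_sides_def)
  note ss = signed_sides_connect[where n = n and \<epsilon> = \<epsilon>, simplified less3_power]
  have old: "a \<in> signed_sides (3 * n) (connect_sign n \<epsilon>) s" if "a \<in> signed_sides n \<epsilon> s" for a s
    using that by (auto simp: signed_sides_def connect_sign_def)
  have cs: "cyc_suc n k < n" if "k < n" for k using that n by (auto simp: cyc_suc_def)
  have g1: "?g (k, i) = (if (k, i) = ?p k then (n + k, 1) else \<pi> (k, i))" if "k < n" for k i
    using that by (simp add: connect_glue_def)
  have g2: "?g (n + k, i) = (if i = 0 then (2 * n + k, 0) else (2 * n + cyc_suc n k, 2))" if "k < n" for k i
    using that by (simp add: connect_glue_def)
  have g3: "?g (2 * n + k, i) = \<pi> (?p k)" if "k < n" for k i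
    using that by (simp add: connect_glue_def)
  have h1: "h a = (if \<rho> a = ?p (fst (\<rho> a)) then (2 * n + fst (\<rho> a), 1) else \<rho> a)" if "a \<in> ?N" for a
    using lt[OF that] by (cases a) (simp add: h_def)
  have h2: "h (n + k, i) = ?p k" if "k < n" for k i using that by (simp add: h_def)
  have h3: "h (2 * n + k, 0) = (n + k, 0)" if "k < n" for k using that by (simp add: h_def)
  have h4: "h (2 * n + cyc_suc n k, 2) = (n + k, 2)" if "k < n" for k using that by (auto simp: h_def cyc_suc_def)
  have P': "(t < n \<and> (t, i) \<in> ?P) \<or> (\<exists>k<n. t = n + k \<and> (i = 0 \<or> i = 2)) \<or> (\<exists>k<n. t = 2 * n + k \<and> i = 1)"
    if "(t, i) \<in> ?P'" for t i
  proof -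
    have "t < 3 * n" using that by (simp add: signed_sides_def)
    then show ?thesis by (rule less_3n_cases) (use that ss(1)[of _ 1] ss(2)[of _ 1] ss(3)[of _ 1] less3_power in auto)
  qed
  have N': "(t < n \<and> (t, i) \<in> ?N) \<or> (\<exists>k<n. t = n + k \<and> i = 1) \<or> (\<exists>k<n. t = 2 * n + k \<and> (i = 0 \<or> i = 2))"
    if "(t, i) \<in> ?N'" for t i
  proof -
    have "t < 3 * n" using that by (simp add: signed_sides_def)
    then show ?thesis by (rule less_3n_cases) (use that ss(1)[of _ "-1"] ss(2)[of _ "-1"] ss(3)[of _ "-1"] less3_power in auto)
  qed
  have pred: "\<exists>j<n. k = cyc_suc n j" if "k < n" for k
    using that n by (cases k) (auto simp: cyc_suc_def intro: exI[of _ "n - 1"] exI[of _ "k - 1"])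
  have mem: "(n + k, Suc 0) \<in> ?N'" "(n + k, 0) \<in> ?P'" "(n + k, 2) \<in> ?P'" "(2 * n + k, 0) \<in> ?N'" "(2 * n + k, 2) \<in> ?N'"
      "(2 * n + k, Suc 0) \<in> ?P'" if "k < n" for k
    using that signed_sides_connect(2,3)[OF that, where \<epsilon> = \<epsilon>] by auto
  show bij: "bij_betw ?g ?P' ?N'"
  proof (rule bij_betw_byWitness[of _ h])
    have "h (?g a) = a \<and> ?g a \<in> ?N'" if a': "a \<in> ?P'" for a
    proof -
      obtain t i where a: "a = (t, i)" "(t, i) \<in> ?P'" using a' by (cases a) auto
      from P'[OF a(2)] consider "t < n" "(t, i) \<in> ?P" | k where "k < n" "t = n + k" "i = 0 \<or> i = 2"
        | k where "k < n" "t = 2 * n + k" "i = 1" by blast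
      then show ?thesis
      proof cases
        case 1
        then show ?thesis
          using \<pi>N[OF 1(2)] \<rho>[OF 1(2)] old[OF \<pi>N[OF 1(2)]] by (auto simp: a(1) g1 h1 h2 mem)
      next
        case (2 k)
        then show ?thesis by (auto simp: a(1) g2 h3 h4 mem cs)
      next
        case (3 k)
        then show ?thesis
          using \<pi>N[OF pP[OF 3(1)]] \<rho>[OF pP[OF 3(1)]] old[OF \<pi>N[OF pP[OF 3(1)]]] by (simp add: a(1) g3 h1 fp)
      qed
    qed
    then show "\<forall>a\<in>?P'. h (?g a) = a" "?g ` ?P' \<subseteq> ?N'" by blast+
    have "?g (h b) = b \<and> h b \<in> ?P'" if b': "b \<in> ?N'" for b
    proof -
      obtain t i where b: "b = (t, i)" "(t, i) \<in> ?N'" using b' by (cases b) auto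
      from N'[OF b(2)] consider "t < n" "(t, i) \<in> ?N" | k where "k < n" "t = n + k" "i = 1"
        | k where "k < n" "t = 2 * n + k" "i = 0" | k where "k < n" "t = 2 * n + k" "i = 2" by blast
      then show ?thesis
      proof cases
        case 1
        define a where "a = \<rho> (t, i)"
        have "a \<in> ?P" "\<pi> a = (t, i)" using \<pi>\<rho>[OF 1(2)] by (simp_all add: a_def)
        then show ?thesis
          using lt[of a 1] g1[of "fst a" "snd a"] g3[of "fst a"] old[of a] mem(6)[of "fst a"]
          by (auto simp: b(1) h1[OF 1(2)] a_def[symmetric])
      next
        case (2 k)
        have "(k, snd (?p k)) = ?p k" using fp[of k] by (simp add: prod_eq_iff)
        then show ?thesis using 2 g1[of k "snd (?p k)"] old[OF pP[OF 2(1)]] by (simp add: b(1) h2)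
      next
        case (3 k)
        then show ?thesis by (simp add: b(1) g2 h3 mem)
      next
        case (4 k)
        then obtain j where "j < n" "k = cyc_suc n j" using pred by blast
        then show ?thesis using 4 by (simp add: b(1) g2 h4 mem)
      qed
    qed
    then show "\<forall>b\<in>?N'. ?g (h b) = b" "h ` ?N' \<subseteq> ?P'" by blast+
  qed
  let ?S = "matched_surface (3 * n) (connect_sign n \<epsilon>) ?g"
  let ?r = "{(fst a, fst (glue ?S a)) |a. a \<in> sides ?S}"
  have \<epsilon>': "connect_sign n \<epsilon> t = 1 \<or> connect_sign n \<epsilon> t = - 1" for t
    using \<epsilon>[of t] by (auto simp: connect_sign_def)
  interpret oriented_surface ?S
    by unfold_locales (rule closed_matched_surface[OF \<epsilon>' bij])
  have r: "(fst a, fst (?g a)) \<in> ?r" if "a \<in> ?P'" for a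
  proof -
    have "a \<in> sides ?S" "glue ?S a = ?g a"
      using that by (auto simp: signed_sides_def matched_surface_def sides_def)
    then show ?thesis by (intro CollectI exI[of _ a]) (simp del: sides_iff)
  qed
  have "sym ?r"
  proof (rule symI)
    fix s t assume "(s, t) \<in> ?r"
    then obtain a where a: "a \<in> sides ?S" "s = fst a" "t = fst (glue ?S a)" by blast
    then show "(t, s) \<in> ?r" using glue_sides[OF a(1)] glue_glue[OF a(1)]
      by (intro CollectI exI[of _ "glue ?S a"]) (simp del: sides_iff)
  qed
  then have symr: "sym (?r\<^sup>*)" by (rule sym_rtrancl)
  have r1: "(k, n + k) \<in> ?r" if "k < n" for k
  proof -
    have e: "(k, snd (?p k)) = ?p k" using fp[of k] by (simp add: prod_eq_iff)
    have g: "?g (?p k) = (n + k, 1)" using g1[OF that, of "snd (?p k)"] unfolding e by simp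
    show ?thesis using r[OF old[OF pP[OF that]]] unfolding g fp fst_conv .
  qed
  have r2: "(n + k, 2 * n + k) \<in> ?r" "(n + k, 2 * n + cyc_suc n k) \<in> ?r" if "k < n" for k
    using r[OF mem(2)[OF that]] r[OF mem(3)[OF that]] g2[OF that] by simp_all
  have three: "(k, n + k) \<in> ?r\<^sup>*" "(k, 2 * n + k) \<in> ?r\<^sup>*" if "k < n" for k
    by (rule r_into_rtrancl[OF r1[OF that]])
      (rule converse_rtrancl_into_rtrancl[OF r1[OF that] r_into_rtrancl[OF r2(1)[OF that]]])
  \<comment> \<open>The path from \<open>k\<close> to \<open>Suc k\<close> runs through
    \<open>n + k\<close> and, by the cyclic gluing, through \<open>2 * n + Suc k\<close>.\<close>
  have zero: "(0, k) \<in> ?r\<^sup>*" if "k < n" for k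
    using that
  proof (induction k)
    case (Suc k)
    have "(0, n + k) \<in> ?r\<^sup>*" using Suc r1[of k] by (meson Suc_lessD rtrancl.rtrancl_into_rtrancl)
    also have "(n + k, 2 * n + Suc k) \<in> ?r" using r2(2)[of k] Suc.prems by (simp add: cyc_suc_def)
    also have "(2 * n + Suc k, Suc k) \<in> ?r\<^sup>*" using three(2)[OF Suc.prems] symr by (meson symD)
    finally show ?case .
  qed simp
  have all: "(0, t) \<in> ?r\<^sup>*" if "t < 3 * n" for t
    using that
  proof (rule less_3n_cases)
    show "(0, t) \<in> ?r\<^sup>*" if "k < n" "t = n + k" for k
      unfolding that(2) by (rule rtrancl_trans[OF zero[OF that(1)] three(1)[OF that(1)]])
    show "(0, t) \<in> ?r\<^sup>*" if "k < n" "t = 2 * n + k" for k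
      unfolding that(2) by (rule rtrancl_trans[OF zero[OF that(1)] three(2)[OF that(1)]])
  qed (rule zero)
  show "connected_surface ?S"
    unfolding connected_surface_def
  proof (intro conjI allI impI)
    show "0 < ntri ?S" using n by simp
    show "(s, t) \<in> ?r\<^sup>*" if "s < ntri ?S" "t < ntri ?S" for s t
    proof -
      have "s < 3 * n" "t < 3 * n" using that by simp_all
      then show ?thesis by (intro rtrancl_trans[OF symD[OF symr all] all])
    qed
  qed
qed

text \<open>The coefficient of \<open>g\<close> in the boundary of \<open>z\<close> is the number of
  positive minus the number of negative sides labelled \<open>g\<close>, so a cycle allows a pairing
  of sides with equal labels. The inserted triangles map to simplices that cancel in pairs; hence
  the cycle \<open>z\<close> itself is obtained, not just its class.\<close>

theorem cycle_represented_by_surface: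
  assumes G: "group G" and z: "z \<in> bar_cycles G"
  shows "\<exists>S \<phi>. closed_oriented_surface S \<and> connected_surface S \<and> local_system G S \<phi> \<and>
    pushforward_fundamental_cycle S \<phi> = z"
proof -
  interpret G: group G by (rule G)
  have "Poly_Mapping.keys z \<subseteq> carrier G \<times> carrier G" using z by (simp add: bar_cycles_def)
  from chain_as_signed_list[OF this]
  obtain n0 and \<epsilon>0 :: "nat \<Rightarrow> int" and p0 where 0: "\<And>t. t < n0 \<Longrightarrow> \<epsilon>0 t = 1 \<or> \<epsilon>0 t = - 1"
    "\<And>t. t < n0 \<Longrightarrow> p0 t \<in> carrier G \<times> carrier G" "z = (\<Sum>t<n0. frag_cmul (\<epsilon>0 t) (frag_of (p0 t)))"
    by blast
  \<comment> \<open>Two cancelling triangles mapped to the simplex of two units are appended, since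
    even the zero cycle needs a nonempty surface.\<close>
  define n where "n = Suc (Suc n0)"
  define \<epsilon> where "\<epsilon> t = (if t < n0 then \<epsilon>0 t else if t = n0 then 1 else - 1)" for t
  define p where "p t = (if t < n0 then p0 t else (\<one>\<^bsub>G\<^esub>, \<one>\<^bsub>G\<^esub>))" for t
  have n: "0 < n" by (simp add: n_def)
  have \<epsilon>: "\<epsilon> t = 1 \<or> \<epsilon> t = - 1" for t using 0(1)[of t] by (simp add: \<epsilon>_def)
  have p: "fst (p t) \<in> carrier G" "snd (p t) \<in> carrier G" for t
    using 0(2)[of t] by (auto simp: p_def)
  have zn: "z = (\<Sum>t<n. frag_cmul (\<epsilon> t) (frag_of (p t)))"
    by (simp add: n_def 0(3) \<epsilon>_def p_def)
  define lab where "lab = (\<lambda>(t, i::nat). if i = 0 then snd (p t) else if i = 1 then fst (p t) \<otimes>\<^bsub>G\<^esub> snd (p t) else fst (p t))"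
  have labG: "lab a \<in> carrier G" for a using p by (cases a) (simp add: lab_def)
  let ?A = "{..<n} \<times> {..<3::nat}"
  have "card {a \<in> signed_sides n \<epsilon> 1. lab a = g} = card {a \<in> signed_sides n \<epsilon> (- 1). lab a = g}" for g
  proof -
    have fin: "finite (signed_sides n \<epsilon> s)" for s
      by (rule finite_subset[of _ ?A]) (auto simp: signed_sides_def)
    have "0 = Poly_Mapping.lookup (bar_d2 G z) g" using z by (simp add: bar_cycles_def)
    also have "\<dots> = (\<Sum>t<n. \<epsilon> t * ((if lab (t, 0) = g then 1 else 0) - (if lab (t, 1) = g then 1 else 0) + (if lab (t, 2) = g then 1 else 0)))"
      unfolding zn bar_d2_def
      by (simp add: frag_extend_sum frag_extend_cmul lookup_sum lookup_add lookup_minus lab_def split_beta)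
        (auto intro!: sum.cong)
    also have "\<dots> = (\<Sum>t<n. \<Sum>i<3. (-1) ^ i * \<epsilon> t * (if lab (t, i) = g then 1 else 0))"
      by (intro sum.cong refl) (simp add: numeral_3_eq_3 numeral_2_eq_2 algebra_simps)
    also have "\<dots> = (\<Sum>a\<in>?A. (-1) ^ snd a * \<epsilon> (fst a) * (if lab a = g then 1 else 0))"
      by (simp add: sum.cartesian_product split_beta)
    also have "\<dots> = (\<Sum>a\<in>signed_sides n \<epsilon> 1 \<union> signed_sides n \<epsilon> (- 1). (-1) ^ snd a * \<epsilon> (fst a) * (if lab a = g then 1 else 0))"
    proof (rule sum.cong)
      have "(t, i) \<in> signed_sides n \<epsilon> 1 \<or> (t, i) \<in> signed_sides n \<epsilon> (- 1)" if "t < n" "i < 3" for t i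
        by (rule signed_sides_cases) (use \<epsilon> that in auto)
      then show "?A = signed_sides n \<epsilon> 1 \<union> signed_sides n \<epsilon> (- 1)"
        by (auto simp: signed_sides_def)
    qed simp
    also have "\<dots> = (\<Sum>a\<in>signed_sides n \<epsilon> 1. (-1) ^ snd a * \<epsilon> (fst a) * (if lab a = g then 1 else 0))
        + (\<Sum>a\<in>signed_sides n \<epsilon> (- 1). (-1) ^ snd a * \<epsilon> (fst a) * (if lab a = g then 1 else 0))"
      by (rule sum.union_disjoint[OF fin fin]) (auto simp: signed_sides_def)
    also have "(\<Sum>a\<in>signed_sides n \<epsilon> 1. (-1) ^ snd a * \<epsilon> (fst a) * (if lab a = g then 1 else 0))
        = (\<Sum>a\<in>signed_sides n \<epsilon> 1. if lab a = g then 1 else 0)"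
      by (rule sum.cong) (auto simp: signed_sides_def)
    also have "(\<Sum>a\<in>signed_sides n \<epsilon> (- 1). (-1) ^ snd a * \<epsilon> (fst a) * (if lab a = g then 1 else 0))
        = (\<Sum>a\<in>signed_sides n \<epsilon> (- 1). - (if lab a = g then 1 else 0))"
      by (rule sum.cong) (auto simp: signed_sides_def)
    also have "(\<Sum>a\<in>signed_sides n \<epsilon> 1. if lab a = g then 1 else 0) + (\<Sum>a\<in>signed_sides n \<epsilon> (- 1). - (if lab a = g then 1 else 0))
       = int (card {a \<in> signed_sides n \<epsilon> 1. lab a = g}) - int (card {a \<in> signed_sides n \<epsilon> (- 1). lab a = g})"
    proof -
      have c: "int (card {a \<in> A. lab a = g}) = (\<Sum>a\<in>A. if lab a = g then 1 else 0)" if "finite A" for A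
        using sum.inter_filter[OF that, of "\<lambda>_. 1 :: int" "\<lambda>a. lab a = g"] by simp
      show ?thesis unfolding c[OF fin] sum_negf by simp
    qed
    finally show ?thesis by simp
  qed
  moreover have "finite (signed_sides n \<epsilon> s)" for s
    by (rule finite_subset[of _ ?A]) (auto simp: signed_sides_def)
  ultimately obtain \<pi> where \<pi>: "bij_betw \<pi> (signed_sides n \<epsilon> 1) (signed_sides n \<epsilon> (- 1))"
    "\<And>a. a \<in> signed_sides n \<epsilon> 1 \<Longrightarrow> lab (\<pi> a) = lab a"
    using ex_label_preserving_bij[of "signed_sides n \<epsilon> 1" "signed_sides n \<epsilon> (- 1)" lab] by auto
  define S where "S = matched_surface (3 * n) (connect_sign n \<epsilon>) (connect_glue n \<epsilon> \<pi>)"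
  define gk where "gk k = lab (first_positive \<epsilon> k)" for k
  define \<phi> where "\<phi> = (\<lambda>(t, i). if t < n then lab (t, i) else if i = 2 then \<one>\<^bsub>G\<^esub>
    else gk (if t < 2 * n then t - n else t - 2 * n))"
  have sgn: "connect_sign n \<epsilon> t = 1 \<or> connect_sign n \<epsilon> t = - 1" for t
    using \<epsilon>[of t] by (auto simp: connect_sign_def)
  note bij = bij_connect_glue[OF n \<epsilon> \<pi>(1)]
  have lt: "fst a < n" if "a \<in> signed_sides n \<epsilon> s" for a s using that by (auto simp: signed_sides_def)
  have \<phi>old: "\<phi> a = lab a" if "fst a < n" for a using that by (cases a) (simp add: \<phi>_def)
  have lab_glue: "\<phi> (connect_glue n \<epsilon> \<pi> a) = \<phi> a" if "a \<in> signed_sides (3 * n) (connect_sign n \<epsilon>) 1" for a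
  proof -
    obtain t i where a: "a = (t, i)" by (cases a) auto
    have pk: "first_positive \<epsilon> k \<in> signed_sides n \<epsilon> 1" if "k < n" for k by (rule first_positive_mem[OF \<epsilon> that])
    have pi\<phi>: "\<phi> (\<pi> b) = lab b" if "b \<in> signed_sides n \<epsilon> 1" for b
      using \<pi>(2)[OF that] \<phi>old[of "\<pi> b"] lt[of "\<pi> b" "-1"] bij_betwE[OF \<pi>(1)] that by auto
    have t: "t < 3 * n" "i < 3" using that a by (auto simp: signed_sides_def)
    show ?thesis using t(1)
    proof (rule less_3n_cases)
      assume "t < n"
      then have "(t, i) \<in> signed_sides n \<epsilon> 1" using that a signed_sides_connect(1)[of t n 1] by simp
      then show ?thesis using \<open>t < n\<close> pi\<phi> by (auto simp: a connect_glue_def \<phi>_def gk_def)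
    next
      fix k assume k: "k < n" "t = n + k"
      then have "i \<noteq> 1" using that a signed_sides_connect(2)[of k n 1] by auto
      then have "i = 0 \<or> i = 2" using t(2) by auto
      then show ?thesis using k by (auto simp: a connect_glue_def \<phi>_def)
    next
      fix k assume k: "k < n" "t = 2 * n + k"
      then have "i = 1" using that a t(2) signed_sides_connect(3)[of k n 1] less3_power(2)[of i] by auto
      then show ?thesis using k pi\<phi>[OF pk[OF k(1)]] by (simp add: a connect_glue_def \<phi>_def gk_def)
    qed
  qed
  have "closed_oriented_surface S" unfolding S_def by (rule closed_matched_surface[OF sgn bij])
  moreover have "connected_surface S" unfolding S_def by (rule connected_connect[OF n \<epsilon> \<pi>(1)])
  moreover have "local_system G S \<phi>"
    unfolding local_system_def
  proof (intro conjI ballI allI impI)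
    fix a assume "a \<in> sides S"
    then show "\<phi> (glue S a) = \<phi> a" unfolding S_def
      by (rule label_matched_surface[OF sgn bij, where lab = \<phi>, rotated]) (rule lab_glue)
    show "\<phi> a \<in> carrier G" using labG by (cases a) (simp add: \<phi>_def gk_def)
  next
    fix t assume "t < ntri S"
    show "\<phi> (t, 1) = \<phi> (t, 2) \<otimes>\<^bsub>G\<^esub> \<phi> (t, 0)"
      using labG by (simp add: \<phi>_def gk_def) (simp add: lab_def)
  qed
  moreover have "pushforward_fundamental_cycle S \<phi> = z"
  proof -
    define f where "f t = frag_cmul (connect_sign n \<epsilon> t) (frag_of (\<phi> (t, 2), \<phi> (t, 0)))" for t
    have split: "(\<Sum>t<m + k. f t) = (\<Sum>t<m. f t) + (\<Sum>t<k. f (m + t))" for m k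
      by (induction k) (simp_all add: add.assoc)
    have "pushforward_fundamental_cycle S \<phi> = (\<Sum>t<n + n + n. f t)"
      by (simp add: pushforward_fundamental_cycle_def S_def f_def numeral_3_eq_3 add.assoc)
    also have "\<dots> = (\<Sum>t<n. f t) + (\<Sum>t<n. f (n + t)) + (\<Sum>t<n. f (n + n + t))"
      unfolding split ..
    also have "(\<Sum>t<n. f t) = z"
      unfolding zn by (intro sum.cong refl) (simp add: f_def connect_sign_def \<phi>_def lab_def)
    also have "(\<Sum>t<n. f (n + n + t)) = (\<Sum>t<n. - f (n + t))"
      by (intro sum.cong refl) (simp add: f_def connect_sign_def \<phi>_def)
    finally show ?thesis by (simp add: sum_negf)
  qed
  ultimately show ?thesis by blast
qed

section \<open>The Maslov cocycle represents the signature class\<close>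

lemma group_Sp: "group (Sp :: ('h::finite symp_space \<Rightarrow> 'h symp_space) monoid)"
proof (rule groupI)
  fix x :: "'h symp_map"
  assume x: "x \<in> carrier Sp"
  have "inv_into UNIV x \<circ> x = id" using Sp_bij[OF x] by (simp add: bij_is_inj)
  then show "\<exists>y\<in>carrier Sp. y \<otimes>\<^bsub>Sp\<^esub> x = \<one>\<^bsub>Sp\<^esub>"
    using Sp_inv_closed[OF x] by (auto simp: Sp_simps)
qed (auto simp: Sp_simps Sp_mult_closed Sp_one_closed o_assoc)

lemma cochain_eval_pushforward:
  "cochain_eval c (pushforward_fundamental_cycle S \<phi>) =
   (\<Sum>t<ntri S. of_int (tri_sign S t) * c (\<phi> (t, 2), \<phi> (t, 0)))"
  by (simp add: pushforward_fundamental_cycle_def cochain_eval_sum cochain_eval_cmul)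

theorem represents_maslov_cocycle:
  "represents_class Sp (maslov_cocycle :: _ \<times> ('h::finite symp_space \<Rightarrow> 'h symp_space) \<Rightarrow> real) signature_class"
  unfolding represents_class_def
proof (intro conjI ballI)
  show m: "bar_cocycle2 Sp (maslov_cocycle :: _ \<times> 'h symp_map \<Rightarrow> real)"
    by (rule maslov_cocycle)
  fix X and z' :: "'h symp_map \<times> 'h symp_map \<Rightarrow>\<^sub>0 int"
  assume X: "X \<in> carrier (bar_H2 Sp)" and z': "z' \<in> X"
  obtain z where z: "z \<in> X" "z \<in> bar_cycles Sp"
    "\<And>z'. z' \<in> X \<Longrightarrow> cochain_eval maslov_cocycle z' = cochain_eval maslov_cocycle z"
    using mem_carrier_bar_H2[OF group_Sp X] m by metis
  obtain S \<phi> where S: "closed_oriented_surface S" "connected_surface S" "local_system Sp S \<phi>"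
    "pushforward_fundamental_cycle S \<phi> = z"
    using cycle_represented_by_surface[OF group_Sp z(2)] by blast
  have eval: "real_of_int s = cochain_eval maslov_cocycle z"
    if "closed_oriented_surface S" "local_system Sp S \<phi>" "pushforward_fundamental_cycle S \<phi> \<in> X" "has_signature S \<phi> s"
    for S \<phi> s
  proof -
    interpret symplectic_surface S \<phi> by unfold_locales (fact that)+
    have "real_of_int s = cochain_eval maslov_cocycle (pushforward_fundamental_cycle S \<phi>)"
      using that(4) by (simp add: has_signature_iff cochain_eval_pushforward)
    also have "\<dots> = cochain_eval maslov_cocycle z" by (rule z(3)[OF that(3)])
    finally show ?thesis .
  qed
  obtain s where s: "has_signature S \<phi> s"
  proof -
    interpret symplectic_surface S \<phi> by unfold_locales (fact S)+
    show thesis using ex_has_signature that by blast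
  qed
  have "signature_class X = cochain_eval maslov_cocycle z"
    unfolding signature_class_def
  proof (rule the_equality)
    show "\<exists>S \<phi> s. closed_oriented_surface S \<and> connected_surface S \<and> local_system Sp S \<phi> \<and>
      pushforward_fundamental_cycle S \<phi> \<in> X \<and> has_signature S \<phi> s \<and> cochain_eval maslov_cocycle z = real_of_int s"
      using S s z(1) eval[OF S(1,3)] by (intro exI[of _ S] exI[of _ \<phi>] exI[of _ s]) auto
  qed (use eval in blast)
  then show "cochain_eval maslov_cocycle z' = signature_class X" using z(3)[OF z'] by simp
qed

section \<open>The lower bound\<close>

text \<open>\<open>b x\<close> is the value of \<open>d\<close> on a chain with boundary
  \<open>frag_of x\<close>; two such chains differ by a cycle, on which \<open>d\<close> vanishes.
  \<open>P\<close> consists of the elements that admit such a chain. For a commutator of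
  \<open>g\<close> and \<open>y\<close> an explicit chain of three simplices does it, so a bound on
  \<open>d\<close> gives three times that bound for \<open>b x\<close>.\<close>

lemma exists_primitive_on_commutators:
  assumes G: "group G" and d: "\<And>z. z \<in> bar_cycles G \<Longrightarrow> cochain_eval d z = 0"
  obtains b P where
    "\<And>x y. x \<in> P \<Longrightarrow> y \<in> P \<Longrightarrow> x \<otimes>\<^bsub>G\<^esub> y \<in> P"
    "\<And>x y. x \<in> P \<Longrightarrow> y \<in> P \<Longrightarrow> d (x, y) = b x + b y - b (x \<otimes>\<^bsub>G\<^esub> y)"
    "\<And>x y g. x \<in> carrier G \<Longrightarrow> y \<in> carrier G \<Longrightarrow> g \<in> carrier G \<Longrightarrow>
       x \<otimes>\<^bsub>G\<^esub> y \<otimes>\<^bsub>G\<^esub> g = g \<otimes>\<^bsub>G\<^esub> y \<Longrightarrow> x \<in> P \<and> b x = d (x, y) - d (g, y) + d (x \<otimes>\<^bsub>G\<^esub> y, g)"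
proof -
  interpret group G by (rule G)
  let ?K = "carrier G \<times> carrier G"
  define fills where "fills x z \<longleftrightarrow> Poly_Mapping.keys z \<subseteq> ?K \<and> bar_d2 G z = frag_of x" for x z
  define P where "P = {x \<in> carrier G. \<exists>z. fills x z}"
  define b where "b x = cochain_eval d (SOME z. fills x z)" for x
  have b_eq: "b x = cochain_eval d z" if z: "fills x z" for x z
  proof -
    define w where "w = (SOME z. fills x z)"
    have w: "fills x w" unfolding w_def using z by (rule someI)
    have "Poly_Mapping.keys (w - z) \<subseteq> ?K"
      using keys_diff[of w z] w z unfolding fills_def by blast
    then have "w - z \<in> bar_cycles G"
      using w z by (simp add: fills_def bar_cycles_def bar_d2_def frag_extend_diff)
    from d[OF this] show ?thesis by (simp add: cochain_eval_diff b_def w_def)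
  qed
  have d2: "bar_d2 G (frag_of (x, y)) = frag_of y - frag_of (x \<otimes>\<^bsub>G\<^esub> y) + frag_of x" for x y
    by (simp add: bar_d2_def)
  have d2_add: "bar_d2 G (z + w) = bar_d2 G z + bar_d2 G w" "bar_d2 G (z - w) = bar_d2 G z - bar_d2 G w" for z w
    by (simp_all add: bar_d2_def frag_extend_add frag_extend_diff)
  have mult: "fills (x \<otimes>\<^bsub>G\<^esub> y) (z + w - frag_of (x, y))" if "x \<in> P" "y \<in> P" "fills x z" "fills y w" for x y z w
  proof -
    have "Poly_Mapping.keys (z + w - frag_of (x, y)) \<subseteq> Poly_Mapping.keys z \<union> Poly_Mapping.keys w \<union> {(x, y)}"
      using keys_diff[of "z + w" "frag_of (x, y)"] keys_add[of z w] by (auto simp: keys_frag_of)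
    then show ?thesis using that by (auto simp: fills_def d2 d2_add P_def)
  qed
  show thesis
  proof (rule that)
    fix x y assume xy: "x \<in> P" "y \<in> P"
    then obtain z w where zw: "fills x z" "fills y w" by (auto simp: P_def)
    show "x \<otimes>\<^bsub>G\<^esub> y \<in> P" using mult[OF xy zw] xy by (auto simp: P_def)
    show "d (x, y) = b x + b y - b (x \<otimes>\<^bsub>G\<^esub> y)"
      unfolding b_eq[OF zw(1)] b_eq[OF zw(2)] b_eq[OF mult[OF xy zw]]
      by (simp add: cochain_eval_add cochain_eval_diff)
  next
    fix x y g assume *: "x \<in> carrier G" "y \<in> carrier G" "g \<in> carrier G" "x \<otimes>\<^bsub>G\<^esub> y \<otimes>\<^bsub>G\<^esub> g = g \<otimes>\<^bsub>G\<^esub> y"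
    let ?z = "frag_of (x, y) - frag_of (g, y) + frag_of (x \<otimes>\<^bsub>G\<^esub> y, g)"
    have "Poly_Mapping.keys ?z \<subseteq> {(x, y), (g, y), (x \<otimes>\<^bsub>G\<^esub> y, g)}"
      using keys_add[of "frag_of (x, y) - frag_of (g, y)" "frag_of (x \<otimes>\<^bsub>G\<^esub> y, g)"]
        keys_diff[of "frag_of (x, y)" "frag_of (g, y)"] by (auto simp: keys_frag_of)
    then have z: "fills x ?z" using * by (auto simp: fills_def d2 d2_add)
    then show "x \<in> P \<and> b x = d (x, y) - d (g, y) + d (x \<otimes>\<^bsub>G\<^esub> y, g)"
      using b_eq[OF z] * by (auto simp: P_def cochain_eval_add cochain_eval_diff)
  qed
qed

text \<open>The diagonal embedding of \<open>SL\<^sub>2(\<real>)\<close> into \<open>Sp\<^sub>2\<^sub>h(\<real>)\<close>.\<close>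

definition sl2 :: "real \<Rightarrow> real \<Rightarrow> real \<Rightarrow> real \<Rightarrow> 'h::finite symp_space \<Rightarrow> 'h symp_space" where
  "sl2 p q r s v = (p *\<^sub>R fst v + q *\<^sub>R snd v, r *\<^sub>R fst v + s *\<^sub>R snd v)"

lemma sl2_comp: "sl2 p q r s \<circ> sl2 p' q' r' s' =
    sl2 (p * p' + q * r') (p * q' + q * s') (r * p' + s * r') (r * q' + s * s')"
  by (simp add: sl2_def fun_eq_iff algebra_simps)

lemma sl2_cong: "p = p' \<Longrightarrow> q = q' \<Longrightarrow> r = r' \<Longrightarrow> s = s' \<Longrightarrow> sl2 p q r s = sl2 p' q' r' s'"
  by simp

lemma sl2_one: "sl2 1 0 0 1 = id"
  by (simp add: sl2_def fun_eq_iff)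

lemma sl2_Sp:
  assumes "p * s - q * r = 1"
  shows "(sl2 p q r s :: 'h::finite symp_space \<Rightarrow> _) \<in> carrier Sp"
proof -
  have "sl2 p q r s \<circ> sl2 s (- q) (- r) p = (id :: 'h symp_space \<Rightarrow> _)"
    "sl2 s (- q) (- r) p \<circ> sl2 p q r s = (id :: 'h symp_space \<Rightarrow> _)"
    using assms unfolding sl2_one[symmetric] sl2_comp by (simp_all add: algebra_simps)
  then have "bij (sl2 p q r s :: 'h symp_space \<Rightarrow> _)" using o_bij by blast
  moreover have "linear (sl2 p q r s :: 'h symp_space \<Rightarrow> _)"
    by (simp add: linear_iff sl2_def algebra_simps)
  moreover have "symp_form (sl2 p q r s u) (sl2 p q r s v) = symp_form u v" for u v :: "'h symp_space"
  proof -
    have "symp_form (sl2 p q r s u) (sl2 p q r s v) = (p * s - q * r) * symp_form u v"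
      by (simp add: symp_form_def sl2_def inner_add_left inner_add_right algebra_simps inner_commute)
    then show ?thesis using assms by simp
  qed
  ultimately show ?thesis by (simp add: Sp_def del: split_paired_All)
qed

lemma maslov_cocycle_sl2:
  fixes x y :: "'h::finite symp_space \<Rightarrow> 'h symp_space"
  assumes "x \<in> carrier Sp" "y \<in> carrier Sp" "x = sl2 p q r s" "x \<circ> y = sl2 p' q' r' s'" "r \<noteq> 0" "r' \<noteq> 0"
  shows "maslov_cocycle (x, y) = real CARD('h) * sgn (p' / r' - p / r)"
proof (rule maslov_cocycle_eq)
  show "x (v, 0) = (p *\<^sub>R v, r *\<^sub>R v)" for v by (simp add: assms(3) sl2_def)
  show "x (y (v, 0)) = (p' *\<^sub>R v, r' *\<^sub>R v)" for v
    using fun_cong[OF assms(4), of "(v, 0)"] by (simp add: sl2_def)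
qed (use assms in auto)

text \<open>The parabolic elements \<open>a = [1 2; 0 1]\<close>, \<open>b = [1 0; -2 1]\<close> and \<open>c = (a b)\<^sup>-\<^sup>1\<close> generate the holonomy of
  the thrice-punctured sphere. The ideal triangles with vertices \<open>\<infinity>, 0, 1\<close> and \<open>\<infinity>, 0, -1\<close>, the fixed
  points of \<open>a, b, c\<close> and of \<open>a, b, a\<^sup>-\<^sup>1 c a\<close>, form a fundamental domain, and the simplices
  \<open>(a\<^sup>i, b\<^sup>j, c\<^sup>k)\<close> and \<open>(a\<^sup>i, b\<^sup>j, a\<^sup>-\<^sup>1 c\<^sup>k)\<close> smear them over their cusps. The Maslov cocycle takes its
  extremal values on all \<open>2 N\<^sup>3\<close> of them, whereas their boundaries cancel up to \<open>O(N\<^sup>2)\<close> terms.\<close>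

definition par_a :: "real \<Rightarrow> 'h::finite symp_space \<Rightarrow> 'h symp_space" where
  "par_a i = sl2 1 (2 * i) 0 1"

definition par_b :: "real \<Rightarrow> 'h::finite symp_space \<Rightarrow> 'h symp_space" where
  "par_b j = sl2 1 0 (- 2 * j) 1"

text \<open>The powers of \<open>c\<close>, whose matrix has rows (1, -2) and (2, -3): it has trace
  -2 and fixes the line of (1, 1), so its powers are unipotent up to the sign
  \<open>(- 1) ^ k\<close>. Because of the sign the exponent is natural, unlike the real parameters
  of \<open>par_a\<close> and \<open>par_b\<close>.\<close>

definition par_c :: "nat \<Rightarrow> 'h::finite symp_space \<Rightarrow> 'h symp_space" where
  "par_c k = sl2 ((- 1) ^ k * (1 - 2 * real k)) ((- 1) ^ k * (2 * real k))
     ((- 1) ^ k * (- 2 * real k)) ((- 1) ^ k * (1 + 2 * real k))"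

lemma sq_minus_one_power: "(- 1) ^ k * ((- 1) ^ k * z) = (z :: real)"
  by (simp flip: mult.assoc power_mult_distrib)

lemma par_Sp: "par_a i \<in> carrier Sp" "par_b j \<in> carrier Sp" "par_c k \<in> carrier Sp"
  unfolding par_a_def par_b_def par_c_def
  by (rule sl2_Sp; simp add: algebra_simps sq_minus_one_power power2_eq_square)+

lemma par_comp:
  "par_a i \<circ> par_a i' = par_a (i + i')" "par_b j \<circ> par_b j' = par_b (j + j')"
  "par_c k \<circ> par_c k' = par_c (k + k')" "par_b (- 1) \<circ> par_a (- 1) = par_c 1"
  "par_b 1 \<circ> par_c 1 = par_a (- 1)"
  unfolding par_a_def par_b_def par_c_def sl2_comp
  by (simp_all add: algebra_simps power_add)

lemma par_0: "par_a 0 = id" "par_b 0 = id" "par_c 0 = id"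
  unfolding par_a_def par_b_def par_c_def by (simp_all add: sl2_one)

text \<open>\<open>L\<close> is the point at infinity, fixed by \<open>a\<close>, which translates
  by 2. The images of \<open>L\<close> under \<open>x\<close> and the product have coordinates
  \<open>- 1 / (2 * j) - 2 * i\<close> and \<open>1 - 1 / (2 * k) - 2 * i\<close>, the latter
  lowered by 2 in the second case. The fractions are at most 1/2, so they cannot change the order;
  positive \<open>j\<close> and \<open>k\<close> keep both points finite.\<close>

lemma maslov_cocycle_par:
  fixes i :: real and j k :: nat
  assumes "0 < j" "0 < k"
  defines "x \<equiv> par_a (- i) \<circ> par_b j :: 'h::finite symp_space \<Rightarrow> _"
  shows "maslov_cocycle (x, par_b (- real j) \<circ> par_c k) = real CARD('h)"
    and "maslov_cocycle (x, par_b (- real j) \<circ> par_a (- 1) \<circ> par_c k) = - real CARD('h)"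
proof -
  define e where "e = (- 1 :: real) ^ k"
  have e: "e \<noteq> 0" by (simp add: e_def)
  have x: "x = sl2 (1 + 4 * i * real j) (- 2 * i) (- 2 * real j) 1" "x \<in> carrier Sp"
    by (simp add: x_def par_a_def par_b_def sl2_comp mult.assoc) (simp add: x_def Sp_mult_closed par_Sp)
  have ac: "par_a (- i') \<circ> par_c k = sl2 (e * (1 - 2 * real k + 4 * i' * real k)) (e * (2 * real k - 2 * i' * (1 + 2 * real k)))
      (e * (- 2 * real k)) (e * (1 + 2 * real k))" for i' :: real
    unfolding par_a_def par_c_def sl2_comp e_def[symmetric] by (simp add: algebra_simps)
  have bb: "par_b j \<circ> par_b (- real j) = (id :: 'h symp_space \<Rightarrow> _)" by (simp add: par_comp par_0)
  have "x \<circ> (par_b (- real j) \<circ> par_c k) = par_a (- i) \<circ> (par_b j \<circ> par_b (- real j)) \<circ> par_c k"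
    by (simp add: x_def o_assoc)
  then have 1: "x \<circ> (par_b (- real j) \<circ> par_c k) = par_a (- i) \<circ> par_c k" by (simp add: bb)
  have "x \<circ> (par_b (- real j) \<circ> par_a (- 1) \<circ> par_c k) =
      par_a (- i) \<circ> (par_b j \<circ> par_b (- real j)) \<circ> par_a (- 1) \<circ> par_c k"
    by (simp add: x_def o_assoc)
  then have 2: "x \<circ> (par_b (- real j) \<circ> par_a (- 1) \<circ> par_c k) = par_a (- (i + 1)) \<circ> par_c k"
    unfolding bb by (simp add: par_comp)
  have slope: "e * (1 - 2 * real k + 4 * i' * real k) / (e * (- 2 * real k)) = 1 - 1 / (2 * real k) - 2 * i'" for i' :: real
    using e assms(2) by (simp add: field_simps)
  have slope_x: "(1 + 4 * i * real j) / (- 2 * real j) = - 1 / (2 * real j) - 2 * i"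
    using assms(1) by (simp add: field_simps)
  have "0 < 1 / (2 * real l)" "1 / (2 * real l) \<le> 1 / 2" if "0 < l" for l :: nat
    using that by (simp_all add: field_simps)
  from this[OF assms(1)] this[OF assms(2)]
  have small: "1 / (2 * real k) < 1 + 1 / (2 * real j)" "1 / (2 * real j) < 1 + 1 / (2 * real k)"
    by linarith+
  have "maslov_cocycle (x, par_b (- real j) \<circ> par_c k) = real CARD('h) *
      sgn (e * (1 - 2 * real k + 4 * i * real k) / (e * (- 2 * real k)) - (1 + 4 * i * real j) / (- 2 * real j))"
    by (rule maslov_cocycle_sl2[OF x(2) _ x(1) trans[OF 1 ac]])
      (use e assms(1,2) in \<open>simp_all add: Sp_mult_closed par_Sp\<close>)
  also have "1 / (2 * real k) < 1 + 1 / (2 * real j)"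
    using small by simp
  then have "sgn (e * (1 - 2 * real k + 4 * i * real k) / (e * (- 2 * real k)) - (1 + 4 * i * real j) / (- 2 * real j)) = 1"
    unfolding slope slope_x by simp
  finally show "maslov_cocycle (x, par_b (- real j) \<circ> par_c k) = real CARD('h)"
    by (simp only: mult_1_right)
  have "maslov_cocycle (x, par_b (- real j) \<circ> par_a (- 1) \<circ> par_c k) = real CARD('h) *
      sgn (e * (1 - 2 * real k + 4 * (i + 1) * real k) / (e * (- 2 * real k)) - (1 + 4 * i * real j) / (- 2 * real j))"
    by (rule maslov_cocycle_sl2[OF x(2) _ x(1) trans[OF 2 ac]])
      (use e assms(1,2) in \<open>simp_all add: Sp_mult_closed par_Sp\<close>)
  also have "1 / (2 * real j) < 1 + 1 / (2 * real k)"
    using small by simp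
  then have "sgn (e * (1 - 2 * real k + 4 * (i + 1) * real k) / (e * (- 2 * real k)) - (1 + 4 * i * real j) / (- 2 * real j)) = - 1"
    unfolding slope slope_x by (simp add: algebra_simps)
  finally show "maslov_cocycle (x, par_b (- real j) \<circ> par_a (- 1) \<circ> par_c k) = - real CARD('h)"
    by (simp only: mult_minus_right mult_1_right)
qed

text \<open>On each pair of simplices the values of \<open>c\<close> differ by at most
  \<open>2 * C\<close>, those of the Maslov cocycle by \<open>2 * h\<close>, and the discrepancy
  consists of differences of \<open>b\<close> on edges. Over \<open>N\<close> cubed index triples
  these telescope to at most \<open>12 * D\<close> times the square of \<open>N\<close>, which is
  negligible as \<open>N\<close> grows.\<close>

lemma sup_norm_ge_CARD:
  fixes c :: "('h::finite symp_space \<Rightarrow> 'h symp_space) \<times> 'h symp_map \<Rightarrow> real"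
  assumes c: "represents_class Sp c signature_class"
    and bound: "\<And>x y. x \<in> carrier Sp \<Longrightarrow> y \<in> carrier Sp \<Longrightarrow> \<bar>c (x, y)\<bar> \<le> C"
  shows "real CARD('h) \<le> C"
proof -
  define h where "h = real CARD('h)"
  define D where "D = C + h"
  define d where "d p = c p - maslov_cocycle p" for p
  note mc [simp] = Sp_mult_closed par_Sp
  have d_bound: "\<bar>d (x, y)\<bar> \<le> D" if "x \<in> carrier Sp" "y \<in> carrier Sp" for x y
    using bound[OF that] abs_maslov_cocycle_le[OF that] by (simp add: d_def D_def h_def)
  have d0: "cochain_eval d z = 0" if z: "z \<in> bar_cycles Sp" for z
  proof -
    obtain X where "X \<in> carrier (bar_H2 Sp)" "z \<in> X" using bar_cycle_mem_class[OF group_Sp z] by blast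
    then have "cochain_eval c z = signature_class X" "cochain_eval maslov_cocycle z = signature_class X"
      using c represents_maslov_cocycle unfolding represents_class_def by blast+
    moreover have "d = (\<lambda>p. c p - maslov_cocycle p)" by (simp add: d_def fun_eq_iff)
    ultimately show ?thesis by (simp add: cochain_eval_diff_left)
  qed
  obtain b P where P: "\<And>x y. x \<in> P \<Longrightarrow> y \<in> P \<Longrightarrow> x \<circ> y \<in> P"
    and b: "\<And>x y. x \<in> P \<Longrightarrow> y \<in> P \<Longrightarrow> d (x, y) = b x + b y - b (x \<circ> y)"
    and comm: "\<And>x y g. x \<in> carrier Sp \<Longrightarrow> y \<in> carrier Sp \<Longrightarrow> g \<in> carrier Sp \<Longrightarrow>
       x \<circ> y \<circ> g = g \<circ> y \<Longrightarrow> x \<in> P \<and> b x = d (x, y) - d (g, y) + d (x \<circ> y, g)"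
    by (rule exists_primitive_on_commutators[OF group_Sp d0, unfolded Sp_simps], assumption, rule that)
  have comm_bound: "x \<in> P \<and> \<bar>b x\<bar> \<le> 3 * D"
    if "x \<in> carrier Sp" "y \<in> carrier Sp" "g \<in> carrier Sp" "x \<circ> y \<circ> g = g \<circ> y" for x y g
    using comm[OF that] d_bound[OF that(1,2)] d_bound[OF that(3,2)] d_bound[OF Sp_mult_closed[OF that(1,2)] that(3)]
    by auto
  \<comment> \<open>Conjugation by the diagonal matrix with entries 2 and 1/2 multiplies the
    parameter by 4, and 4/3 - 1/3 = 1; the next claim uses its inverse.\<close>
  have aP: "par_a i \<in> P \<and> \<bar>b (par_a i)\<bar> \<le> 3 * D" for i
    by (rule comm_bound[of _ "par_a (i / 3)" "sl2 2 0 0 (1 / 2)"])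
      (simp_all add: sl2_Sp, simp add: par_a_def sl2_comp)
  have bP: "par_b j \<in> P \<and> \<bar>b (par_b j)\<bar> \<le> 3 * D" for j
    by (rule comm_bound[of _ "par_b (j / 3)" "sl2 (1 / 2) 0 0 2"])
      (simp_all add: sl2_Sp, simp add: par_b_def sl2_comp)
  \<comment> \<open>The same device at the cusp 1: the conjugating matrix has (1, 1) as eigenvector
    for the eigenvalue 2, and \<open>s\<close> is a third of the parameter \<open>4 * k\<close> of
    the even power.\<close>
  have c2: "\<bar>b (par_c (2 * k))\<bar> \<le> 3 * D" for k
  proof -
    define s where "s = 4 * real k / 3"
    have "par_c (2 * k) \<circ> sl2 (1 - s) s (- s) (1 + s) \<circ> sl2 2 0 (3 / 2) (1 / 2) =
        (sl2 2 0 (3 / 2) (1 / 2) \<circ> sl2 (1 - s) s (- s) (1 + s) :: 'h symp_space \<Rightarrow> _)"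
      unfolding par_c_def sl2_comp by (rule sl2_cong) (simp_all add: s_def field_simps)
    then show ?thesis
      by (intro comm_bound[THEN conjunct2, of _ "sl2 (1 - s) s (- s) (1 + s)" "sl2 2 0 (3 / 2) (1 / 2)"])
        (simp_all add: sl2_Sp algebra_simps)
  qed
  \<comment> \<open>Odd powers belong to \<open>P\<close> as well, since \<open>c\<close> is a
    product of inverses of \<open>b\<close> and \<open>a\<close>; the bound in \<open>c2\<close>
    concerns even powers only.\<close>
  have cP: "par_c k \<in> P" for k
  proof (induction k)
    case 0
    show ?case using aP[of 0] unfolding par_0 by (rule conjunct1)
  next
    case (Suc k)
    have "par_c k \<circ> (par_b (- 1) \<circ> par_a (- 1)) \<in> P" using Suc aP bP P by blast
    then show ?case by (simp add: par_comp)
  qed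
  define E where "E i k = b (par_a (- real i) \<circ> par_c k)" for i k :: nat
  define F where "F j k = b (par_b (- real j) \<circ> par_c k)" for j k :: nat
  have E0: "\<bar>E 0 k - E N k\<bar> \<le> 4 * D" for N k
    using b[of "par_a (- real N)" "par_c k"] aP[of "- real N"] cP[of k]
      d_bound[of "par_a (- real N)" "par_c k"] by (simp add: E_def par_0) linarith
  have F0: "\<bar>F N k - F 0 k\<bar> \<le> 4 * D" for N k
    using b[of "par_b (- real N)" "par_c k"] bP[of "- real N"] cP[of k]
      d_bound[of "par_b (- real N)" "par_c k"] by (simp add: F_def par_0) linarith
  have F1: "\<bar>F j 1 - F j (Suc (2 * M))\<bar> \<le> 4 * D" for j M
  proof -
    have "(par_b (- real j) :: 'h symp_space \<Rightarrow> _) \<circ> par_c (Suc (2 * M)) = par_b (- real j) \<circ> par_c 1 \<circ> par_c (2 * M)"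
      by (simp add: o_assoc[symmetric] par_comp)
    then have e: "F j (Suc (2 * M)) = b (par_b (- real j) \<circ> par_c 1 \<circ> par_c (2 * M))"
      by (simp only: F_def)
    have "d (par_b (- real j) \<circ> par_c 1, par_c (2 * M)) = F j 1 + b (par_c (2 * M)) - F j (Suc (2 * M))"
      unfolding e unfolding F_def by (rule b[OF P[OF conjunct1[OF bP] cP] cP])
    moreover have "\<bar>d (par_b (- real j) \<circ> par_c 1, par_c (2 * M))\<bar> \<le> D"
      by (rule d_bound) simp_all
    ultimately show ?thesis using c2[of M] by linarith
  qed
  \<comment> \<open>The two simplices share the edge \<open>x\<close>, so \<open>b x\<close> drops
    out of the difference. The remaining edges of the second one are shifts of those of the first:
    \<open>E\<close> moves by one in \<open>i\<close>, and since the inverse of \<open>a\<close> is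
    \<open>b c\<close>, \<open>F\<close> moves from \<open>(j + 1, k + 1)\<close> to
    \<open>(j, k + 2)\<close>.\<close>
  have step: "2 * h + (F (Suc j) (Suc k) - F j (Suc (Suc k))) - (E i (Suc k) - E (Suc i) (Suc k)) \<le> 2 * C" for i j k :: nat
  proof -
    define x where "x = par_a (- real i) \<circ> (par_b (real (Suc j)) :: 'h symp_space \<Rightarrow> _)"
    define y where "y = par_b (- real (Suc j)) \<circ> (par_c (Suc k) :: 'h symp_space \<Rightarrow> _)"
    define y' where "y' = par_b (- real (Suc j)) \<circ> par_a (- 1) \<circ> (par_c (Suc k) :: 'h symp_space \<Rightarrow> _)"
    have Sp: "x \<in> carrier Sp" "y \<in> carrier Sp" "y' \<in> carrier Sp" by (simp_all add: x_def y_def y'_def)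
    have xyP: "x \<in> P" "y \<in> P" "y' \<in> P" using aP bP cP P by (simp_all add: x_def y_def y'_def)
    have m: "maslov_cocycle (x, y) = h" "maslov_cocycle (x, y') = - h"
      using maslov_cocycle_par[of "Suc j" "Suc k" "real i", where 'h = 'h] by (simp_all add: x_def y_def y'_def h_def del: of_nat_Suc)
    have bb: "par_b (real (Suc j)) \<circ> par_b (- real (Suc j)) = (id :: 'h symp_space \<Rightarrow> _)"
      by (simp add: par_comp par_0)
    have "x \<circ> y = par_a (- real i) \<circ> (par_b (real (Suc j)) \<circ> par_b (- real (Suc j))) \<circ> par_c (Suc k)"
      by (simp add: x_def y_def o_assoc)
    then have xy: "x \<circ> y = par_a (- real i) \<circ> par_c (Suc k)" unfolding bb by simp
    have "x \<circ> y' = par_a (- real i) \<circ> (par_b (real (Suc j)) \<circ> par_b (- real (Suc j))) \<circ> par_a (- 1) \<circ> par_c (Suc k)"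
      by (simp add: x_def y'_def o_assoc)
    then have xy': "x \<circ> y' = par_a (- real (Suc i)) \<circ> par_c (Suc k)"
    proof -
      have "- real (Suc i) = - real i + - 1" by simp
      then show ?thesis
        using \<open>x \<circ> y' = _\<close> unfolding bb comp_id by (simp only: par_comp)
    qed
    have "y' = par_b (- real (Suc j)) \<circ> par_b 1 \<circ> (par_c 1 \<circ> par_c (Suc k))"
      unfolding y'_def par_comp(5)[symmetric] by (simp only: o_assoc)
    then have y': "y' = par_b (- real j) \<circ> par_c (Suc (Suc k))" by (simp add: par_comp)
    have "d (x, y) = b x + F (Suc j) (Suc k) - E i (Suc k)"
      using b[OF xyP(1,2)] unfolding xy by (simp add: y_def F_def E_def)
    moreover have "d (x, y') = b x + F j (Suc (Suc k)) - E (Suc i) (Suc k)"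
      using b[OF xyP(1,3)] unfolding xy' by (simp add: y' F_def E_def)
    moreover have "c (x, y) - c (x, y') \<le> 2 * C"
      using bound[OF Sp(1,2)] bound[OF Sp(1,3)] by simp
    ultimately show ?thesis using m by (simp add: d_def)
  qed
  have "(h - C) * real M \<le> 3 * D" for M
  proof (cases "M = 0")
    case True
    then show ?thesis using order_trans[OF abs_ge_zero d_bound[OF par_Sp(1) par_Sp(1)]] by simp
  next
    case False
    \<comment> \<open>Even, because \<open>F1\<close> compares the powers 1 and \<open>Suc N\<close>
      of \<open>c\<close>, whose quotient has to be unipotent.\<close>
    define N where "N = 2 * M"
    have "(\<Sum>i<N. \<Sum>j<N. \<Sum>k<N. 2 * h + (F (Suc j) (Suc k) - F j (Suc (Suc k))) - (E i (Suc k) - E (Suc i) (Suc k)))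
       \<le> (\<Sum>i<N. \<Sum>j<N. \<Sum>k<N. 2 * C)"
      by (intro sum_mono step)
    also have "\<dots> = real N * (real N * (real N * (2 * C)))" by simp
    also have "(\<Sum>i<N. \<Sum>j<N. \<Sum>k<N. 2 * h + (F (Suc j) (Suc k) - F j (Suc (Suc k))) - (E i (Suc k) - E (Suc i) (Suc k)))
       = real N * (real N * (real N * (2 * h))) + real N * (\<Sum>j<N. \<Sum>k<N. F (Suc j) (Suc k) - F j (Suc (Suc k)))
         - real N * (\<Sum>i<N. \<Sum>k<N. E i (Suc k) - E (Suc i) (Suc k))"
      by (simp add: sum.distrib sum_subtractf sum_distrib_left[symmetric] right_diff_distrib distrib_left)
    finally have main: "real N * (real N * (real N * (2 * h))) + real N * (\<Sum>j<N. \<Sum>k<N. F (Suc j) (Suc k) - F j (Suc (Suc k)))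
         - real N * (\<Sum>i<N. \<Sum>k<N. E i (Suc k) - E (Suc i) (Suc k)) \<le> real N * (real N * (real N * (2 * C)))" .
    have "(\<Sum>i<N. \<Sum>k<N. E i (Suc k) - E (Suc i) (Suc k)) = (\<Sum>k<N. E 0 (Suc k) - E N (Suc k))"
      by (subst sum.swap) (simp only: sum_lessThan_telescope'[where f = "\<lambda>i. E i (Suc k)" for k])
    also have "\<dots> \<le> (\<Sum>k<N. 4 * D)" using E0 by (intro sum_mono) (simp add: abs_le_iff)
    finally have 1: "(\<Sum>i<N. \<Sum>k<N. E i (Suc k) - E (Suc i) (Suc k)) \<le> real N * (4 * D)" by simp
    \<comment> \<open>\<open>F\<close> moves diagonally; inserting \<open>F j (Suc k)\<close> splits
      this into a move in \<open>j\<close> and a move in \<open>k\<close>, each of which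
      telescopes.\<close>
    have "(\<Sum>j<N. \<Sum>k<N. F (Suc j) (Suc k) - F j (Suc (Suc k))) =
        (\<Sum>j<N. \<Sum>k<N. F (Suc j) (Suc k) - F j (Suc k)) + (\<Sum>j<N. \<Sum>k<N. F j (Suc k) - F j (Suc (Suc k)))"
      by (simp flip: sum.distrib)
    also have "(\<Sum>j<N. \<Sum>k<N. F (Suc j) (Suc k) - F j (Suc k)) = (\<Sum>k<N. F N (Suc k) - F 0 (Suc k))"
      by (subst sum.swap) (simp only: sum_lessThan_telescope[where f = "\<lambda>j. F j (Suc k)" for k])
    also have "(\<Sum>j<N. \<Sum>k<N. F j (Suc k) - F j (Suc (Suc k))) = (\<Sum>j<N. F j 1 - F j (Suc N))"
      by (simp only: sum_lessThan_telescope'[where f = "\<lambda>k. F j (Suc k)" for j] One_nat_def)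
    finally have "(\<Sum>j<N. \<Sum>k<N. F (Suc j) (Suc k) - F j (Suc (Suc k))) =
        (\<Sum>k<N. F N (Suc k) - F 0 (Suc k)) + (\<Sum>j<N. F j 1 - F j (Suc N))" .
    moreover have "(\<Sum>k<N. - (4 * D)) \<le> (\<Sum>k<N. F N (Suc k) - F 0 (Suc k))"
    proof (rule sum_mono)
      show "- (4 * D) \<le> F N (Suc k) - F 0 (Suc k)" for k using F0[of N "Suc k"] by linarith
    qed
    moreover have "(\<Sum>k<N. - (4 * D)) \<le> (\<Sum>j<N. F j 1 - F j (Suc N))"
    proof (rule sum_mono)
      show "- (4 * D) \<le> F j 1 - F j (Suc N)" for j using F1[of j M] unfolding N_def by linarith
    qed
    ultimately have 2: "- (real N * (8 * D)) \<le> (\<Sum>j<N. \<Sum>k<N. F (Suc j) (Suc k) - F j (Suc (Suc k)))" by simp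
    have "real N * (real N * (real N * (2 * h))) + real N * (- (real N * (8 * D))) - real N * (real N * (4 * D))
        \<le> real N * (real N * (real N * (2 * C)))"
      using main mult_left_mono[OF 1, of "real N"] mult_left_mono[OF 2, of "real N"] by linarith
    then have "(real N * real N) * (2 * ((h - C) * real N)) \<le> (real N * real N) * (12 * D)"
      by (simp add: algebra_simps)
    then have "2 * ((h - C) * real N) \<le> 12 * D"
      using False by (simp add: N_def)
    then show ?thesis by (simp add: N_def mult.commute)
  qed
  note M = this
  show ?thesis
  proof (rule ccontr)
    assume "\<not> real CARD('h) \<le> C"
    then have pos: "0 < h - C" by (simp add: h_def)
    then obtain M where "3 * D < real M * (h - C)" using reals_Archimedean3 by blast
    then show False using M[of M] by (simp add: mult.commute)
  qed
qed

theorem mainTheorem5: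
  shows "gromov_norm (Sp :: ('h::finite symp_space \<Rightarrow> 'h symp_space) monoid) signature_class
           = of_nat CARD('h)"
proof (rule antisym)
  have h: "of_nat CARD('h) = ennreal (real CARD('h))" by (simp add: ennreal_of_nat_eq_real_of_nat)
  have "gromov_norm (Sp :: 'h symp_map monoid) signature_class
      \<le> (SUP p\<in>carrier Sp \<times> carrier Sp. ennreal \<bar>maslov_cocycle (p :: 'h symp_map \<times> _)\<bar>)"
    unfolding gromov_norm_def using represents_maslov_cocycle by (intro INF_lower) simp
  also have "\<dots> \<le> of_nat CARD('h)"
    unfolding h using abs_maslov_cocycle_le by (intro SUP_least ennreal_leI) auto
  finally show "gromov_norm (Sp :: 'h symp_map monoid) signature_class \<le> of_nat CARD('h)" .
  show "of_nat CARD('h) \<le> gromov_norm (Sp :: 'h symp_map monoid) signature_class"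
    unfolding gromov_norm_def
  proof (rule INF_greatest)
    fix c :: "'h symp_map \<times> 'h symp_map \<Rightarrow> real"
    assume c: "c \<in> {c. represents_class Sp c signature_class}"
    let ?s = "SUP p\<in>carrier Sp \<times> carrier Sp. ennreal \<bar>c p\<bar>"
    show "of_nat CARD('h) \<le> ?s"
    proof (cases ?s)
      case (real C)
      have "\<bar>c (x, y)\<bar> \<le> C" if "x \<in> carrier Sp" "y \<in> carrier Sp" for x y
      proof -
        have "ennreal \<bar>c (x, y)\<bar> \<le> ?s" by (rule SUP_upper) (use that in simp)
        then show ?thesis using real by simp
      qed
      then have "real CARD('h) \<le> C" using c by (intro sup_norm_ge_CARD[of c]) auto
      then show ?thesis using real h by (simp add: ennreal_leI)
    next
      case top
      show ?thesis unfolding top by simp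
    qed
  qed
qed

end
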